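(* Let $\lambda$ be an infinite cardinal and let the vocabulary $\tau$ be $\{F\}\cup\{P_i:i<\lambda\}$, where $F$ is a unary function symbol and the $P_i$ are unary predicates. (A) If a sentence $\psi\in\mathbb{L}_{\lambda^+,\lambda^+}(\tau)$ has models in arbitrarily large cardinalities $<\beth_{\lambda^+}$ (in fact it suffices that $\psi$ has a model of cardinality $>\beth_{\mathrm{q.d.}(\psi)+1}(\lambda)$), then $\psi$ has models in arbitrarily large cardinalities (in fact, in every cardinality above $\beth_{\mathrm{q.d.}(\psi)+1}(\lambda)$). (B) If a theory $T\subseteq\mathbb{L}_{\lambda^+,\lambda^+}(\tau)$ has a model of cardinality $>\beth_{\lambda^+}$, then $T$ has models in arbitrarily large cardinalities.
   Context: $\mathbb{L}_{\lambda^+,\lambda^+}(\tau)$ is the infinitary logic (with equality) allowing conjunctions and disjunctions of at most $\lambda$ formulas and quantification over strings of at most $\lambda$ variables. $\mathrm{q.d.}(\psi)$ denotes the quantifier depth of $\psi$ (an ordinal $<\lambda^+$; each block of quantifiers of one kind adds one). The beth function is defined by $\beth_\alpha(\mu)=\mu+\sum_{\beta<\alpha}2^{\beth_\beta(\mu)}$ and $\beth_\alpha=\beth_\alpha(\aleph_0)$. *)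

theory Defs
  imports Main
begin

unbundle cardinal_syntax

text \<open>
  The cardinal \<open>\<lambda>\<close> is the cardinality of an infinite type \<open>'l\<close>, which also serves as the set of
  indices of the predicates \<open>P\<^sub>i\<close>. The variables of the language range over an arbitrary type \<open>'v\<close>.
\<close>

datatype 'v trm = Var 'v | F "'v trm"

text \<open>
  A family of at most \<open>\<lambda>\<close> objects is given by a set \<open>I\<close> of indices in \<open>'l\<close> and a function on \<open>'l\<close>
  of which only the values on \<open>I\<close> matter. Thus \<open>Conj I f\<close> is the conjunction of the formulas
  \<open>f i\<close> (\<open>i \<in> I\<close>), and \<open>Ex I v \<phi>\<close> quantifies over the string of the variables \<open>v i\<close> (\<open>i \<in> I\<close>).
\<close>

datatype (discs_sels) ('l, 'v) fm =
    Eq "'v trm" "'v trm"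
  | P 'l "'v trm"
  | Neg "('l, 'v) fm"
  | Conj "'l set" "'l \<Rightarrow> ('l, 'v) fm"
  | Disj "'l set" "'l \<Rightarrow> ('l, 'v) fm"
  | Ex "'l set" "'l \<Rightarrow> 'v" "('l, 'v) fm"
  | All "'l set" "'l \<Rightarrow> 'v" "('l, 'v) fm"

primrec fv_trm :: "'v trm \<Rightarrow> 'v set" where
  "fv_trm (Var x) = {x}"
| "fv_trm (F t) = fv_trm t"

primrec fv :: "('l, 'v) fm \<Rightarrow> 'v set" where
  "fv (Eq s t) = fv_trm s \<union> fv_trm t"
| "fv (P i t) = fv_trm t"
| "fv (Neg \<phi>) = fv \<phi>"
| "fv (Conj I f) = (\<Union>i\<in>I. fv (f i))"
| "fv (Disj I f) = (\<Union>i\<in>I. fv (f i))"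
| "fv (Ex I v \<phi>) = fv \<phi> - v ` I"
| "fv (All I v \<phi>) = fv \<phi> - v ` I"

definition sentence :: "('l, 'v) fm \<Rightarrow> bool" where
  "sentence \<phi> \<longleftrightarrow> fv \<phi> = {}"

record ('l, 'm) struc =
  univ :: "'m set"
  fn :: "'m \<Rightarrow> 'm"
  pr :: "'l \<Rightarrow> 'm set"

definition is_struc :: "('l, 'm) struc \<Rightarrow> bool" where
  "is_struc S \<longleftrightarrow> univ S \<noteq> {} \<and> fn S ` univ S \<subseteq> univ S \<and> (\<forall>i. pr S i \<subseteq> univ S)"

primrec eval_trm :: "('l, 'm) struc \<Rightarrow> ('v \<Rightarrow> 'm) \<Rightarrow> 'v trm \<Rightarrow> 'm" where
  "eval_trm S e (Var x) = e x"
| "eval_trm S e (F t) = fn S (eval_trm S e t)"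

primrec sat :: "('l, 'm) struc \<Rightarrow> ('v \<Rightarrow> 'm) \<Rightarrow> ('l, 'v) fm \<Rightarrow> bool" where
  "sat S e (Eq s t) \<longleftrightarrow> eval_trm S e s = eval_trm S e t"
| "sat S e (P i t) \<longleftrightarrow> eval_trm S e t \<in> pr S i"
| "sat S e (Neg \<phi>) \<longleftrightarrow> \<not> sat S e \<phi>"
| "sat S e (Conj I f) \<longleftrightarrow> (\<forall>i\<in>I. sat S e (f i))"
| "sat S e (Disj I f) \<longleftrightarrow> (\<exists>i\<in>I. sat S e (f i))"
| "sat S e (Ex I v \<phi>) \<longleftrightarrow>
     (\<exists>e'. range e' \<subseteq> univ S \<and> (\<forall>x. x \<notin> v ` I \<longrightarrow> e' x = e x) \<and> sat S e' \<phi>)"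
| "sat S e (All I v \<phi>) \<longleftrightarrow>
     (\<forall>e'. range e' \<subseteq> univ S \<and> (\<forall>x. x \<notin> v ` I \<longrightarrow> e' x = e x) \<longrightarrow> sat S e' \<phi>)"

definition models :: "('l, 'm) struc \<Rightarrow> ('l, 'v) fm set \<Rightarrow> bool" where
  "models S T \<longleftrightarrow> is_struc S \<and> (\<forall>\<phi>\<in>T. \<forall>e. range e \<subseteq> univ S \<longrightarrow> sat S e \<phi>)"


text \<open>
  The type \<open>'l ord_below\<close> consists of the ordinals below \<open>\<lambda>\<^sup>+\<close>: it is well-ordered in the order type
  of the initial ordinal \<open>cardSuc |UNIV :: 'l set|\<close>.
\<close>

lemma Card_order_lambda_plus: "Card_order (cardSuc |UNIV :: 'l set| )"
  by (simp add: cardSuc_Card_order card_of_Card_order)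

typedef 'l ord_below = "Field (cardSuc |UNIV :: 'l set| )"
proof -
  let ?r = "cardSuc |UNIV :: 'l set|"
  have less: "|UNIV :: 'l set| <o ?r"
    by (simp add: cardSuc_greater card_of_Card_order)
  have "Field ?r \<noteq> {}"
  proof
    assume "Field ?r = {}"
    then have "|Field ?r| \<le>o |UNIV :: 'l set|"
      by (simp add: card_of_empty)
    with card_of_Field_ordIso[OF Card_order_lambda_plus] have "?r \<le>o |UNIV :: 'l set|"
      using ordIso_ordLeq_trans ordIso_symmetric by blast
    with less show False using not_ordLess_ordLeq by blast
  qed
  then show ?thesis by blast
qed

instantiation ord_below :: (type) wellorder
begin

definition less_eq_ord_below :: "'a ord_below \<Rightarrow> 'a ord_below \<Rightarrow> bool" where
  "x \<le> y \<longleftrightarrow> (Rep_ord_below x, Rep_ord_below y) \<in> cardSuc |UNIV :: 'a set|"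

definition less_ord_below :: "'a ord_below \<Rightarrow> 'a ord_below \<Rightarrow> bool" where
  "x < y \<longleftrightarrow> (x::'a ord_below) \<le> y \<and> x \<noteq> y"

instance
proof -
  let ?r = "cardSuc |UNIV :: 'a set|"
  have wo: "Well_order ?r"
    using Card_order_lambda_plus card_order_on_def by blast
  then have refl: "refl_on (Field ?r) ?r" and trans: "trans ?r" and antisym: "antisym ?r"
    and total: "total_on (Field ?r) ?r" and wf: "wf (?r - Id)"
    by (auto simp: well_order_on_def linear_order_on_def partial_order_on_def preorder_on_def)
  have anti: "x = y" if "x \<le> y" "y \<le> x" for x y :: "'a ord_below"
    using that antisym by (auto simp: less_eq_ord_below_def antisym_def simp flip: Rep_ord_below_inject)
  show "OFCLASS('a ord_below, wellorder_class)"
  proof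
    fix x y z :: "'a ord_below"
    show "x < y \<longleftrightarrow> x \<le> y \<and> \<not> y \<le> x"
      using anti refl Rep_ord_below[of x]
      by (auto simp: less_ord_below_def less_eq_ord_below_def refl_on_def)
    show "x \<le> x"
      using refl Rep_ord_below[of x] by (auto simp: less_eq_ord_below_def refl_on_def)
    show "x \<le> y \<Longrightarrow> y \<le> z \<Longrightarrow> x \<le> z"
      using trans by (auto simp: less_eq_ord_below_def elim: transE)
    show "x \<le> y \<Longrightarrow> y \<le> x \<Longrightarrow> x = y" by (rule anti)
    show "x \<le> y \<or> y \<le> x"
      using total refl Rep_ord_below[of x] Rep_ord_below[of y]
      by (cases "x = y") (auto simp: less_eq_ord_below_def total_on_def refl_on_def Rep_ord_below_inject)
  next
    fix Q :: "'a ord_below \<Rightarrow> bool" and a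
    assume step: "\<And>x. (\<And>y. y < x \<Longrightarrow> Q y) \<Longrightarrow> Q x"
    have "wf (inv_image (?r - Id) Rep_ord_below)" using wf by (rule wf_inv_image)
    moreover have "inv_image (?r - Id) Rep_ord_below = {(x, y). x < y}"
      by (auto simp: inv_image_def less_ord_below_def less_eq_ord_below_def Rep_ord_below_inject)
    ultimately have "wf {(x, y :: 'a ord_below). x < y}" by simp
    then show "Q a" by (induction a rule: wf_induct_rule) (use step in auto)
  qed
qed

end

definition ord_zero :: "'o :: wellorder" where
  "ord_zero = (LEAST y. True)"

definition ord_suc :: "'o :: wellorder \<Rightarrow> 'o" where
  "ord_suc x = (LEAST y. x < y)"

definition ord_sup :: "'i set \<Rightarrow> ('i \<Rightarrow> 'o :: wellorder) \<Rightarrow> 'o" where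
  "ord_sup I f = (LEAST y. \<forall>i\<in>I. f i \<le> y)"

text \<open>
  If \<open>'l\<close> is infinite, successors and suprema of at most \<open>\<lambda>\<close> ordinals exist below the
  regular cardinal \<open>\<lambda>\<^sup>+\<close>, so that the least elements above are not vacuous.
\<close>

lemma ord_below_bounded:
  fixes f :: "'l \<Rightarrow> 'l ord_below"
  assumes inf: "infinite (UNIV :: 'l set)"
  shows "\<exists>y. \<forall>i. f i < y"
proof (rule ccontr)
  let ?r = "cardSuc |UNIV :: 'l set|"
  let ?K = "Rep_ord_below ` range f"
  assume "\<not> ?thesis"
  then have cof: "\<forall>y. \<exists>i. y \<le> f i" by (metis not_less)
  have reg: "regularCard ?r"
    by (rule infinite_cardSuc_regularCard) (use inf in \<open>auto simp: card_of_card_order_on Field_card_of\<close>)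
  have "Card_order ?r" by (rule Card_order_lambda_plus)
  moreover have "\<not> finite (Field ?r)"
    using inf cardSuc_finite[OF card_of_Card_order] Field_card_of by metis
  ultimately have cinf: "cinfinite ?r" by (simp add: cinfinite_def)
  have "?K \<subseteq> Field ?r" using Rep_ord_below by auto
  moreover have "cofinal ?K ?r"
    unfolding cofinal_def
  proof
    fix a assume a: "a \<in> Field ?r"
    obtain y where y: "Abs_ord_below a < y"
    proof -
      have "\<exists>b\<in>Field ?r. a \<noteq> b \<and> (a, b) \<in> ?r"
        using infinite_Card_order_limit[OF Card_order_lambda_plus] cinf a
        by (auto simp: cinfinite_def)
      then obtain b where "b \<in> Field ?r" "a \<noteq> b" "(a, b) \<in> ?r" by blast
      then have "Abs_ord_below a < Abs_ord_below b"
        using a by (simp add: less_ord_below_def less_eq_ord_below_def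
            Abs_ord_below_inverse Abs_ord_below_inject)
      then show ?thesis by (rule that)
    qed
    obtain i where "y \<le> f i" using cof by blast
    with y have "Abs_ord_below a < f i" by simp
    then show "\<exists>b\<in>?K. a \<noteq> b \<and> (a, b) \<in> ?r"
      using a by (intro bexI[of _ "Rep_ord_below (f i)"])
        (auto simp: less_ord_below_def less_eq_ord_below_def Abs_ord_below_inverse Rep_ord_below_inverse)
  qed
  ultimately have "|?K| =o ?r" using reg by (auto simp: regularCard_def)
  moreover have "|?K| \<le>o |UNIV :: 'l set|"
    using card_of_image[of "Rep_ord_below \<circ> f" "UNIV :: 'l set"] by (simp add: image_comp)
  moreover have "|UNIV :: 'l set| <o ?r" by (simp add: cardSuc_greater card_of_Card_order)
  ultimately show False
    by (meson not_ordLess_ordLeq ordIso_ordLeq_trans ordIso_symmetric)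
qed

text \<open>
  Immediately nested quantifiers of one kind form one block, hence they count once.
\<close>

primrec qd :: "('l, 'v) fm \<Rightarrow> 'l ord_below" where
  "qd (Eq s t) = ord_zero"
| "qd (P i t) = ord_zero"
| "qd (Neg \<phi>) = qd \<phi>"
| "qd (Conj I f) = ord_sup I (\<lambda>i. qd (f i))"
| "qd (Disj I f) = ord_sup I (\<lambda>i. qd (f i))"
| "qd (Ex I v \<phi>) = (if is_Ex \<phi> then qd \<phi> else ord_suc (qd \<phi>))"
| "qd (All I v \<phi>) = (if is_All \<phi> then qd \<phi> else ord_suc (qd \<phi>))"


text \<open>
  Let \<open>A\<close> be an initial segment of a well-ordered type, of order type \<open>\<alpha>\<close>. Then \<open>is_beth \<mu> A K\<close>
  says that \<open>K\<close> has cardinality \<open>\<beth>\<^sub>\<alpha>(|\<mu>|)\<close>, where the cardinals \<open>\<beth>\<^sub>\<beta>(|\<mu>|)\<close> (\<open>\<beta> < \<alpha>\<close>) are represented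
  by subsets \<open>B \<beta>\<close> of the type of \<open>K\<close>; this is no restriction, as they are at most \<open>|K|\<close>. The
  recursion equation is \<open>\<beth>\<^sub>\<beta>(\<mu>) = \<mu> + (\<Sum>\<gamma><\<beta>. 2 ^ \<beth>\<^sub>\<gamma>(\<mu>))\<close>; the disjoint union of power sets
  represents the sum. If the type of \<open>K\<close> is smaller than \<open>\<beth>\<^sub>\<alpha>(|\<mu>|)\<close>, no \<open>K\<close> qualifies.
\<close>

definition is_beth :: "'a set \<Rightarrow> 'o :: wellorder set \<Rightarrow> 'k set \<Rightarrow> bool" where
  "is_beth \<mu> A K \<longleftrightarrow>
     (\<exists>B :: 'o \<Rightarrow> 'k set.
        (\<forall>\<beta>\<in>A. |B \<beta>| =o |\<mu>| +c |SIGMA \<gamma>:{..<\<beta>}. Pow (B \<gamma>)| ) \<and>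
        |K| =o |\<mu>| +c |SIGMA \<gamma>:A. Pow (B \<gamma>)| )"

text \<open>\<open>|X| > \<beth>\<^sub>\<alpha>(|\<mu>|)\<close>, where a set of cardinality \<open>\<beth>\<^sub>\<alpha>(|\<mu>|)\<close> can be found in the type of \<open>X\<close>.\<close>

definition above_beth :: "'a set \<Rightarrow> 'o :: wellorder set \<Rightarrow> 'k set \<Rightarrow> bool" where
  "above_beth \<mu> A X \<longleftrightarrow> (\<exists>K :: 'k set. is_beth \<mu> A K \<and> |K| <o |X| )"

end

theory Submission
  imports Defs
begin

text \<open>
  A unary function and unary predicates see a structure as a system of trees and cycles, and such a
  system falls into pieces as soon as it is large. Let \<open>S\<close> be a structure with more than \<open>\<kappa>\<close>
  elements. Either some element \<open>a\<close> has more than \<open>\<kappa>\<close> immediate predecessors, and then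
  the trees above those predecessors that are outside the forward orbit of \<open>a\<close> are more than \<open>\<kappa>\<close> disjoint
  pieces, each of them attached to the rest only by \<open>F\<close> leading into \<open>a\<close>. Or all fibres have at
  most \<open>\<kappa>\<close> elements, so that the connected components have at most \<open>\<kappa>\<close> elements and there are more
  than \<open>\<kappa>\<close> of them; then the components other than that of an arbitrary \<open>a\<close> serve as pieces
  (\<open>many_pieces\<close>).

  Formulas of quantifier depth \<open>\<alpha>\<close> are replaced by back-and-forth equivalence. The \<open>\<alpha>\<close>-type of a
  \<open>\<lambda>\<close>-tuple consists of the atomic formulas that it satisfies and of the \<open>\<delta>\<close>-types of its extensions by
  \<open>\<lambda>\<close> further elements, for all \<open>\<delta> < \<alpha>\<close>. Thus an \<open>\<alpha>\<close>-type amounts to a subset of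
  \<open>\<lambda> + (\<Sum>\<delta><\<alpha>. 2 ^ \<beth>\<^sub>\<delta>(\<lambda>))\<close>, which has cardinality \<open>\<beth>\<^sub>\<alpha>(\<lambda>)\<close>, so that there are at most
  \<open>\<beth>\<^sub>\<alpha>\<^sub>+\<^sub>1(\<lambda>)\<close> of them; and tuples of equal \<open>\<alpha>\<close>-type satisfy the same formulas of depth at most \<open>\<alpha>\<close>
  (\<open>types_decide_formulas\<close>).

  If a structure consists of a core and of pieces hanging from a point \<open>a\<close> of the core, if all pieces have
  the same \<open>\<alpha>\<close>-type and if there are more than \<open>\<lambda>\<close> of them, then the \<open>\<alpha>\<close>-type of the whole is
  determined by the types of the core and of one piece (\<open>tp_eq_of_blocks\<close>): a play of the game touches
  at most \<open>\<lambda>\<close> pieces, so a fresh one is always available. With \<open>\<kappa> = \<beth>\<^sub>\<alpha>\<^sub>+\<^sub>1(\<lambda>)\<close> the pigeonhole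
  principle provides more than \<open>\<lambda>\<close> pieces of one type, and adding arbitrarily many copies of one of
  them does not change the \<open>\<alpha>\<close>-type of the structure (\<open>upward\<close>). For a model of an exactly
  prescribed cardinality, the core and the piece are first replaced by elementary substructures of
  cardinality at most \<open>\<beth>\<^sub>\<alpha>\<^sub>+\<^sub>1(\<lambda>)\<close> (\<open>exact_cardinality\<close>); these exist since
  \<open>\<beth>\<^sub>\<alpha>\<^sub>+\<^sub>1(\<lambda>) ^ \<lambda> = \<beth>\<^sub>\<alpha>\<^sub>+\<^sub>1(\<lambda>)\<close>.

  For a theory all \<open>\<alpha> < \<lambda>\<^sup>+\<close> matter at once. Let \<open>\<mu>\<close> be the value of the beth function at
  \<open>\<lambda>\<^sup>+\<close>, and let \<open>\<kappa> = \<mu>\<close>. A piece is exceptional if for some \<open>\<alpha>\<close> at most \<open>\<lambda>\<close> pieces share its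
  \<open>\<alpha>\<close>-type. There are at most \<open>\<lambda>\<^sup>+ \<cdot> \<mu> \<cdot> \<lambda> = \<mu>\<close> of these, so some piece is not exceptional, and it
  can be multiplied without changing any of the types (\<open>common_large_class\<close>).
\<close>

section \<open>Cardinal arithmetic\<close>

lemma card_le_total: "|X| \<le>o |Y| \<or> |Y| \<le>o |X|"
  by (rule ordLeq_total[OF card_of_Well_order card_of_Well_order])

lemma card_not_le_iff: "\<not> |X| \<le>o |Y| \<longleftrightarrow> |Y| <o |X|"
  by (rule not_ordLeq_iff_ordLess[OF card_of_Well_order card_of_Well_order])

lemma card_le_trans: "|X| \<le>o |Y| \<Longrightarrow> |Y| \<le>o |Z| \<Longrightarrow> |X| \<le>o |Z|"
  by (rule ordLeq_transitive)

lemma card_subset_le: "X \<subseteq> Y \<Longrightarrow> |Y| \<le>o |K| \<Longrightarrow> |X| \<le>o |K|"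
  using card_of_mono1 card_le_trans by metis

lemma card_of_image_le: "|X| \<le>o |K| \<Longrightarrow> |h ` X| \<le>o |K|"
  using card_of_image card_le_trans by metis

lemma card_nat_le: "infinite K \<Longrightarrow> |X :: nat set| \<le>o |K|"
  using infinite_iff_card_of_nat[of K] card_of_mono1[of X UNIV] card_le_trans by blast

lemma card_of_Un_le:
  assumes "infinite K" "|X| \<le>o |K|" "|Y| \<le>o |K|"
  shows "|X \<union> Y| \<le>o |K|"
  by (rule card_of_Un_ordLeq_infinite_Field) (use assms card_of_Card_order[of K] in \<open>simp_all add: Field_card_of\<close>)

lemma card_Plus_le:
  assumes "infinite K" "|X| \<le>o |K|" "|Y| \<le>o |K|"
  shows "|X <+> Y| \<le>o |K|"
  by (rule card_of_Plus_ordLeq_infinite_Field) (use assms card_of_Card_order[of K] in \<open>simp_all add: Field_card_of\<close>)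

lemma card_Times_le:
  assumes "infinite K" "|X| \<le>o |K|" "|Y| \<le>o |K|"
  shows "|X \<times> Y| \<le>o |K|"
  by (rule card_of_Sigma_ordLeq_infinite) (use assms in auto)

lemma card_Pow_mono: "|X| \<le>o |Y| \<Longrightarrow> |Pow X| \<le>o |Pow Y|"
proof -
  assume "|X| \<le>o |Y|"
  then obtain h where h: "inj_on h X" "h ` X \<subseteq> Y" using card_of_ordLeq by metis
  have "inj_on (image h) (Pow X)" using h(1) by (rule inj_on_image_Pow)
  moreover have "image h ` Pow X \<subseteq> Pow Y" using h(2) by auto
  ultimately show ?thesis using card_of_ordLeq by metis
qed

section \<open>Tuples\<close>

text \<open>
  As \<open>\<lambda> + \<lambda> = \<lambda>\<close>, two \<open>\<lambda>\<close>-tuples can be merged into one. All tuples in a play of the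
  back-and-forth game are therefore indexed by the same type \<open>'l\<close>, and the entries of a tuple keep a fixed
  place in all its extensions.
\<close>

definition halves :: "'l \<Rightarrow> 'l + 'l" where
  "halves = (SOME h. bij h)"

definition join :: "('l \<Rightarrow> 'm) \<Rightarrow> ('l \<Rightarrow> 'm) \<Rightarrow> 'l \<Rightarrow> 'm" where
  "join t u i = case_sum t u (halves i)"

definition fst_half :: "'l \<Rightarrow> 'l" where "fst_half i = inv halves (Inl i)"
definition snd_half :: "'l \<Rightarrow> 'l" where "snd_half i = inv halves (Inr i)"

lemma bij_halves:
  assumes "infinite (UNIV :: 'l set)"
  shows "bij (halves :: 'l \<Rightarrow> 'l + 'l)"
proof -
  have "|UNIV <+> UNIV :: ('l + 'l) set| =o |UNIV :: 'l set|"
    by (rule card_of_Plus_infinite1[OF assms card_of_mono1[OF subset_refl]])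
  then have "|UNIV :: 'l set| =o |UNIV :: ('l + 'l) set|"
    by (simp add: ordIso_symmetric)
  then have "\<exists>h :: 'l \<Rightarrow> 'l + 'l. bij h"
    using card_of_ordIso by blast
  then show ?thesis unfolding halves_def by (rule someI_ex)
qed

context
  assumes inf: "infinite (UNIV :: 'l set)"
begin

lemma halves_fst_half [simp]: "halves (fst_half (i :: 'l)) = Inl i"
  unfolding fst_half_def by (meson bij_halves[OF inf] bij_inv_eq_iff)

lemma halves_snd_half [simp]: "halves (snd_half (i :: 'l)) = Inr i"
  unfolding snd_half_def by (meson bij_halves[OF inf] bij_inv_eq_iff)

lemma join_fst_half [simp]: "join t u (fst_half (i :: 'l)) = t i"
  by (simp add: join_def)

lemma join_snd_half [simp]: "join t u (snd_half (i :: 'l)) = u i"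
  by (simp add: join_def)

end

lemma comp_join: "h \<circ> join t u = join (h \<circ> t) (h \<circ> u)"
  by (auto simp: join_def fun_eq_iff split: sum.split)

lemma join_const: "join (\<lambda>_. a) (\<lambda>_. a) = (\<lambda>_. a)"
  by (auto simp: join_def fun_eq_iff split: sum.split)

lemma range_join: "range t \<subseteq> U \<Longrightarrow> range u \<subseteq> U \<Longrightarrow> range (join t u) \<subseteq> U"
proof -
  assume "range t \<subseteq> U" "range u \<subseteq> U"
  then have "join t u i \<in> U" for i by (cases "halves i") (auto simp: join_def)
  then show "range (join t u) \<subseteq> U" by blast
qed

text \<open>
  Extending a reindexed tuple is reindexing the extended tuple, and the two ways of extending a tuple
  twice differ by a reindexing. The reindexing maps are explicit because they are used simultaneously for
  tuples of two structures over different types.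
\<close>

definition lift_index :: "('l \<Rightarrow> 'l) \<Rightarrow> 'l \<Rightarrow> 'l" where
  "lift_index \<rho> i = case_sum (\<lambda>k. fst_half (\<rho> k)) snd_half (halves i)"

lemma join_lift_index:
  assumes "infinite (UNIV :: 'l set)"
  shows "join (t \<circ> \<rho>) u = join t u \<circ> lift_index (\<rho> :: 'l \<Rightarrow> 'l)"
  using assms by (auto simp: fun_eq_iff join_def lift_index_def split: sum.split)

definition assoc_index :: "'l \<Rightarrow> 'l" where
  "assoc_index i = case_sum (\<lambda>k. fst_half (fst_half k))
     (\<lambda>k. case_sum (\<lambda>j. fst_half (snd_half j)) snd_half (halves k)) (halves i)"

lemma join_assoc:
  assumes "infinite (UNIV :: 'l set)"
  shows "join t (join u w) = join (join t u) w \<circ> (assoc_index :: 'l \<Rightarrow> 'l)"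
  using assms by (auto simp: fun_eq_iff join_def assoc_index_def split: sum.split)

section \<open>Types of tuples\<close>

datatype 'l atom = Same nat 'l nat 'l | Holds 'l nat 'l

definition true_atoms :: "('l, 'm) struc \<Rightarrow> ('l \<Rightarrow> 'm) \<Rightarrow> 'l atom set" where
  "true_atoms S t =
     {Same n i m j |n i m j. (fn S ^^ n) (t i) = (fn S ^^ m) (t j)} \<union>
     {Holds p n i |p n i. (fn S ^^ n) (t i) \<in> pr S p}"

lemma true_atoms_eq_iff:
  "true_atoms S t = true_atoms S' t' \<longleftrightarrow>
     (\<forall>n i m j. (fn S ^^ n) (t i) = (fn S ^^ m) (t j) \<longleftrightarrow> (fn S' ^^ n) (t' i) = (fn S' ^^ m) (t' j)) \<and>
     (\<forall>p n i. (fn S ^^ n) (t i) \<in> pr S p \<longleftrightarrow> (fn S' ^^ n) (t' i) \<in> pr S' p)"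
  (is "?L = ?R")
proof
  assume L: ?L
  have "Same n i m j \<in> true_atoms S t \<longleftrightarrow> Same n i m j \<in> true_atoms S' t'"
    "Holds p n i \<in> true_atoms S t \<longleftrightarrow> Holds p n i \<in> true_atoms S' t'" for n i m j p
    using L by auto
  then show ?R by (simp add: true_atoms_def)
qed (simp add: true_atoms_def)

text \<open>
  Types will be codes of disjoint unions; these two facts read the components back.
\<close>

lemma Plus_eq_iff: "(A <+> B = A' <+> B') \<longleftrightarrow> A = A' \<and> B = B'"
  by (auto simp: Plus_def set_eq_iff image_iff)

lemma Sigma_eq_iff: "Sigma I f = Sigma I g \<longleftrightarrow> (\<forall>i\<in>I. f i = g i)"
  by (auto simp: set_eq_iff)

text \<open>
  The set \<open>C \<gamma>\<close> plays the role of \<open>\<beth>\<^sub>\<gamma>(\<lambda>)\<close>. The injections \<open>code \<gamma>\<close> collapse the iterated power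
  sets in which the \<open>\<gamma>\<close>-types would naturally live, for ordinals \<open>\<gamma>\<close>, to subsets of the single type \<open>'k\<close>.
  The initial segment \<open>A\<close> collects the depths for which this type has enough room.
\<close>

locale coded_types =
  fixes A :: "'l ord_below set"
    and C :: "'l ord_below \<Rightarrow> 'k set"
    and code :: "'l ord_below \<Rightarrow> 'l atom + 'l ord_below \<times> 'k set \<Rightarrow> 'k"
  assumes infinite_index: "infinite (UNIV :: 'l set)"
    and A_down: "\<gamma> \<in> A \<Longrightarrow> \<delta> \<le> \<gamma> \<Longrightarrow> \<delta> \<in> A"
    and inj_code: "\<gamma> \<in> A \<Longrightarrow> inj_on (code \<gamma>) (UNIV <+> (SIGMA \<delta>:{..<\<gamma>}. Pow (C \<delta>)))"
    and code_into: "\<gamma> \<in> A \<Longrightarrow> code \<gamma> ` (UNIV <+> (SIGMA \<delta>:{..<\<gamma>}. Pow (C \<delta>))) \<subseteq> C \<gamma>"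
begin

context notes Sigma_cong [fundef_cong]
begin

function tp :: "'l ord_below \<Rightarrow> ('l, 'm) struc \<Rightarrow> ('l \<Rightarrow> 'm) \<Rightarrow> 'k set" where
  "tp \<gamma> S t = code \<gamma> ` (true_atoms S t <+>
     (SIGMA \<delta>:{..<\<gamma>}. (\<lambda>u. tp \<delta> S (join t u)) ` {u. range u \<subseteq> univ S}))"
  by pat_completeness auto
termination
  by (relation "inv_image {(x, y). x < y} fst") (auto simp: wf)

end

declare tp.simps [simp del]

lemma tp_subset: "\<gamma> \<in> A \<Longrightarrow> tp \<gamma> S t \<subseteq> C \<gamma>"
proof (induction \<gamma> arbitrary: t rule: less_induct)
  case (less \<gamma>)
  have "tp \<delta> S (join t u) \<subseteq> C \<delta>" if "\<delta> < \<gamma>" for \<delta> u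
    using less that A_down by (meson less_imp_le)
  then have "true_atoms S t <+> (SIGMA \<delta>:{..<\<gamma>}. (\<lambda>u. tp \<delta> S (join t u)) ` {u. range u \<subseteq> univ S})
      \<subseteq> UNIV <+> (SIGMA \<delta>:{..<\<gamma>}. Pow (C \<delta>))"
    by auto
  then show ?case
    unfolding tp.simps[of \<gamma>] by (rule order_trans[OF image_mono code_into[OF less.prems]])
qed

lemma coded_subset:
  assumes "\<gamma> \<in> A"
  shows "true_atoms S t <+> (SIGMA \<delta>:{..<\<gamma>}. (\<lambda>u. tp \<delta> S (join t u)) ` {u. range u \<subseteq> univ S})
    \<subseteq> UNIV <+> (SIGMA \<delta>:{..<\<gamma>}. Pow (C \<delta>))"
proof -
  have "tp \<delta> S w \<subseteq> C \<delta>" if "\<delta> < \<gamma>" for \<delta> w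
    using assms that A_down tp_subset by (meson less_imp_le)
  then show ?thesis by auto
qed

lemma tp_eq_iff:
  assumes "\<gamma> \<in> A"
  shows "tp \<gamma> S t = tp \<gamma> S' t' \<longleftrightarrow> true_atoms S t = true_atoms S' t' \<and>
     (\<forall>\<delta><\<gamma>. (\<lambda>u. tp \<delta> S (join t u)) ` {u. range u \<subseteq> univ S} =
              (\<lambda>u. tp \<delta> S' (join t' u)) ` {u. range u \<subseteq> univ S'})"
  unfolding tp.simps[of \<gamma>] inj_on_image_eq_iff[OF inj_code[OF assms] coded_subset[OF assms] coded_subset[OF assms]]
  unfolding Plus_eq_iff Sigma_eq_iff Ball_def lessThan_iff by (rule refl)

text \<open>
  Equality of types is the largest back-and-forth relation: any other one implies it.
\<close>

lemma tp_eqI: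
  assumes "R \<gamma> t t'"
    and atoms: "\<And>\<gamma> t t'. R \<gamma> t t' \<Longrightarrow> true_atoms S t = true_atoms S' t'"
    and forth: "\<And>\<gamma> t t' \<delta> u. R \<gamma> t t' \<Longrightarrow> \<delta> < \<gamma> \<Longrightarrow> range u \<subseteq> univ S \<Longrightarrow>
      \<exists>u'. range u' \<subseteq> univ S' \<and> R \<delta> (join t u) (join t' u')"
    and backward: "\<And>\<gamma> t t' \<delta> u'. R \<gamma> t t' \<Longrightarrow> \<delta> < \<gamma> \<Longrightarrow> range u' \<subseteq> univ S' \<Longrightarrow>
      \<exists>u. range u \<subseteq> univ S \<and> R \<delta> (join t u) (join t' u')"
  shows "tp \<gamma> S t = tp \<gamma> S' t'"
  using assms(1)
proof (induction \<gamma> arbitrary: t t' rule: less_induct)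
  case (less \<gamma>)
  have "(\<lambda>u. tp \<delta> S (join t u)) ` {u. range u \<subseteq> univ S} =
        (\<lambda>u. tp \<delta> S' (join t' u)) ` {u. range u \<subseteq> univ S'}" if \<delta>: "\<delta> < \<gamma>" for \<delta>
  proof (intro equalityI subsetI)
    fix x assume "x \<in> (\<lambda>u. tp \<delta> S (join t u)) ` {u. range u \<subseteq> univ S}"
    then obtain u where u: "x = tp \<delta> S (join t u)" "range u \<subseteq> univ S" by auto
    then obtain u' where "range u' \<subseteq> univ S'" "R \<delta> (join t u) (join t' u')"
      using forth[OF less.prems \<delta> u(2)] by blast
    moreover from this have "x = tp \<delta> S' (join t' u')"
      unfolding u(1) by (intro less.IH \<delta>)
    ultimately show "x \<in> (\<lambda>u. tp \<delta> S' (join t' u)) ` {u. range u \<subseteq> univ S'}"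
      by blast
  next
    fix x assume "x \<in> (\<lambda>u. tp \<delta> S' (join t' u)) ` {u. range u \<subseteq> univ S'}"
    then obtain u' where u: "x = tp \<delta> S' (join t' u')" "range u' \<subseteq> univ S'" by auto
    then obtain u where "range u \<subseteq> univ S" "R \<delta> (join t u) (join t' u')"
      using backward[OF less.prems \<delta> u(2)] by blast
    moreover from this have "x = tp \<delta> S (join t u)"
      unfolding u(1) by (intro less.IH[symmetric] \<delta>)
    ultimately show "x \<in> (\<lambda>u. tp \<delta> S (join t u)) ` {u. range u \<subseteq> univ S}"
      by blast
  qed
  then have "(SIGMA \<delta>:{..<\<gamma>}. (\<lambda>u. tp \<delta> S (join t u)) ` {u. range u \<subseteq> univ S}) =
      (SIGMA \<delta>:{..<\<gamma>}. (\<lambda>u. tp \<delta> S' (join t' u)) ` {u. range u \<subseteq> univ S'})"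
    by (intro Sigma_cong) auto
  then show ?case
    unfolding tp.simps[of \<gamma>] by (simp only: atoms[OF less.prems])
qed

lemma tp_atoms: "\<gamma> \<in> A \<Longrightarrow> tp \<gamma> S t = tp \<gamma> S' t' \<Longrightarrow> true_atoms S t = true_atoms S' t'"
  by (simp add: tp_eq_iff)

lemma tp_forth:
  assumes "\<gamma> \<in> A" "tp \<gamma> S t = tp \<gamma> S' t'" "\<delta> < \<gamma>" "range u \<subseteq> univ S"
  shows "\<exists>u'. range u' \<subseteq> univ S' \<and> tp \<delta> S (join t u) = tp \<delta> S' (join t' u')"
proof -
  have "tp \<delta> S (join t u) \<in> (\<lambda>u. tp \<delta> S (join t u)) ` {u. range u \<subseteq> univ S}"
    using assms(4) by blast
  also have "\<dots> = (\<lambda>u. tp \<delta> S' (join t' u)) ` {u. range u \<subseteq> univ S'}"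
    using assms(2,3) by (simp add: tp_eq_iff[OF assms(1)])
  finally show ?thesis by auto
qed

lemma tp_mono:
  assumes "\<gamma> \<in> A" "\<delta> \<le> \<gamma>" "tp \<gamma> S t = tp \<gamma> S' t'"
  shows "tp \<delta> S t = tp \<delta> S' t'"
  using assms A_down[OF assms(1,2)] by (simp add: tp_eq_iff)

text \<open>
  A strategy for a tuple is a strategy for any rearrangement of its entries.
\<close>

lemma tp_reindex:
  assumes "\<gamma> \<in> A" "tp \<gamma> S t = tp \<gamma> S' t'"
  shows "tp \<gamma> S (t \<circ> \<rho>) = tp \<gamma> S' (t' \<circ> \<rho>)"
proof (rule tp_eqI[where R = "\<lambda>\<gamma> w w'. \<gamma> \<in> A \<and>
    (\<exists>t t' \<rho>. w = t \<circ> \<rho> \<and> w' = t' \<circ> \<rho> \<and> tp \<gamma> S t = tp \<gamma> S' t')"], goal_cases)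
  case 1
  then show ?case using assms by blast
next
  case (2 \<gamma> w w')
  then obtain t t' \<rho> where "\<gamma> \<in> A" and w: "w = t \<circ> \<rho>" "w' = t' \<circ> \<rho>" and eq: "tp \<gamma> S t = tp \<gamma> S' t'"
    by blast
  then show ?case using tp_atoms[OF _ eq] by (simp add: true_atoms_eq_iff w)
next
  case (3 \<gamma> w w' \<delta> u)
  then obtain t t' \<rho> where "\<gamma> \<in> A" and w: "w = t \<circ> \<rho>" "w' = t' \<circ> \<rho>" and eq: "tp \<gamma> S t = tp \<gamma> S' t'"
    by blast
  obtain u' where "range u' \<subseteq> univ S'" "tp \<delta> S (join t u) = tp \<delta> S' (join t' u')"
    using tp_forth[OF \<open>\<gamma> \<in> A\<close> eq 3(2,3)] by blast
  then show ?case
    unfolding w join_lift_index[OF infinite_index]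
    using A_down[OF \<open>\<gamma> \<in> A\<close>] 3(2) by (intro exI[of _ u'] conjI exI[of _ "join t u"] exI[of _ "join t' u'"] exI[of _ "lift_index \<rho>"]) auto
next
  case (4 \<gamma> w w' \<delta> u')
  then obtain t t' \<rho> where "\<gamma> \<in> A" and w: "w = t \<circ> \<rho>" "w' = t' \<circ> \<rho>" and eq: "tp \<gamma> S t = tp \<gamma> S' t'"
    by blast
  obtain u where "range u \<subseteq> univ S" "tp \<delta> S' (join t' u') = tp \<delta> S (join t u)"
    using tp_forth[OF \<open>\<gamma> \<in> A\<close> eq[symmetric] 4(2,3)] by blast
  then show ?case
    unfolding w join_lift_index[OF infinite_index]
    using A_down[OF \<open>\<gamma> \<in> A\<close>] 4(2) by (intro exI[of _ u] conjI exI[of _ "join t u"] exI[of _ "join t' u'"] exI[of _ "lift_index \<rho>"]) auto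
qed

lemma tp_iso:
  assumes inj: "inj_on h (univ S)" and univ: "univ S' = h ` univ S"
    and S: "is_struc S"
    and fn: "\<And>x. x \<in> univ S \<Longrightarrow> fn S' (h x) = h (fn S x)"
    and pr: "\<And>x p. x \<in> univ S \<Longrightarrow> h x \<in> pr S' p \<longleftrightarrow> x \<in> pr S p"
    and t: "range t \<subseteq> univ S"
  shows "tp \<gamma> S t = tp \<gamma> S' (h \<circ> t)"
proof (rule tp_eqI[where R = "\<lambda>\<gamma> t t'. range t \<subseteq> univ S \<and> t' = h \<circ> t"], goal_cases)
  case 1
  then show ?case using t by simp
next
  case (2 \<gamma> t t')
  have in_univ: "(fn S ^^ n) x \<in> univ S" if "x \<in> univ S" for n x
    using that S by (induction n) (auto simp: is_struc_def)
  have iter: "(fn S' ^^ n) (h x) = h ((fn S ^^ n) x)" if "x \<in> univ S" for n x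
    using that by (induction n) (auto simp: fn in_univ)
  show ?case
    using 2 inj by (auto simp: true_atoms_eq_iff iter in_univ pr image_subset_iff dest: inj_onD)
next
  case (3 \<gamma> t t' \<delta> u)
  then have "range (join t u) \<subseteq> univ S" by (intro range_join) auto
  with 3 show ?case
    by (intro exI[of _ "h \<circ> u"]) (auto simp: univ comp_join)
next
  case (4 \<gamma> t t' \<delta> u')
  define u where "u i = (SOME x. x \<in> univ S \<and> h x = u' i)" for i
  have u_Some: "u i \<in> univ S \<and> h (u i) = u' i" for i
  proof -
    have "u' i \<in> h ` univ S" using 4(3) univ by auto
    then obtain x where "u' i = h x" "x \<in> univ S" by (rule imageE)
    then have "\<exists>x. x \<in> univ S \<and> h x = u' i" by metis
    then show ?thesis unfolding u_def by (rule someI_ex)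
  qed
  have u: "range u \<subseteq> univ S" by (rule image_subsetI) (rule u_Some[THEN conjunct1])
  have u': "u' = h \<circ> u" by (rule ext) (simp only: comp_apply u_Some[THEN conjunct2])
  have t: "range t \<subseteq> univ S" "t' = h \<circ> t" using 4(1) by auto
  show ?case
    unfolding t(2) u' comp_join using u range_join[OF t(1) u] by blast
qed

end

section \<open>Types decide formulas\<close>

text \<open>
  Quantifier depth counts a block of quantifiers of one kind once. A block is accordingly treated as a
  single quantifier over all its variables, followed by the matrix that remains when the block is stripped.
\<close>

fun ex_matrix :: "('l, 'v) fm \<Rightarrow> ('l, 'v) fm" where
  "ex_matrix (Ex I v \<phi>) = ex_matrix \<phi>"
| "ex_matrix \<phi> = \<phi>"

fun ex_vars :: "('l, 'v) fm \<Rightarrow> 'v set" where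
  "ex_vars (Ex I v \<phi>) = v ` I \<union> ex_vars \<phi>"
| "ex_vars \<phi> = {}"

fun all_matrix :: "('l, 'v) fm \<Rightarrow> ('l, 'v) fm" where
  "all_matrix (All I v \<phi>) = all_matrix \<phi>"
| "all_matrix \<phi> = \<phi>"

fun all_vars :: "('l, 'v) fm \<Rightarrow> 'v set" where
  "all_vars (All I v \<phi>) = v ` I \<union> all_vars \<phi>"
| "all_vars \<phi> = {}"

definition varies :: "('l, 'm) struc \<Rightarrow> 'v set \<Rightarrow> ('v \<Rightarrow> 'm) \<Rightarrow> ('v \<Rightarrow> 'm) \<Rightarrow> bool" where
  "varies S W e e' \<longleftrightarrow> range e' \<subseteq> univ S \<and> (\<forall>x. x \<notin> W \<longrightarrow> e' x = e x)"

lemma varies_empty: "range e \<subseteq> univ S \<Longrightarrow> varies S {} e e' \<longleftrightarrow> e' = e"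
  by (auto simp: varies_def)

lemma varies_trans:
  assumes "range e \<subseteq> univ S"
  shows "varies S (V \<union> W) e e' \<longleftrightarrow> (\<exists>d. varies S V e d \<and> varies S W d e')"
proof
  assume e': "varies S (V \<union> W) e e'"
  have "varies S V e (\<lambda>x. if x \<in> V then e' x else e x)"
    using e' assms by (auto simp: varies_def image_subset_iff)
  moreover have "varies S W (\<lambda>x. if x \<in> V then e' x else e x) e'"
    using e' by (auto simp: varies_def)
  ultimately show "\<exists>d. varies S V e d \<and> varies S W d e'" by blast
qed (auto simp: varies_def)

lemma sat_ex_block:
  "range e \<subseteq> univ S \<Longrightarrow> sat S e \<phi> \<longleftrightarrow> (\<exists>e'. varies S (ex_vars \<phi>) e e' \<and> sat S e' (ex_matrix \<phi>))"
proof (induction \<phi> arbitrary: e)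
  case (Ex I v \<phi>)
  have "sat S e (Ex I v \<phi>) \<longleftrightarrow> (\<exists>d. varies S (v ` I) e d \<and> sat S d \<phi>)"
    by (auto simp: varies_def)
  also have "\<dots> \<longleftrightarrow> (\<exists>d. varies S (v ` I) e d \<and>
      (\<exists>e'. varies S (ex_vars \<phi>) d e' \<and> sat S e' (ex_matrix \<phi>)))"
    by (rule ex_cong) (use Ex.IH in \<open>simp add: varies_def\<close>)
  finally show ?case by (auto simp: varies_trans[OF Ex.prems])
qed (simp_all add: varies_empty)

lemma sat_all_block:
  "range e \<subseteq> univ S \<Longrightarrow> sat S e \<phi> \<longleftrightarrow> (\<forall>e'. varies S (all_vars \<phi>) e e' \<longrightarrow> sat S e' (all_matrix \<phi>))"
proof (induction \<phi> arbitrary: e)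
  case (All I v \<phi>)
  have "sat S e (All I v \<phi>) \<longleftrightarrow> (\<forall>d. varies S (v ` I) e d \<longrightarrow> sat S d \<phi>)"
    by (auto simp: varies_def)
  also have "\<dots> \<longleftrightarrow> (\<forall>d. varies S (v ` I) e d \<longrightarrow>
      (\<forall>e'. varies S (all_vars \<phi>) d e' \<longrightarrow> sat S e' (all_matrix \<phi>)))"
    by (rule all_cong) (use All.IH in \<open>simp add: varies_def\<close>)
  finally show ?case by (auto simp: varies_trans[OF All.prems])
qed (simp_all add: varies_empty)

lemma qd_Ex_matrix: "qd (Ex I v \<phi>) = ord_suc (qd (ex_matrix \<phi>))"
  by (induction \<phi> arbitrary: I v) auto

lemma qd_All_matrix: "qd (All I v \<phi>) = ord_suc (qd (all_matrix \<phi>))"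
  by (induction \<phi> arbitrary: I v) auto

lemma range_Un_halves:
  assumes "infinite (UNIV :: 'l set)"
  shows "range (join v w :: 'l \<Rightarrow> 'v) = range v \<union> range w"
  using join_fst_half[OF assms, of v w] join_snd_half[OF assms, of v w]
  by (auto simp: join_def split: sum.splits) (metis rangeI)+

text \<open>
  A block binds at most \<open>\<lambda>\<close> variables, whence a single move in the game can answer all of it.
\<close>

lemma enum_ex_vars:
  assumes "infinite (UNIV :: 'l set)"
  shows "\<exists>w :: 'l \<Rightarrow> 'v. ex_vars (\<phi> :: ('l, 'v) fm) \<subseteq> range w"
proof (induction \<phi>)
  case (Ex I v \<phi>)
  then obtain w :: "'l \<Rightarrow> 'v" where "ex_vars \<phi> \<subseteq> range w" by blast
  then show ?case
    by (intro exI[of _ "join v w"]) (auto simp: range_Un_halves[OF assms])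
qed auto

lemma enum_all_vars:
  assumes "infinite (UNIV :: 'l set)"
  shows "\<exists>w :: 'l \<Rightarrow> 'v. all_vars (\<phi> :: ('l, 'v) fm) \<subseteq> range w"
proof (induction \<phi>)
  case (All I v \<phi>)
  then obtain w :: "'l \<Rightarrow> 'v" where "all_vars \<phi> \<subseteq> range w" by blast
  then show ?case
    by (intro exI[of _ "join v w"]) (auto simp: range_Un_halves[OF assms])
qed auto

lemma ord_suc_greater:
  assumes "infinite (UNIV :: 'l set)"
  shows "(\<gamma> :: 'l ord_below) < ord_suc \<gamma>"
  unfolding ord_suc_def using ord_below_bounded[OF assms, of "\<lambda>_. \<gamma>"] by (metis LeastI)

lemma le_ord_sup:
  assumes "infinite (UNIV :: 'l set)" "i \<in> I"
  shows "(f i :: 'l ord_below) \<le> ord_sup I (f :: 'l \<Rightarrow> 'l ord_below)"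
proof -
  obtain y where "\<forall>i. f i < y" using ord_below_bounded[OF assms(1)] by blast
  then have "\<forall>i\<in>I. f i \<le> y" by (simp add: less_imp_le)
  then have "\<forall>i\<in>I. f i \<le> ord_sup I f" unfolding ord_sup_def by (rule LeastI)
  then show ?thesis using assms by blast
qed

primrec height :: "'v trm \<Rightarrow> nat" where
  "height (Var x) = 0"
| "height (F s) = Suc (height s)"

primrec root_var :: "'v trm \<Rightarrow> 'v" where
  "root_var (Var x) = x"
| "root_var (F s) = root_var s"

lemma eval_trm_iterate: "eval_trm S e s = (fn S ^^ height s) (e (root_var s))"
  by (induction s) auto

lemma eval_trm_cong_fv: "\<forall>x\<in>fv_trm s. e x = e' x \<Longrightarrow> eval_trm S e s = eval_trm S e' s"
  by (induction s) auto

lemma sat_cong_fv: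
  assumes "\<forall>x\<in>fv \<phi>. e x = e' x" "range e \<subseteq> univ S" "range e' \<subseteq> univ S"
  shows "sat S e \<phi> \<longleftrightarrow> sat S e' \<phi>"
  using assms
proof (induction \<phi> arbitrary: e e')
  case (Eq x y)
  then show ?case by (simp add: eval_trm_cong_fv[of x e e'] eval_trm_cong_fv[of y e e'])
next
  case (P i x)
  then show ?case by (simp add: eval_trm_cong_fv[of x e e'])
next
  case (Neg \<phi>)
  then show ?case by simp
next
  case (Conj I f)
  have "sat S e (f i) = sat S e' (f i)" if "i \<in> I" for i
    using Conj.IH[OF rangeI] Conj.prems that by auto
  then show ?case by simp
next
  case (Disj I f)
  have "sat S e (f i) = sat S e' (f i)" if "i \<in> I" for i
    using Disj.IH[OF rangeI] Disj.prems that by auto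
  then show ?case by simp
next
  case (Ex I v \<phi>)
  have "sat S e' (Ex I v \<phi>)"
    if as: "sat S e (Ex I v \<phi>)" "\<forall>x\<in>fv (Ex I v \<phi>). e x = e' x" "range e' \<subseteq> univ S" for e e'
  proof -
    obtain d where d: "range d \<subseteq> univ S" "\<forall>x. x \<notin> v ` I \<longrightarrow> d x = e x" "sat S d \<phi>"
      using as(1) by auto
    let ?d = "\<lambda>x. if x \<in> v ` I then d x else e' x"
    have r: "range ?d \<subseteq> univ S" using d(1) as(3) by auto
    have sat: "sat S ?d \<phi>" using Ex.IH[of d ?d] d as(2) r by auto
    show ?thesis unfolding sat.simps
      by (rule exI[of _ ?d], rule conjI[OF r], rule conjI[OF _ sat]) simp
  qed
  moreover have "\<forall>x\<in>fv (Ex I v \<phi>). e' x = e x" using Ex.prems(1) by metis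
  ultimately show ?case using Ex.prems by meson
next
  case (All I v \<phi>)
  have "\<not> sat S e' (All I v \<phi>)"
    if as: "\<not> sat S e (All I v \<phi>)" "\<forall>x\<in>fv (All I v \<phi>). e x = e' x" "range e' \<subseteq> univ S" for e e'
  proof -
    obtain d where d: "range d \<subseteq> univ S" "\<forall>x. x \<notin> v ` I \<longrightarrow> d x = e x" "\<not> sat S d \<phi>"
      using as(1) by auto
    let ?d = "\<lambda>x. if x \<in> v ` I then d x else e' x"
    have r: "range ?d \<subseteq> univ S" using d(1) as(3) by auto
    have sat: "\<not> sat S ?d \<phi>" using All.IH[of d ?d] d as(2) r by auto
    show ?thesis unfolding sat.simps not_all not_imp
      by (rule exI[of _ ?d], rule conjI[OF conjI[OF r] sat]) simp
  qed
  moreover have "\<forall>x\<in>fv (All I v \<phi>). e' x = e x" using All.prems(1) by metis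
  ultimately show ?case using All.prems by meson
qed

context coded_types
begin

text \<open>
  A change of at most \<open>\<lambda>\<close> values of an assignment is one extension of the tuple that carries the
  assignment, so the forth property of types answers it by a change of the same variables.
\<close>

lemma type_move:
  assumes \<gamma>: "\<gamma> \<in> A" and eq: "tp \<gamma> S t = tp \<gamma> S' t'" and "\<delta> < \<gamma>"
    and t': "range t' \<subseteq> univ S'"
    and W: "W \<subseteq> range (w :: 'l \<Rightarrow> 'v)" and e1: "varies S W (t \<circ> s) e1"
  shows "\<exists>u u' s1. range u \<subseteq> univ S \<and> range u' \<subseteq> univ S' \<and> e1 = join t u \<circ> s1 \<and>
    tp \<delta> S (join t u) = tp \<delta> S' (join t' u') \<and> varies S' W (t' \<circ> s) (join t' u' \<circ> s1)"
proof -
  define u where "u = e1 \<circ> w"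
  \<comment> \<open>Changed variables point to the new half of the extended tuple, the others to the old half.\<close>
  define s1 where "s1 x = (if x \<in> W then snd_half (SOME i. w i = x) else fst_half (s x))" for x
  have w: "w (SOME i. w i = x) = x" if "x \<in> W" for x
    by (rule someI_ex) (use that W in blast)
  have u: "range u \<subseteq> univ S" using e1 by (auto simp: varies_def u_def)
  then obtain u' where u': "range u' \<subseteq> univ S'" "tp \<delta> S (join t u) = tp \<delta> S' (join t' u')"
    using tp_forth[OF \<gamma> eq \<open>\<delta> < \<gamma>\<close>] by blast
  have "e1 = join t u \<circ> s1"
    using e1 w infinite_index by (auto simp: fun_eq_iff s1_def u_def varies_def)
  moreover have "varies S' W (t' \<circ> s) (join t' u' \<circ> s1)"
    using range_join[OF t' u'(1)] infinite_index by (auto simp: varies_def s1_def)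
  ultimately show ?thesis using u u' by blast
qed

text \<open>
  Assignments have the form \<open>t \<circ> s\<close> with a \<open>\<lambda>\<close>-tuple \<open>t\<close>: although the set of variables may be
  larger than \<open>\<lambda>\<close>, an assignment that occurs in the evaluation of a sentence takes at most \<open>\<lambda>\<close> values if it
  starts from a constant one.
\<close>

definition decided :: "'m itself \<Rightarrow> 'n itself \<Rightarrow> ('l, 'v) fm \<Rightarrow> bool" where
  "decided _ _ \<phi> \<longleftrightarrow> (\<forall>(S :: ('l, 'm) struc) (S' :: ('l, 'n) struc) \<gamma> t t' s.
     \<gamma> \<in> A \<longrightarrow> qd \<phi> \<le> \<gamma> \<longrightarrow> range t \<subseteq> univ S \<longrightarrow> range t' \<subseteq> univ S' \<longrightarrow> tp \<gamma> S t = tp \<gamma> S' t' \<longrightarrow>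
     sat S (t \<circ> s) \<phi> = sat S' (t' \<circ> s) \<phi>)"

lemma decidedD:
  fixes S :: "('l, 'm) struc" and S' :: "('l, 'n) struc"
  assumes "decided TYPE('m) TYPE('n) \<phi>" "\<gamma> \<in> A" "qd \<phi> \<le> \<gamma>"
    and "range t \<subseteq> univ S" "range t' \<subseteq> univ S'" "tp \<gamma> S t = tp \<gamma> S' t'"
  shows "sat S (t \<circ> s) \<phi> = sat S' (t' \<circ> s) \<phi>"
  using assms unfolding decided_def by blast

lemma block_transfer:
  fixes S :: "('l, 'm) struc" and S' :: "('l, 'n) struc" and \<phi> :: "('l, 'v) fm"
  assumes dec: "decided TYPE('m) TYPE('n) \<phi>" and less: "qd \<phi> < \<gamma>"
    and \<gamma>: "\<gamma> \<in> A" and eq: "tp \<gamma> S t = tp \<gamma> S' t'"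
    and t: "range t \<subseteq> univ S" and t': "range t' \<subseteq> univ S'"
    and W: "\<exists>w :: 'l \<Rightarrow> 'v. W \<subseteq> range w"
  shows "(\<exists>e. varies S W (t \<circ> s) e \<and> sat S e \<phi> = b) \<longleftrightarrow> (\<exists>e'. varies S' W (t' \<circ> s) e' \<and> sat S' e' \<phi> = b)"
proof -
  have A: "qd \<phi> \<in> A" using A_down[OF \<gamma>] less by simp
  obtain w :: "'l \<Rightarrow> 'v" where w: "W \<subseteq> range w" using W by blast
  show ?thesis
  proof (intro iffI; elim exE conjE)
    fix e assume e: "varies S W (t \<circ> s) e" "sat S e \<phi> = b"
    then obtain u u' s1 where u: "range u \<subseteq> univ S" "range u' \<subseteq> univ S'" "e = join t u \<circ> s1"
      "tp (qd \<phi>) S (join t u) = tp (qd \<phi>) S' (join t' u')" "varies S' W (t' \<circ> s) (join t' u' \<circ> s1)"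
      using type_move[OF \<gamma> eq less t' w] by blast
    then have "sat S' (join t' u' \<circ> s1) \<phi> = b"
      using decidedD[OF dec A order_refl range_join[OF t] range_join[OF t']] e(2) by metis
    with u show "\<exists>e'. varies S' W (t' \<circ> s) e' \<and> sat S' e' \<phi> = b" by blast
  next
    fix e assume e: "varies S' W (t' \<circ> s) e" "sat S' e \<phi> = b"
    then obtain u u' s1 where u: "range u \<subseteq> univ S'" "range u' \<subseteq> univ S" "e = join t' u \<circ> s1"
      "tp (qd \<phi>) S' (join t' u) = tp (qd \<phi>) S (join t u')" "varies S W (t \<circ> s) (join t u' \<circ> s1)"
      using type_move[OF \<gamma> eq[symmetric] less t w] by blast
    then have "sat S (join t u' \<circ> s1) \<phi> = b"
      using decidedD[OF dec A order_refl range_join[OF t] range_join[OF t']] e(2) by metis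
    with u show "\<exists>e'. varies S W (t \<circ> s) e' \<and> sat S e' \<phi> = b" by blast
  qed
qed

text \<open>
  Induction on the formula. The claim for the matrices is carried along because the immediate
  subformula of a quantifier is in general still inside the block.
\<close>

lemma types_decide_formulas:
  fixes \<phi> :: "('l, 'v) fm"
  shows "decided TYPE('m) TYPE('n) \<phi> \<and> decided TYPE('m) TYPE('n) (ex_matrix \<phi>) \<and>
    decided TYPE('m) TYPE('n) (all_matrix \<phi>)"
proof (induction \<phi>)
  case (Eq x y)
  have "decided TYPE('m) TYPE('n) (Eq x y :: ('l, 'v) fm)"
    unfolding decided_def
  proof (intro allI impI, goal_cases)
    case (1 S S' \<gamma> t t' s)
    then show ?case
      using tp_atoms[OF 1(1,5)] by (simp add: eval_trm_iterate true_atoms_eq_iff)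
  qed
  then show ?case by simp
next
  case (P i x)
  have "decided TYPE('m) TYPE('n) (P i x :: ('l, 'v) fm)"
    unfolding decided_def
  proof (intro allI impI, goal_cases)
    case (1 S S' \<gamma> t t' s)
    then show ?case
      using tp_atoms[OF 1(1,5)] by (simp add: eval_trm_iterate true_atoms_eq_iff)
  qed
  then show ?case by simp
next
  case (Neg \<phi>)
  then have "decided TYPE('m) TYPE('n) (Neg \<phi>)" unfolding decided_def by simp
  then show ?case by simp
next
  case (Conj I f)
  have "decided TYPE('m) TYPE('n) (Conj I f)"
    unfolding decided_def
  proof (intro allI impI, unfold sat.simps, rule ball_cong[OF refl], goal_cases)
    case (1 S S' \<gamma> t t' s i)
    have "qd (f i) \<le> \<gamma>"
      using le_ord_sup[OF infinite_index 1(6), of "\<lambda>i. qd (f i)"] 1(2) by simp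
    then show ?case
      by (rule decidedD[OF Conj.IH[OF rangeI, THEN conjunct1] 1(1) _ 1(3,4,5)])
  qed
  then show ?case by simp
next
  case (Disj I f)
  have "decided TYPE('m) TYPE('n) (Disj I f)"
    unfolding decided_def
  proof (intro allI impI, unfold sat.simps, rule bex_cong[OF refl], goal_cases)
    case (1 S S' \<gamma> t t' s i)
    have "qd (f i) \<le> \<gamma>"
      using le_ord_sup[OF infinite_index 1(6), of "\<lambda>i. qd (f i)"] 1(2) by simp
    then show ?case
      by (rule decidedD[OF Disj.IH[OF rangeI, THEN conjunct1] 1(1) _ 1(3,4,5)])
  qed
  then show ?case by simp
next
  case (Ex I v \<phi>)
  have "decided TYPE('m) TYPE('n) (Ex I v \<phi>)"
    unfolding decided_def
  proof (intro allI impI, goal_cases)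
    case (1 S S' \<gamma> t t' s)
    have less: "qd (ex_matrix \<phi>) < \<gamma>"
      using 1(2) ord_suc_greater[OF infinite_index] unfolding qd_Ex_matrix by (rule order.strict_trans2[rotated])
    have r: "range (t \<circ> s) \<subseteq> univ S" "range (t' \<circ> s) \<subseteq> univ S'" using 1 by auto
    show ?case
      unfolding sat_ex_block[OF r(1)] sat_ex_block[OF r(2)] ex_matrix.simps
      using block_transfer[where b = True, OF _ less 1(1,5,3,4) enum_ex_vars[OF infinite_index, of "Ex I v \<phi>"]] Ex.IH
      by (simp del: ex_vars.simps)
  qed
  with Ex.IH show ?case by simp
next
  case (All I v \<phi>)
  have "decided TYPE('m) TYPE('n) (All I v \<phi>)"
    unfolding decided_def
  proof (intro allI impI, goal_cases)
    case (1 S S' \<gamma> t t' s)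
    have less: "qd (all_matrix \<phi>) < \<gamma>"
      using 1(2) ord_suc_greater[OF infinite_index] unfolding qd_All_matrix by (rule order.strict_trans2[rotated])
    have r: "range (t \<circ> s) \<subseteq> univ S" "range (t' \<circ> s) \<subseteq> univ S'" using 1 by auto
    show ?case
      unfolding sat_all_block[OF r(1)] sat_all_block[OF r(2)] all_matrix.simps
      using block_transfer[where b = False, OF _ less 1(1,5,3,4) enum_all_vars[OF infinite_index, of "All I v \<phi>"]] All.IH
      by (auto simp del: all_vars.simps)
  qed
  with All.IH show ?case by simp
qed

text \<open>
  The truth value of a sentence can be read off at constant assignments, which are carried by
  constant tuples.
\<close>

lemma models_transfer:
  fixes S :: "('l, 'm) struc" and S' :: "('l, 'n) struc" and \<phi> :: "('l, 'v) fm"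
  assumes \<phi>: "sentence \<phi>" "qd \<phi> \<le> \<gamma>" and \<gamma>: "\<gamma> \<in> A"
    and S: "models S {\<phi>}" "a \<in> univ S" and S': "is_struc S'" "a' \<in> univ S'"
    and eq: "tp \<gamma> S (\<lambda>_. a) = tp \<gamma> S' (\<lambda>_. a')"
  shows "models S' {\<phi>}"
proof -
  have "sat S' e \<phi>" if e: "range e \<subseteq> univ S'" for e
  proof -
    have "sat S (\<lambda>_. a) \<phi>" using S by (auto simp: models_def)
    moreover have "sat S ((\<lambda>_. a) \<circ> (\<lambda>_. undefined :: 'l)) \<phi> = sat S' ((\<lambda>_. a') \<circ> (\<lambda>_. undefined :: 'l)) \<phi>"
      by (rule decidedD[OF types_decide_formulas[THEN conjunct1] \<gamma> \<phi>(2) _ _ eq]) (use S S' in auto)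
    ultimately have "sat S' (\<lambda>_. a') \<phi>" by (simp add: comp_def)
    then show ?thesis
      using sat_cong_fv[of \<phi> "\<lambda>_. a'" e S'] e S' \<phi>(1) by (auto simp: sentence_def)
  qed
  then show ?thesis using S' by (simp add: models_def)
qed

end

section \<open>Structures glued at a point\<close>

text \<open>
  A part \<open>T\<close> of a structure that is closed under \<open>F\<close> except for values equal to \<open>a\<close> becomes a structure of its
  own when \<open>a\<close> is added. If \<open>a\<close> is outside \<open>T\<close>, it is made a fixed point without predicates: what
  holds at \<open>a\<close> is then recorded only by the block that contains \<open>a\<close>, the core.
\<close>

definition block :: "('l, 'm) struc \<Rightarrow> 'm \<Rightarrow> 'm set \<Rightarrow> ('l, 'm) struc" where
  "block S a T = \<lparr>univ = insert a T, fn = (\<lambda>x. if x \<in> T then fn S x else a), pr = (\<lambda>p. pr S p \<inter> T)\<rparr>"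

definition blocks :: "('l, 'm) struc \<Rightarrow> 'm \<Rightarrow> 'm set set \<Rightarrow> bool" where
  "blocks S a \<B> \<longleftrightarrow> is_struc S \<and> a \<in> univ S \<and> \<Union>\<B> = univ S \<and> pairwise disjnt \<B> \<and>
     (\<forall>T\<in>\<B>. fn S ` T \<subseteq> insert a T)"

lemma blocks_unique: "blocks S a \<B> \<Longrightarrow> T \<in> \<B> \<Longrightarrow> T' \<in> \<B> \<Longrightarrow> x \<in> T \<Longrightarrow> x \<in> T' \<Longrightarrow> T = T'"
  by (auto simp: blocks_def pairwise_def disjnt_iff)

lemma base_block: "blocks S a \<B> \<Longrightarrow> \<exists>N\<in>\<B>. a \<in> N"
  unfolding blocks_def by (metis UnionE)

definition proj :: "'m \<Rightarrow> 'm set \<Rightarrow> ('l \<Rightarrow> 'm) \<Rightarrow> 'l \<Rightarrow> 'm" where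
  "proj a T t i = (if t i \<in> T then t i else a)"

lemma proj_join: "proj a T (join t u) = join (proj a T t) (proj a T u)"
  by (auto simp: proj_def join_def fun_eq_iff split: sum.split)

text \<open>
  The point \<open>a\<close> is prefixed to the trace of the tuple on the block, so that the type of the trace knows which entries are equal to
  \<open>a\<close>. For a block that does not contain \<open>a\<close> these are the entries outside the block.
\<close>

definition based :: "'m \<Rightarrow> 'm set \<Rightarrow> ('l \<Rightarrow> 'm) \<Rightarrow> 'l \<Rightarrow> 'm" where
  "based a T t = join (\<lambda>_. a) (proj a T t)"

lemma based_const: "(\<And>i. t i \<notin> T \<or> t i = a) \<Longrightarrow> based a T t = (\<lambda>_. a)"
proof -
  assume "\<And>i. t i \<notin> T \<or> t i = a"
  then have "proj a T t = (\<lambda>_. a)" by (auto simp: proj_def fun_eq_iff)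
  then show ?thesis by (simp add: based_def join_const)
qed

context coded_types
begin

text \<open>
  The winning positions of the game between two glued structures: the set \<open>D\<close> of the blocks touched so
  far, always including the core, is matched by \<open>\<pi>\<close> with blocks of the other structure such that
  corresponding entries are in corresponding blocks and the traces on them have the same type.
\<close>

definition glued :: "('l, 'm) struc \<Rightarrow> 'm \<Rightarrow> 'm set set \<Rightarrow> ('l, 'n) struc \<Rightarrow> 'n \<Rightarrow> 'n set set \<Rightarrow>
    'l ord_below \<Rightarrow> ('l \<Rightarrow> 'm) \<Rightarrow> ('l \<Rightarrow> 'n) \<Rightarrow> bool" where
  "glued S a \<B> S' a' \<B>' \<gamma> t t' \<longleftrightarrow> (\<exists>D \<pi>. D \<subseteq> \<B> \<and> inj_on \<pi> D \<and> \<pi> ` D \<subseteq> \<B>' \<and> |D| \<le>o |UNIV :: 'l set| \<and>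
     (\<exists>N\<in>D. a \<in> N \<and> a' \<in> \<pi> N) \<and> (\<forall>i. \<exists>T\<in>D. t i \<in> T \<and> t' i \<in> \<pi> T) \<and>
     (\<forall>T\<in>D. tp \<gamma> (block S a T) (based a T t) = tp \<gamma> (block S' a' (\<pi> T)) (based a' (\<pi> T) t')))"

lemma glued_sym:
  assumes "glued S a \<B> S' a' \<B>' \<gamma> t t'"
  shows "glued S' a' \<B>' S a \<B> \<gamma> t' t"
proof -
  obtain D \<pi> where *: "D \<subseteq> \<B>" "inj_on \<pi> D" "\<pi> ` D \<subseteq> \<B>'" "|D| \<le>o |UNIV :: 'l set|"
     "\<exists>N\<in>D. a \<in> N \<and> a' \<in> \<pi> N" "\<forall>i. \<exists>T\<in>D. t i \<in> T \<and> t' i \<in> \<pi> T"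
     "\<forall>T\<in>D. tp \<gamma> (block S a T) (based a T t) = tp \<gamma> (block S' a' (\<pi> T)) (based a' (\<pi> T) t')"
    using assms unfolding glued_def by blast
  let ?\<rho> = "inv_into D \<pi>"
  have \<rho>: "?\<rho> (\<pi> T) = T" if "T \<in> D" for T using that *(2) by simp
  show ?thesis
    unfolding glued_def
  proof (intro exI[of _ "\<pi> ` D"] exI[of _ ?\<rho>] conjI)
    show "|\<pi> ` D| \<le>o |UNIV :: 'l set|" using card_of_image *(4) by (rule ordLeq_transitive)
    show "\<pi> ` D \<subseteq> \<B>'" by (rule *(3))
    show "inj_on ?\<rho> (\<pi> ` D)" by (rule inj_on_inv_into) simp
    show "?\<rho> ` \<pi> ` D \<subseteq> \<B>" using *(1) \<rho> by auto
    show "\<exists>N\<in>\<pi> ` D. a' \<in> N \<and> a \<in> ?\<rho> N" using *(5) \<rho> by auto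
    show "\<forall>i. \<exists>T\<in>\<pi> ` D. t' i \<in> T \<and> t i \<in> ?\<rho> T"
    proof
      fix i
      obtain T where "T \<in> D" "t i \<in> T" "t' i \<in> \<pi> T" using *(6) by blast
      then show "\<exists>T\<in>\<pi> ` D. t' i \<in> T \<and> t i \<in> ?\<rho> T" using \<rho>
        by (intro bexI[of _ "\<pi> T"]) auto
    qed
    show "\<forall>T\<in>\<pi> ` D. tp \<gamma> (block S' a' T) (based a' T t') = tp \<gamma> (block S a (?\<rho> T)) (based a (?\<rho> T) t)"
      using *(7) \<rho> by auto
  qed
qed

text \<open>
  Iterating \<open>F\<close> on an entry stays in its block until it possibly reaches \<open>a\<close>, and then
  continues in the core; this happens at the same time on both sides, since \<open>a\<close> is an entry of
  the based traces. So each iterate is represented by an iterate inside one touched block (\<open>rep\<close> below), where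
  the types of the traces decide all atomic formulas.
\<close>

lemma glued_atoms:
  assumes S: "blocks S a \<B>" and S': "blocks S' a' \<B>'" and \<gamma>: "\<gamma> \<in> A"
    and R: "glued S a \<B> S' a' \<B>' \<gamma> t t'"
  shows "true_atoms S t = true_atoms S' t'"
proof -
  obtain D \<pi> where D: "D \<subseteq> \<B>" "inj_on \<pi> D" "\<pi> ` D \<subseteq> \<B>'"
     and N: "\<exists>N\<in>D. a \<in> N \<and> a' \<in> \<pi> N" and t: "\<forall>i. \<exists>T\<in>D. t i \<in> T \<and> t' i \<in> \<pi> T"
     and eq: "\<forall>T\<in>D. tp \<gamma> (block S a T) (based a T t) = tp \<gamma> (block S' a' (\<pi> T)) (based a' (\<pi> T) t')"
    using R unfolding glued_def by blast
  obtain N where N: "N \<in> D" "a \<in> N" "a' \<in> \<pi> N" using N by blast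
  let ?f = "\<lambda>T. fn (block S a T)" and ?f' = "\<lambda>T. fn (block S' a' (\<pi> T))"
  let ?w = "\<lambda>T. based a T t" and ?w' = "\<lambda>T. based a' (\<pi> T) t'"
  have atoms: "(?f T ^^ n) (?w T i) = (?f T ^^ m) (?w T j) \<longleftrightarrow> (?f' T ^^ n) (?w' T i) = (?f' T ^^ m) (?w' T j)"
    "(?f T ^^ n) (?w T i) \<in> pr S p \<inter> T \<longleftrightarrow> (?f' T ^^ n) (?w' T i) \<in> pr S' p \<inter> \<pi> T"
    if "T \<in> D" for T n i m j p
  proof -
    have *: "true_atoms (block S a T) (?w T) = true_atoms (block S' a' (\<pi> T)) (?w' T)"
      using tp_atoms[OF \<gamma>] eq that by blast
    show "(?f T ^^ n) (?w T i) = (?f T ^^ m) (?w T j) \<longleftrightarrow> (?f' T ^^ n) (?w' T i) = (?f' T ^^ m) (?w' T j)"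
      using * unfolding true_atoms_eq_iff by blast
    have "(?f T ^^ n) (?w T i) \<in> pr (block S a T) p \<longleftrightarrow> (?f' T ^^ n) (?w' T i) \<in> pr (block S' a' (\<pi> T)) p"
      using * unfolding true_atoms_eq_iff by blast
    then show "(?f T ^^ n) (?w T i) \<in> pr S p \<inter> T \<longleftrightarrow> (?f' T ^^ n) (?w' T i) \<in> pr S' p \<inter> \<pi> T"
      unfolding block_def struc.simps .
  qed
  have a: "?w T (fst_half i) = a" "?w' T (fst_half i) = a'" for T i
    by (simp_all add: based_def infinite_index)
  define rep where "rep x x' T k i \<longleftrightarrow> T \<in> D \<and> x \<in> T \<and> x' \<in> \<pi> T \<and>
    x = (?f T ^^ k) (?w T i) \<and> x' = (?f' T ^^ k) (?w' T i)" for x x' T k i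
  have rep: "\<exists>T k j. rep ((fn S ^^ n) (t i)) ((fn S' ^^ n) (t' i)) T k j" for n i
  proof (induction n)
    case 0
    obtain T where "T \<in> D" "t i \<in> T" "t' i \<in> \<pi> T" using t by blast
    then have "rep (t i) (t' i) T 0 (snd_half i)"
      by (simp add: rep_def based_def proj_def infinite_index)
    then show ?case by auto
  next
    case (Suc n)
    let ?x = "(fn S ^^ n) (t i)" and ?x' = "(fn S' ^^ n) (t' i)"
    obtain T k j where r: "rep ?x ?x' T k j" using Suc.IH by blast
    then have T: "T \<in> D" "?x \<in> T" "?x' \<in> \<pi> T" unfolding rep_def by blast+
    have y: "fn S ?x = (?f T ^^ Suc k) (?w T j)" "fn S' ?x' = (?f' T ^^ Suc k) (?w' T j)"
    proof -
      have "?x = (?f T ^^ k) (?w T j)" "?x' = (?f' T ^^ k) (?w' T j)"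
        using r unfolding rep_def by blast+
      moreover have "fn S ?x = ?f T ?x" "fn S' ?x' = ?f' T ?x'" using T by (simp_all add: block_def)
      ultimately show "fn S ?x = (?f T ^^ Suc k) (?w T j)" "fn S' ?x' = (?f' T ^^ Suc k) (?w' T j)" by simp_all
    qed
    have in_T: "fn S ?x \<in> insert a T" "fn S' ?x' \<in> insert a' (\<pi> T)"
    proof -
      have "fn S ` T \<subseteq> insert a T" using S T(1) D(1) unfolding blocks_def by (metis subsetD)
      then show "fn S ?x \<in> insert a T" using T(2) by (metis imageI subsetD)
      have "fn S' ` \<pi> T \<subseteq> insert a' (\<pi> T)" using S' T(1) D(3) unfolding blocks_def by (metis imageI subsetD)
      then show "fn S' ?x' \<in> insert a' (\<pi> T)" using T(3) by (metis imageI subsetD)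
    qed
    have iff: "fn S ?x = a \<longleftrightarrow> fn S' ?x' = a'"
      using atoms(1)[OF T(1), of "Suc k" j 0 "fst_half undefined"] unfolding y a by simp
    show ?case
    proof (cases "fn S ?x = a")
      case True
      then have "rep (fn S ?x) (fn S' ?x') N 0 (fst_half undefined)"
        using N iff a unfolding rep_def by simp
      then show ?thesis by auto
    next
      case False
      then have "rep (fn S ?x) (fn S' ?x') T (Suc k) j"
        using iff in_T T(1) y by (auto simp: rep_def)
      then show ?thesis by auto
    qed
  qed
  have same: "x = y \<longleftrightarrow> x' = y'" if "rep x x' T k i" "rep y y' U l j" for x x' y y' T U k l i j
  proof (cases "T = U")
    case True
    then show ?thesis using that atoms(1)[of T k i l j] by (simp add: rep_def)
  next
    case False
    have x: "T \<in> D" "x \<in> T" "x' \<in> \<pi> T" and y: "U \<in> D" "y \<in> U" "y' \<in> \<pi> U"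
      using that unfolding rep_def by blast+
    have "\<pi> T \<noteq> \<pi> U" using False inj_onD[OF D(2) _ x(1) y(1)] by metis
    then have "x' \<noteq> y'"
      using blocks_unique[OF S', of "\<pi> T" "\<pi> U" x'] x y D(3) by (metis imageI subsetD)
    moreover have "x \<noteq> y"
      using blocks_unique[OF S, of T U x] x y D(1) False by (metis subsetD)
    ultimately show ?thesis by simp
  qed
  have pred: "x \<in> pr S p \<longleftrightarrow> x' \<in> pr S' p" if "rep x x' T k i" for x x' T k i p
    using that atoms(2)[of T k i p] by (auto simp: rep_def)
  show ?thesis
    unfolding true_atoms_eq_iff using rep same pred by meson
qed

text \<open>
  The new entries touch at most \<open>\<lambda>\<close> new blocks. These are matched injectively with unused blocks of
  the other structure, of which more than \<open>\<lambda>\<close> remain, and in each touched block the trace of the move is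
  answered separately.
\<close>

lemma glued_forth:
  assumes S: "blocks S a \<B>" and S': "blocks S' a' \<B>'"
    and many: "|UNIV :: 'l set| <o |\<B>'|"
    and \<alpha>: "\<alpha> \<in> A" and eq\<alpha>: "\<And>T T'. T \<in> \<B> \<Longrightarrow> T' \<in> \<B>' \<Longrightarrow> a \<in> T \<longleftrightarrow> a' \<in> T' \<Longrightarrow>
      tp \<alpha> (block S a T) (\<lambda>_. a) = tp \<alpha> (block S' a' T') (\<lambda>_. a')"
    and \<gamma>: "\<gamma> \<le> \<alpha>" and R: "glued S a \<B> S' a' \<B>' \<gamma> t t'" and \<delta>: "\<delta> < \<gamma>" and u: "range u \<subseteq> univ S"
  shows "\<exists>u'. range u' \<subseteq> univ S' \<and> glued S a \<B> S' a' \<B>' \<delta> (join t u) (join t' u')"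
proof -
  obtain D \<pi> where D: "D \<subseteq> \<B>" "inj_on \<pi> D" "\<pi> ` D \<subseteq> \<B>'" "|D| \<le>o |UNIV :: 'l set|"
     and N: "\<exists>N\<in>D. a \<in> N \<and> a' \<in> \<pi> N" and t: "\<forall>i. \<exists>T\<in>D. t i \<in> T \<and> t' i \<in> \<pi> T"
     and eq: "\<forall>T\<in>D. tp \<gamma> (block S a T) (based a T t) = tp \<gamma> (block S' a' (\<pi> T)) (based a' (\<pi> T) t')"
    using R unfolding glued_def by blast
  obtain N where N: "N \<in> D" "a \<in> N" "a' \<in> \<pi> N" using N by blast
  have \<gamma>A: "\<gamma> \<in> A" and \<delta>A: "\<delta> \<in> A" using A_down[OF \<alpha>] \<gamma> \<delta> by auto
  have "\<exists>T\<in>\<B>. u i \<in> T" for i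
  proof -
    have "u i \<in> \<Union>\<B>" using u S unfolding blocks_def by (metis rangeI subsetD)
    then show ?thesis by blast
  qed
  then obtain blk where blk: "blk i \<in> \<B>" "u i \<in> blk i" for i by metis
  define E where "E = range blk"
  have E: "|E| \<le>o |UNIV :: 'l set|" "E \<subseteq> \<B>" using card_of_image blk by (auto simp: E_def)
  have "|E - D| \<le>o |\<B>' - \<pi> ` D|"
  proof -
    have "|\<pi> ` D| \<le>o |UNIV :: 'l set|" using card_of_image D(4) by (rule ordLeq_transitive)
    have "\<not> |\<B>' - \<pi> ` D| \<le>o |UNIV :: 'l set|"
    proof
      assume "|\<B>' - \<pi> ` D| \<le>o |UNIV :: 'l set|"
      then have "|(\<B>' - \<pi> ` D) \<union> \<pi> ` D| \<le>o |UNIV :: 'l set|"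
        using \<open>|\<pi> ` D| \<le>o _\<close> infinite_index by (intro card_of_Un_le)
      moreover have "(\<B>' - \<pi> ` D) \<union> \<pi> ` D = \<B>'" using D(3) by blast
      ultimately show False using many not_ordLess_ordLeq by metis
    qed
    then have "|UNIV :: 'l set| \<le>o |\<B>' - \<pi> ` D|"
      using card_le_total[of "UNIV :: 'l set" "\<B>' - \<pi> ` D"] by metis
    moreover have "|E - D| \<le>o |UNIV :: 'l set|"
      using E(1) card_of_mono1[of "E - D" E] ordLeq_transitive by blast
    ultimately show ?thesis by (rule ordLeq_transitive[rotated])
  qed
  then obtain f where f: "inj_on f (E - D)" "f ` (E - D) \<subseteq> \<B>' - \<pi> ` D"
    using card_of_ordLeq[of "E - D" "\<B>' - \<pi> ` D"] by auto
  \<comment> \<open>The matching of the old blocks is extended by \<open>f\<close> to the blocks touched for the first time.\<close>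
  define \<rho> where "\<rho> T = (if T \<in> D then \<pi> T else f T)" for T
  have inj: "inj_on \<rho> (D \<union> E)"
  proof (rule inj_onI)
    fix T U assume T: "T \<in> D \<union> E" and U: "U \<in> D \<union> E" and eq: "\<rho> T = \<rho> U"
    have f_new: "f V \<notin> \<pi> ` D" if "V \<in> E - D" for V using f(2) that by (metis DiffD2 imageI subsetD)
    show "T = U"
    proof (cases "T \<in> D"; cases "U \<in> D")
      assume "T \<in> D" "U \<in> D"
      then show ?thesis using eq D(2) by (simp add: \<rho>_def inj_on_eq_iff)
    next
      assume "T \<in> D" "U \<notin> D"
      then show ?thesis using eq f_new[of U] U by (auto simp: \<rho>_def)
    next
      assume "T \<notin> D" "U \<in> D"
      then show ?thesis using eq f_new[of T] T by (auto simp: \<rho>_def)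
    next
      assume "T \<notin> D" "U \<notin> D"
      then show ?thesis using eq f(1) T U by (simp add: \<rho>_def inj_on_eq_iff)
    qed
  qed
  have into: "\<rho> T \<in> \<B>'" if "T \<in> D \<union> E" for T using that D(3) f by (auto simp: \<rho>_def)
  have in_\<B>: "T \<in> \<B>" if "T \<in> D \<union> E" for T using that D(1) E(2) by auto
  have sep: "T = T'" if "x \<in> \<rho> T" "x \<in> \<rho> T'" "T \<in> D \<union> E" "T' \<in> D \<union> E" for x T T'
    using blocks_unique[OF S' into[OF that(3)] into[OF that(4)] that(1,2)] inj_onD[OF inj _ that(3,4)] by blast
  have \<rho>N: "\<rho> N = \<pi> N" using N by (simp add: \<rho>_def)
  have a_iff: "a \<in> T \<longleftrightarrow> a' \<in> \<rho> T" if "T \<in> D \<union> E" for T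
    using that N blocks_unique[OF S in_\<B> in_\<B>] sep[of a' T N] \<rho>N by blast
  have tpT: "tp \<gamma> (block S a T) (based a T t) = tp \<gamma> (block S' a' (\<rho> T)) (based a' (\<rho> T) t')"
    if T: "T \<in> D \<union> E" for T
  proof (cases "T \<in> D")
    case True
    then show ?thesis using eq by (simp add: \<rho>_def)
  next
    case False
    have "t i \<notin> T" for i
      using t blocks_unique[OF S] in_\<B> T False D(1) by (metis subsetD)
    moreover have "t' i \<notin> \<rho> T" for i
    proof
      assume "t' i \<in> \<rho> T"
      moreover obtain U where "U \<in> D" "t' i \<in> \<rho> U" using t by (metis \<rho>_def)
      ultimately show False using sep[of "t' i" T U] T False by blast
    qed
    ultimately have "based a T t = (\<lambda>_. a)" "based a' (\<rho> T) t' = (\<lambda>_. a')"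
      by (simp_all add: based_const)
    then show ?thesis
      using tp_mono[OF \<alpha> \<gamma> eq\<alpha>[OF in_\<B>[OF T] into[OF T] a_iff[OF T]]] by simp
  qed
  have "\<forall>T. \<exists>v. T \<in> D \<union> E \<longrightarrow> range v \<subseteq> insert a' (\<rho> T) \<and>
      tp \<delta> (block S a T) (join (based a T t) (proj a T u)) =
      tp \<delta> (block S' a' (\<rho> T)) (join (based a' (\<rho> T) t') v)"
  proof
    fix T
    have "range (proj a T u) \<subseteq> univ (block S a T)" by (auto simp: proj_def block_def)
    then show "\<exists>v. T \<in> D \<union> E \<longrightarrow> range v \<subseteq> insert a' (\<rho> T) \<and>
      tp \<delta> (block S a T) (join (based a T t) (proj a T u)) =
      tp \<delta> (block S' a' (\<rho> T)) (join (based a' (\<rho> T) t') v)"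
      using tp_forth[OF \<gamma>A tpT \<delta>, of T "proj a T u"] by (auto simp: block_def)
  qed
  then obtain v where v: "\<And>T. T \<in> D \<union> E \<Longrightarrow> range (v T) \<subseteq> insert a' (\<rho> T)"
    "\<And>T. T \<in> D \<union> E \<Longrightarrow> tp \<delta> (block S a T) (join (based a T t) (proj a T u)) =
      tp \<delta> (block S' a' (\<rho> T)) (join (based a' (\<rho> T) t') (v T))"
    by metis
  \<comment> \<open>The doubled \<open>fst_half\<close> is the place of the base point in the extended based trace.\<close>
  have v_iff: "proj a T u i = a \<longleftrightarrow> v T i = a'" if "T \<in> D \<union> E" for T i
    using tp_atoms[OF \<delta>A v(2)[OF that], unfolded true_atoms_eq_iff, THEN conjunct1,
        rule_format, of 0 "snd_half i" 0 "fst_half (fst_half i)"]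
    by (simp add: based_def infinite_index)
  have v_out: "v T i = a'" if "T \<in> D \<union> E" "u i \<notin> T" for T i
    using v_iff[OF that(1), of i] that(2) by (simp add: proj_def)
  have v_in: "v T i \<in> \<rho> T" if T: "T \<in> D \<union> E" "u i \<in> T" for T i
  proof (cases "a \<in> T")
    case True
    then show ?thesis using v(1)[OF T(1)] a_iff[OF T(1)] by (auto simp: insert_absorb)
  next
    case False
    then have "v T i \<noteq> a'" using v_iff[OF T(1), of i] T(2) by (auto simp: proj_def)
    then show ?thesis using v(1)[OF T(1)] by auto
  qed
  define u' where "u' i = v (blk i) i" for i
  have blkE: "blk i \<in> D \<union> E" for i by (simp add: E_def)
  have u'_in: "u' i \<in> \<rho> (blk i)" for i
    unfolding u'_def using v_in[OF blkE] blk(2) by blast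
  have proj_u': "proj a' (\<rho> T) u' = v T" if T: "T \<in> D \<union> E" for T
  proof
    fix i show "proj a' (\<rho> T) u' i = v T i"
    proof (cases "u i \<in> T")
      case True
      then have "T = blk i" using blocks_unique[OF S in_\<B>[OF T] blk(1)] blk(2) by blast
      then show ?thesis using u'_in[of i] by (simp add: proj_def u'_def)
    next
      case False
      then have "u' i \<notin> \<rho> T" using sep[OF u'_in[of i] _ blkE T] blk(2)[of i] by blast
      then show ?thesis using v_out[OF T False] by (simp add: proj_def)
    qed
  qed
  have range_u': "range u' \<subseteq> univ S'"
    using u'_in into[OF blkE] S' by (auto simp: blocks_def)
  moreover have "glued S a \<B> S' a' \<B>' \<delta> (join t u) (join t' u')"
    unfolding glued_def
  proof (intro exI[of _ "D \<union> E"] exI[of _ \<rho>] conjI)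
    show "D \<union> E \<subseteq> \<B>" using in_\<B> by blast
    show "\<rho> ` (D \<union> E) \<subseteq> \<B>'" using into by blast
    show "|D \<union> E| \<le>o |UNIV :: 'l set|"
      using infinite_index D(4) E(1) by (intro card_of_Un_le)
    show "\<exists>N\<in>D \<union> E. a \<in> N \<and> a' \<in> \<rho> N" using N \<rho>N by auto
    show "\<forall>i. \<exists>T\<in>D \<union> E. join t u i \<in> T \<and> join t' u' i \<in> \<rho> T"
    proof
      fix i
      show "\<exists>T\<in>D \<union> E. join t u i \<in> T \<and> join t' u' i \<in> \<rho> T"
      proof (cases "halves i")
        case (Inl k)
        then show ?thesis using t[rule_format, of k] by (auto simp: join_def \<rho>_def)
      next
        case (Inr k)
        then show ?thesis using u'_in[of k] blk(2)[of k] blkE[of k] by (auto simp: join_def)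
      qed
    qed
    show "\<forall>T\<in>D \<union> E. tp \<delta> (block S a T) (based a T (join t u)) =
        tp \<delta> (block S' a' (\<rho> T)) (based a' (\<rho> T) (join t' u'))"
    proof
      fix T assume T: "T \<in> D \<union> E"
      show "tp \<delta> (block S a T) (based a T (join t u)) =
        tp \<delta> (block S' a' (\<rho> T)) (based a' (\<rho> T) (join t' u'))"
        using tp_reindex[OF \<delta>A v(2)[OF T], of assoc_index]
        by (simp add: based_def proj_join proj_u'[OF T] join_assoc[OF infinite_index])
    qed
  qed (rule inj)
  ultimately show ?thesis by blast
qed

text \<open>
  A Feferman-Vaught theorem for gluing at a point: the number of the blocks has no influence on the type as
  long as it exceeds \<open>\<lambda>\<close>.
\<close>

theorem tp_eq_of_blocks:
  assumes S: "blocks S a \<B>" and S': "blocks S' a' \<B>'"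
    and many: "|UNIV :: 'l set| <o |\<B>|" "|UNIV :: 'l set| <o |\<B>'|"
    and \<alpha>: "\<alpha> \<in> A" and eq: "\<And>T T'. T \<in> \<B> \<Longrightarrow> T' \<in> \<B>' \<Longrightarrow> a \<in> T \<longleftrightarrow> a' \<in> T' \<Longrightarrow>
      tp \<alpha> (block S a T) (\<lambda>_. a) = tp \<alpha> (block S' a' T') (\<lambda>_. a')"
  shows "tp \<alpha> S (\<lambda>_. a) = tp \<alpha> S' (\<lambda>_. a')"
proof (rule tp_eqI[where R = "\<lambda>\<gamma> t t'. \<gamma> \<le> \<alpha> \<and> glued S a \<B> S' a' \<B>' \<gamma> t t'"], goal_cases)
  case 1
  obtain N N' where N: "N \<in> \<B>" "a \<in> N" "N' \<in> \<B>'" "a' \<in> N'"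
    using base_block[OF S] base_block[OF S'] by metis
  have "|{N}| \<le>o |UNIV :: 'l set|"
    by (rule card_of_singl_ordLeq) simp
  moreover have "tp \<alpha> (block S a N) (\<lambda>_. a) = tp \<alpha> (block S' a' N') (\<lambda>_. a')"
    using eq N by blast
  ultimately have "glued S a \<B> S' a' \<B>' \<alpha> (\<lambda>_. a) (\<lambda>_. a')"
    unfolding glued_def using N
    by (intro exI[of _ "{N}"] exI[of _ "\<lambda>_. N'"] conjI) (simp_all add: based_const)
  then show ?case by simp
next
  case (2 \<gamma> t t')
  then have "\<gamma> \<le> \<alpha>" and R: "glued S a \<B> S' a' \<B>' \<gamma> t t'" by simp_all
  then show ?case using glued_atoms[OF S S' A_down[OF \<alpha>] R] by simp
next
  case (3 \<gamma> t t' \<delta> u)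
  then have \<gamma>: "\<gamma> \<le> \<alpha>" and R: "glued S a \<B> S' a' \<B>' \<gamma> t t'" by simp_all
  obtain u' where "range u' \<subseteq> univ S'" "glued S a \<B> S' a' \<B>' \<delta> (join t u) (join t' u')"
    using glued_forth[OF S S' many(2) \<alpha> eq \<gamma> R 3(2,3)] by metis
  then show ?case using \<gamma> 3(2) by (intro exI[of _ u']) simp
next
  case (4 \<gamma> t t' \<delta> u')
  then have \<gamma>: "\<gamma> \<le> \<alpha>" and R: "glued S' a' \<B>' S a \<B> \<gamma> t' t" by (simp_all add: glued_sym)
  have eq': "tp \<alpha> (block S' a' T) (\<lambda>_. a') = tp \<alpha> (block S a T') (\<lambda>_. a)"
    if "T \<in> \<B>'" "T' \<in> \<B>" "a' \<in> T \<longleftrightarrow> a \<in> T'" for T T'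
    by (rule eq[symmetric]) (use that in auto)
  obtain u where "range u \<subseteq> univ S" "glued S' a' \<B>' S a \<B> \<delta> (join t' u') (join t u)"
    using glued_forth[OF S' S many(1) \<alpha> eq' \<gamma> R 4(2,3)] by metis
  then show ?case using \<gamma> 4(2) by (intro exI[of _ u]) (simp add: glued_sym)
qed

end

section \<open>Many pieces hanging from one point\<close>

text \<open>
  The pieces are the trees of all iterated preimages of the elements of the fibre. Two such trees can only
  meet if a forward orbit returns from the fibre to the fibre, thus passes through \<open>a\<close>; omitting
  the countable orbit of \<open>a\<close> excludes this.
\<close>

lemma many_pieces_of_fibre:
  assumes inf: "infinite K" and f: "f ` U \<subseteq> U" and "a \<in> U"
    and big: "|K| <o |{x \<in> U. f x = a}|"
  shows "\<exists>\<T>. |K| <o |\<T>| \<and> pairwise disjnt \<T> \<and>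
    (\<forall>T\<in>\<T>. T \<noteq> {} \<and> T \<subseteq> U - {a} \<and> f ` T \<subseteq> insert a T \<and> {x \<in> U. f x \<in> T} \<subseteq> T)"
proof -
  define orbit where "orbit = range (\<lambda>k::nat. (f ^^ k) a)"
  define Q where "Q = {x \<in> U. f x = a} - orbit"
  define tree where "tree b = {x \<in> U. \<exists>n. (f ^^ n) x = b}" for b
  have "|orbit| \<le>o |K|"
    unfolding orbit_def by (rule card_of_image_le[OF card_nat_le[OF inf]])
  have Q: "|K| <o |Q|"
  proof (rule ccontr)
    assume "\<not> |K| <o |Q|"
    then have "|Q| \<le>o |K|" using card_not_le_iff by metis
    then have "|Q \<union> orbit| \<le>o |K|" using \<open>|orbit| \<le>o |K|\<close> by (rule card_of_Un_le[OF inf])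
    moreover have "{x \<in> U. f x = a} \<subseteq> Q \<union> orbit" by (auto simp: Q_def)
    ultimately have "|{x \<in> U. f x = a}| \<le>o |K|" using card_subset_le by metis
    then show False using big card_not_le_iff by metis
  qed
  have no_return: "b = b'" if b: "b \<in> Q" "b' \<in> Q" and "(f ^^ d) b = b'" for b b' d
  proof (cases d)
    case 0
    then show ?thesis using that by simp
  next
    case (Suc e)
    have "f b = a" using b by (simp add: Q_def)
    then have "(f ^^ e) a = b'" using that(3) Suc by (simp add: funpow_swap1)
    then show ?thesis using b by (auto simp: Q_def orbit_def)
  qed
  have meet: "b = b'" if b: "b \<in> Q" "b' \<in> Q" and x: "x \<in> tree b" "x \<in> tree b'" for b b' x
  proof -
    obtain n m where nm: "(f ^^ n) x = b" "(f ^^ m) x = b'" using x by (auto simp: tree_def)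
    show ?thesis
    proof (cases "n \<le> m")
      case True
      then have "(f ^^ (m - n)) b = b'"
        using nm funpow_add[of "m - n" n f] by (metis comp_apply le_add_diff_inverse2)
      then show ?thesis using no_return b by metis
    next
      case False
      then have "(f ^^ (n - m)) b' = b"
        using nm funpow_add[of "n - m" m f] by (metis comp_apply le_add_diff_inverse2 nat_le_linear)
      then show ?thesis using no_return b by metis
    qed
  qed
  have self: "b \<in> tree b" if "b \<in> Q" for b
    using that by (auto simp: tree_def Q_def intro!: exI[of _ 0])
  have "inj_on tree Q" using meet self by (intro inj_onI) metis
  then have "|Q| \<le>o |tree ` Q|" using card_of_ordLeq[of Q "tree ` Q"] by blast
  with Q have "|K| <o |tree ` Q|" by (rule ordLess_ordLeq_trans)
  moreover have "pairwise disjnt (tree ` Q)"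
    unfolding pairwise_def disjnt_iff using meet by fast
  moreover have "tree b \<noteq> {} \<and> tree b \<subseteq> U - {a} \<and> f ` tree b \<subseteq> insert a (tree b) \<and>
      {x \<in> U. f x \<in> tree b} \<subseteq> tree b" if b: "b \<in> Q" for b
  proof (intro conjI subsetI)
    show "tree b \<noteq> {}" using self[OF b] by auto
    fix x assume x: "x \<in> tree b"
    have "x \<noteq> a"
    proof
      assume "x = a"
      then have "b \<in> orbit" using x by (auto simp: tree_def orbit_def)
      then show False using b by (simp add: Q_def)
    qed
    then show "x \<in> U - {a}" using x by (simp add: tree_def)
  next
    fix x assume "x \<in> {x \<in> U. f x \<in> tree b}"
    then obtain n where "x \<in> U" "(f ^^ n) (f x) = b" by (auto simp: tree_def)
    then show "x \<in> tree b" unfolding tree_def by (auto intro!: exI[of _ "Suc n"] simp: funpow_swap1)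
  next
    fix y assume "y \<in> f ` tree b"
    then obtain x n where x: "x \<in> U" "(f ^^ n) x = b" "y = f x" by (auto simp: tree_def)
    show "y \<in> insert a (tree b)"
    proof (cases n)
      case 0
      then show ?thesis using x b by (simp add: Q_def)
    next
      case (Suc k)
      then have "(f ^^ k) y = b" using x by (simp add: funpow_swap1)
      then show ?thesis using x f by (auto simp: tree_def)
    qed
  qed
  ultimately show ?thesis by (intro exI[of _ "tree ` Q"]) auto
qed

text \<open>
  If all fibres are small, so are the connected components, as every element of the component of \<open>x\<close> is an
  iterated preimage of an iterated image of \<open>x\<close>. Hence there are many components.
\<close>

lemma many_components:
  assumes inf: "infinite K" and f: "f ` U \<subseteq> U" and big: "|K| <o |U|"
    and fibres: "\<And>z. z \<in> U \<Longrightarrow> |{x \<in> U. f x = z}| \<le>o |K|"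
  shows "\<exists>a\<in>U. \<exists>\<T>. |K| <o |\<T>| \<and> pairwise disjnt \<T> \<and>
    (\<forall>T\<in>\<T>. T \<noteq> {} \<and> T \<subseteq> U - {a} \<and> f ` T \<subseteq> insert a T \<and> {x \<in> U. f x \<in> T} \<subseteq> T)"
proof -
  have iter: "(f ^^ n) x \<in> U" if "x \<in> U" for n x using that f by (induction n) auto
  define meet where "meet x y \<longleftrightarrow> (\<exists>n m. (f ^^ n) x = (f ^^ m) y)" for x y
  have refl: "meet x x" for x by (auto simp: meet_def)
  have sym: "meet y x" if "meet x y" for x y using that unfolding meet_def by metis
  have trans: "meet x z" if xyz: "meet x y" "meet y z" for x y z
  proof -
    obtain n m p q where e: "(f ^^ n) x = (f ^^ m) y" "(f ^^ p) y = (f ^^ q) z"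
      using xyz unfolding meet_def by metis
    have "(f ^^ (p + n)) x = (f ^^ p) ((f ^^ m) y)" by (simp add: funpow_add e(1))
    also have "\<dots> = (f ^^ m) ((f ^^ p) y)" by (simp add: funpow_add[symmetric, THEN fun_cong, simplified] add.commute)
    also have "\<dots> = (f ^^ (m + q)) z" by (simp add: funpow_add e(2))
    finally show ?thesis unfolding meet_def by metis
  qed
  define comp where "comp x = {y \<in> U. meet y x}" for x
  have comp_eq: "comp x = comp y" if "z \<in> comp x" "z \<in> comp y" for x y z
    using that sym trans unfolding comp_def by (intro Collect_cong) (metis mem_Collect_eq)
  have pre: "|{y \<in> U. (f ^^ n) y = z}| \<le>o |K|" if "z \<in> U" for n z
  proof (induction n)
    case 0
    have "{y \<in> U. (f ^^ 0) y = z} \<subseteq> {z}" by auto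
    moreover have "|{z}| \<le>o |K|" using inf by (intro card_of_singl_ordLeq) auto
    ultimately show ?case by (rule card_subset_le)
  next
    case (Suc n)
    have "{y \<in> U. (f ^^ Suc n) y = z} \<subseteq> (\<Union>w\<in>{w \<in> U. (f ^^ n) w = z}. {y \<in> U. f y = w})"
      using f by (auto simp: funpow_swap1)
    moreover have "|\<Union>w\<in>{w \<in> U. (f ^^ n) w = z}. {y \<in> U. f y = w}| \<le>o |K|"
      by (rule card_of_UNION_ordLeq_infinite[OF inf Suc]) (use fibres in auto)
    ultimately show ?case by (rule card_subset_le)
  qed
  have comp_small: "|comp x| \<le>o |K|" if "x \<in> U" for x
  proof -
    have "comp x \<subseteq> (\<Union>m\<in>(UNIV :: nat set). \<Union>n\<in>(UNIV :: nat set). {y \<in> U. (f ^^ n) y = (f ^^ m) x})"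
      by (auto simp: comp_def meet_def)
    moreover have "|\<Union>m\<in>(UNIV :: nat set). \<Union>n\<in>(UNIV :: nat set). {y \<in> U. (f ^^ n) y = (f ^^ m) x}| \<le>o |K|"
      by (intro card_of_UNION_ordLeq_infinite[OF inf] card_nat_le[OF inf] ballI pre iter that)
    ultimately show ?thesis by (rule card_subset_le)
  qed
  have many: "|K| <o |comp ` U|"
  proof (rule ccontr)
    assume "\<not> |K| <o |comp ` U|"
    then have "|comp ` U| \<le>o |K|" using card_not_le_iff by metis
    then have "|\<Union>c\<in>comp ` U. c| \<le>o |K|"
      by (rule card_of_UNION_ordLeq_infinite[OF inf]) (use comp_small in auto)
    moreover have "U \<subseteq> (\<Union>c\<in>comp ` U. c)" using refl by (auto simp: comp_def)
    ultimately have "|U| \<le>o |K|" using card_subset_le by metis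
    then show False using big card_not_le_iff by metis
  qed
  have "U \<noteq> {}" using big by (metis card_not_le_iff card_of_empty)
  then obtain a where a: "a \<in> U" by blast
  define \<T> where "\<T> = comp ` U - {comp a}"
  have "|K| <o |\<T>|"
  proof (rule ccontr)
    assume "\<not> |K| <o |\<T>|"
    then have "|\<T>| \<le>o |K|" using card_not_le_iff by metis
    moreover have "|{comp a}| \<le>o |K|" using inf by (intro card_of_singl_ordLeq) auto
    ultimately have "|\<T> \<union> {comp a}| \<le>o |K|" by (rule card_of_Un_le[OF inf])
    moreover have "comp ` U \<subseteq> \<T> \<union> {comp a}" by (auto simp: \<T>_def)
    ultimately have "|comp ` U| \<le>o |K|" using card_subset_le by metis
    then show False using many card_not_le_iff by metis
  qed
  moreover have "pairwise disjnt \<T>"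
    unfolding pairwise_def disjnt_iff \<T>_def using comp_eq by fast
  moreover have "T \<noteq> {} \<and> T \<subseteq> U - {a} \<and> f ` T \<subseteq> insert a T \<and> {x \<in> U. f x \<in> T} \<subseteq> T"
    if "T \<in> \<T>" for T
  proof -
    obtain x where x: "x \<in> U" "T = comp x" "comp x \<noteq> comp a" using \<open>T \<in> \<T>\<close> by (auto simp: \<T>_def)
    have step: "meet (f y) y" for y
      unfolding meet_def by (intro exI[of _ 0] exI[of _ 1]) simp
    show ?thesis
      unfolding x(2)
    proof (intro conjI)
      show "comp x \<noteq> {}" using x(1) refl by (auto simp: comp_def)
      have "a \<notin> comp x" using comp_eq[of a x a] x(3) a refl by (auto simp: comp_def)
      then show "comp x \<subseteq> U - {a}" by (auto simp: comp_def)
      show "f ` comp x \<subseteq> insert a (comp x)"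
      proof
        fix z assume "z \<in> f ` comp x"
        then obtain y where "y \<in> U" "meet y x" "z = f y" by (auto simp: comp_def)
        then show "z \<in> insert a (comp x)" using f trans[OF step[of y]] by (auto simp: comp_def)
      qed
      show "{y \<in> U. f y \<in> comp x} \<subseteq> comp x"
      proof
        fix y assume "y \<in> {y \<in> U. f y \<in> comp x}"
        then have "y \<in> U" "meet (f y) x" by (simp_all add: comp_def)
        then show "y \<in> comp x" using trans[OF sym[OF step[of y]]] by (simp add: comp_def)
      qed
    qed
  qed
  ultimately show ?thesis using a by (intro bexI[of _ a] exI[of _ \<T>]) auto
qed

lemma many_pieces:
  assumes inf: "infinite K" and f: "f ` U \<subseteq> U" and big: "|K| <o |U|"
  shows "\<exists>a\<in>U. \<exists>\<T>. |K| <o |\<T>| \<and> pairwise disjnt \<T> \<and>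
    (\<forall>T\<in>\<T>. T \<noteq> {} \<and> T \<subseteq> U - {a} \<and> f ` T \<subseteq> insert a T \<and> {x \<in> U. f x \<in> T} \<subseteq> T)"
proof (cases "\<exists>a\<in>U. |K| <o |{x \<in> U. f x = a}|")
  case True
  then obtain a where "a \<in> U" "|K| <o |{x \<in> U. f x = a}|" by metis
  then show ?thesis using many_pieces_of_fibre[OF inf f] by (intro bexI[of _ a])
next
  case False
  then have "|{x \<in> U. f x = z}| \<le>o |K|" if "z \<in> U" for z using that card_not_le_iff by metis
  then show ?thesis by (rule many_components[OF inf f big])
qed

text \<open>
  The elements that lie in a small class for some of the classifications \<open>c i\<close> form a small set, as there
  are few classifications, few classes of each and few elements in a small class.
\<close>

lemma common_large_class:
  assumes inf: "infinite K" and big: "|K| <o |\<T>|" and I: "|I| \<le>o |K|" and L: "|L| \<le>o |K|"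
    and few: "\<And>i. i \<in> I \<Longrightarrow> |c i ` \<T>| \<le>o |K|"
  shows "\<exists>T\<in>\<T>. \<forall>i\<in>I. |L| <o |{T' \<in> \<T>. c i T' = c i T}|"
proof (rule ccontr)
  assume neg: "\<not> ?thesis"
  let ?cl = "\<lambda>i v. {T' \<in> \<T>. c i T' = v}"
  let ?small = "\<lambda>i. {v \<in> c i ` \<T>. |?cl i v| \<le>o |L|}"
  have "\<T> \<subseteq> (\<Union>i\<in>I. \<Union>v\<in>?small i. ?cl i v)"
  proof
    fix T assume T: "T \<in> \<T>"
    then have "\<not> (\<forall>i\<in>I. |L| <o |?cl i (c i T)| )" using neg by metis
    then obtain i where i: "i \<in> I" "\<not> |L| <o |?cl i (c i T)|" by metis
    then have "|?cl i (c i T)| \<le>o |L|" using card_not_le_iff by metis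
    then have "c i T \<in> ?small i" using T by simp
    moreover have "T \<in> ?cl i (c i T)" using T by simp
    ultimately show "T \<in> (\<Union>i\<in>I. \<Union>v\<in>?small i. ?cl i v)" using i(1) by (intro UN_I)
  qed
  moreover have "|\<Union>i\<in>I. \<Union>v\<in>?small i. ?cl i v| \<le>o |K|"
  proof (intro card_of_UNION_ordLeq_infinite[OF inf] I ballI)
    fix i assume "i \<in> I"
    show "|?small i| \<le>o |K|" by (rule card_subset_le[OF _ few[OF \<open>i \<in> I\<close>]]) auto
    fix v assume "v \<in> ?small i"
    then have "|?cl i v| \<le>o |L|" by simp
    then show "|?cl i v| \<le>o |K|" using L by (rule card_le_trans)
  qed
  ultimately have "|\<T>| \<le>o |K|" by (rule card_subset_le)
  then show False using big card_not_le_iff by metis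
qed

section \<open>Small substructures\<close>

text \<open>
  The closure of a set under operations on \<open>\<lambda>\<close>-tuples is exhausted by \<open>\<lambda>\<^sup>+\<close> stages: by regularity of
  \<open>\<lambda>\<^sup>+\<close> all entries of a \<open>\<lambda>\<close>-tuple appear before some stage.
\<close>

function stage :: "('m set \<Rightarrow> 'm set) \<Rightarrow> 'm set \<Rightarrow> 'o :: wellorder \<Rightarrow> 'm set" where
  "stage s X \<gamma> = (X \<union> (\<Union>\<delta>\<in>{..<\<gamma>}. stage s X \<delta>)) \<union> s (X \<union> (\<Union>\<delta>\<in>{..<\<gamma>}. stage s X \<delta>))"
  by pat_completeness auto
termination
  by (relation "inv_image {(x, y). x < y} (snd \<circ> snd)") (auto simp: wf)

declare stage.simps [simp del]

lemma card_ord_below: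
  assumes "|UNIV :: 'l set| <o |Q|"
  shows "|UNIV :: 'l ord_below set| \<le>o |Q|"
proof -
  let ?r = "cardSuc |UNIV :: 'l set|"
  have "inj Rep_ord_below" by (simp add: inj_on_def Rep_ord_below_inject)
  moreover have "range (Rep_ord_below :: 'l ord_below \<Rightarrow> _) \<subseteq> Field ?r" using Rep_ord_below by blast
  ultimately have "|UNIV :: 'l ord_below set| \<le>o |Field ?r|" using card_of_ordLeq by metis
  also have "|Field ?r| =o ?r" by (rule card_of_Field_ordIso[OF Card_order_lambda_plus])
  also have "?r \<le>o |Q|" using assms by (intro cardSuc_least card_of_Card_order)
  finally show ?thesis .
qed

lemma closure_under_tuples:
  fixes s :: "'m set \<Rightarrow> 'm set" and Q :: "'k set"
  assumes inf: "infinite (UNIV :: 'l set)" and Q: "|UNIV :: 'l set| <o |Q|" and X: "|X| \<le>o |Q|"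
    and s: "\<And>H. |H| \<le>o |Q| \<Longrightarrow> |s H| \<le>o |Q|"
    and U: "X \<subseteq> U" "\<And>H. H \<subseteq> U \<Longrightarrow> s H \<subseteq> U"
  shows "\<exists>H. X \<subseteq> H \<and> H \<subseteq> U \<and> |H| \<le>o |Q| \<and>
    (\<forall>t :: 'l \<Rightarrow> 'm. range t \<subseteq> H \<longrightarrow> (\<exists>Z\<subseteq>H. range t \<subseteq> Z \<and> s Z \<subseteq> H))"
proof -
  have infQ: "infinite Q" using Q inf by (metis card_of_ordLeq_infinite ordLess_imp_ordLeq)
  let ?st = "stage s X :: 'l ord_below \<Rightarrow> 'm set"
  let ?Z = "\<lambda>\<gamma>. X \<union> (\<Union>\<delta>\<in>{..<\<gamma>}. ?st \<delta>)"
  have st: "?st \<gamma> = ?Z \<gamma> \<union> s (?Z \<gamma>)" for \<gamma> by (rule stage.simps)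
  have ords: "|I| \<le>o |Q|" for I :: "'l ord_below set"
    using card_subset_le[OF subset_UNIV card_ord_below[OF Q]] .
  have small: "|?st \<gamma>| \<le>o |Q|" for \<gamma>
  proof (induction \<gamma> rule: less_induct)
    case (less \<gamma>)
    have "|\<Union>\<delta>\<in>{..<\<gamma>}. ?st \<delta>| \<le>o |Q|"
      by (rule card_of_UNION_ordLeq_infinite[OF infQ ords]) (use less in auto)
    then have Z: "|?Z \<gamma>| \<le>o |Q|" by (rule card_of_Un_le[OF infQ X])
    show ?case unfolding st[of \<gamma>] by (rule card_of_Un_le[OF infQ Z s[OF Z]])
  qed
  have inU: "?st \<gamma> \<subseteq> U" for \<gamma>
  proof (induction \<gamma> rule: less_induct)
    case (less \<gamma>)
    then have "?Z \<gamma> \<subseteq> U" using U(1) by auto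
    then show ?case unfolding st[of \<gamma>] using U(2) by (metis Un_least)
  qed
  define H where "H = (\<Union>\<gamma>. ?st \<gamma>)"
  have "|H| \<le>o |Q|"
    unfolding H_def by (rule card_of_UNION_ordLeq_infinite[OF infQ ords]) (use small in auto)
  moreover have "H \<subseteq> U" using inU by (auto simp: H_def)
  moreover have "X \<subseteq> H"
  proof -
    have "X \<subseteq> ?st undefined" unfolding st[of undefined] by (intro le_supI1 order_refl)
    then show ?thesis unfolding H_def by (rule order_trans) (intro UN_upper UNIV_I)
  qed
  moreover have "\<exists>Z\<subseteq>H. range t \<subseteq> Z \<and> s Z \<subseteq> H" if t: "range t \<subseteq> H" for t :: "'l \<Rightarrow> 'm"
  proof -
    have "\<exists>\<gamma>. t i \<in> ?st \<gamma>" for i using t by (auto simp: H_def)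
    then obtain g where g: "\<And>i. t i \<in> ?st (g i)" by metis
    obtain \<gamma> where \<gamma>: "\<forall>i. g i < \<gamma>" using ord_below_bounded[OF inf] by metis
    have "range t \<subseteq> ?Z \<gamma>" using g \<gamma> by auto
    moreover have "?st \<gamma> \<subseteq> H" unfolding H_def by (intro UN_upper UNIV_I)
    then have "?Z \<gamma> \<subseteq> H" "s (?Z \<gamma>) \<subseteq> H" unfolding st[of \<gamma>] by (simp_all only: Un_subset_iff)
    ultimately show ?thesis by (intro exI[of _ "?Z \<gamma>"]) simp
  qed
  ultimately show ?thesis by (intro exI[of _ H]) simp
qed

text \<open>
  The cardinal equality \<open>(2 ^ |Q|) ^ \<lambda> = 2 ^ |Q|\<close> for \<open>\<lambda> \<le> |Q|\<close>: a tuple of subsets of \<open>Q\<close> is a subset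
  of \<open>UNIV \<times> Q\<close>.
\<close>

lemma card_tuples_le:
  fixes Q :: "'k set" and H :: "'m set"
  assumes inf: "infinite (UNIV :: 'l set)" and Q: "|UNIV :: 'l set| \<le>o |Q|" and H: "|H| \<le>o |Pow Q|"
  shows "|{t :: 'l \<Rightarrow> 'm. range t \<subseteq> H}| \<le>o |Pow Q|"
proof -
  obtain h where h: "inj_on h H" "h ` H \<subseteq> Pow Q" using H card_of_ordLeq by metis
  let ?c = "\<lambda>t :: 'l \<Rightarrow> 'm. SIGMA i:UNIV. h (t i)"
  have "inj_on ?c {t. range t \<subseteq> H}"
  proof (rule inj_onI)
    fix t t' assume t: "t \<in> {t. range t \<subseteq> H}" "t' \<in> {t. range t \<subseteq> H}" and "?c t = ?c t'"
    then have "h (t i) = h (t' i)" for i by (auto simp: set_eq_iff)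
    moreover have "t i \<in> H" "t' i \<in> H" for i using t by auto
    ultimately have "t i = t' i" for i by (intro inj_onD[OF h(1)])
    then show "t = t'" by (rule ext)
  qed
  moreover have "?c ` {t. range t \<subseteq> H} \<subseteq> Pow (UNIV \<times> Q)" using h(2) by fastforce
  ultimately have "|{t :: 'l \<Rightarrow> 'm. range t \<subseteq> H}| \<le>o |Pow ((UNIV :: 'l set) \<times> Q)|"
    using card_of_ordLeq by metis
  also have "|Pow ((UNIV :: 'l set) \<times> Q)| \<le>o |Pow Q|"
  proof (rule card_Pow_mono)
    have "infinite Q" using Q inf by (metis card_of_ordLeq_infinite)
    then show "|(UNIV :: 'l set) \<times> Q| \<le>o |Q|"
      using Q by (intro card_of_Sigma_ordLeq_infinite) (auto intro: card_of_mono1)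
  qed
  finally show ?thesis .
qed

definition restrict_struc :: "('l, 'm) struc \<Rightarrow> 'm set \<Rightarrow> ('l, 'm) struc" where
  "restrict_struc S H = \<lparr>univ = H, fn = fn S, pr = (\<lambda>p. pr S p \<inter> H)\<rparr>"

context coded_types
begin

lemma card_code_domain:
  "\<gamma> \<in> A \<Longrightarrow> |(UNIV :: 'l atom set) <+> (SIGMA \<delta>:{..<\<gamma>}. Pow (C \<delta>))| \<le>o |C \<gamma>|"
  using inj_code code_into card_of_ordLeq by metis

lemma index_le: "\<gamma> \<in> A \<Longrightarrow> |UNIV :: 'l set| \<le>o |C \<gamma>|"
proof -
  assume "\<gamma> \<in> A"
  have "inj (\<lambda>i :: 'l. Same 0 i 0 i)" by (simp add: inj_on_def)
  then have "|UNIV :: 'l set| \<le>o |UNIV :: 'l atom set|" using card_of_ordLeq by blast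
  then show ?thesis
    using card_of_Plus1 card_code_domain[OF \<open>\<gamma> \<in> A\<close>] card_le_trans by metis
qed

text \<open>
  A downward Loewenheim-Skolem theorem for types: \<open>H\<close> is closed under choosing, for each tuple
  and each type of an extension of it in \<open>S\<close>, one extension of that type. There are at most \<open>2 ^ |C \<alpha>|\<close>
  tuples and at most \<open>|C \<alpha>|\<close> types of lower depth to be realized.
\<close>

lemma small_elementary_substructure:
  fixes S :: "('l, 'm) struc"
  assumes \<alpha>: "\<alpha> \<in> A" and S: "is_struc S" and X: "X \<subseteq> univ S" "|X| \<le>o |Pow (C \<alpha>)|" "X \<noteq> {}"
  shows "\<exists>H. X \<subseteq> H \<and> H \<subseteq> univ S \<and> |H| \<le>o |Pow (C \<alpha>)| \<and> is_struc (restrict_struc S H) \<and>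
    (\<forall>t. range t \<subseteq> H \<longrightarrow> tp \<alpha> (restrict_struc S H) t = tp \<alpha> S t)"
proof -
  let ?Q = "Pow (C \<alpha>)"
  have less: "|UNIV :: 'l set| <o |?Q|"
    using index_le[OF \<alpha>] card_of_Pow by (rule ordLeq_ordLess_trans)
  have infQ: "infinite ?Q" using less infinite_index by (metis card_of_ordLeq_infinite ordLess_imp_ordLeq)
  define ok where "ok t \<delta> c u \<longleftrightarrow> range u \<subseteq> univ S \<and> tp \<delta> S (join t u) = c" for t u :: "'l \<Rightarrow> 'm" and \<delta> c
  define wit where "wit t \<delta> c = (SOME u. ok t \<delta> c u)" for t \<delta> c
  define demands where "demands H = {(t, \<delta>, c). range t \<subseteq> H \<and> \<delta> < \<alpha> \<and> c \<subseteq> C \<delta> \<and> (\<exists>u. ok t \<delta> c u)}" for H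
  define step where "step H = fn S ` H \<union> (\<Union>(t, \<delta>, c)\<in>demands H. range (wit t \<delta> c))" for H
  have wit: "ok t \<delta> c (wit t \<delta> c)" if "\<exists>u. ok t \<delta> c u" for t \<delta> c
    unfolding wit_def using that by (rule someI_ex)
  have codes: "|SIGMA \<delta>:{..<\<alpha>}. Pow (C \<delta>)| \<le>o |?Q|"
    using card_of_Plus2 card_code_domain[OF \<alpha>] card_of_Pow[of "C \<alpha>"]
    by (metis card_le_trans ordLess_imp_ordLeq)
  have step_small: "|step H| \<le>o |?Q|" if H: "|H| \<le>o |?Q|" for H
  proof -
    have "demands H \<subseteq> {t. range t \<subseteq> H} \<times> (SIGMA \<delta>:{..<\<alpha>}. Pow (C \<delta>))"
      by (auto simp: demands_def)
    moreover have "|{t :: 'l \<Rightarrow> 'm. range t \<subseteq> H} \<times> (SIGMA \<delta>:{..<\<alpha>}. Pow (C \<delta>))| \<le>o |?Q|"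
      using card_tuples_le[OF infinite_index index_le[OF \<alpha>] H] codes
      by (intro card_of_Sigma_ordLeq_infinite[OF infQ]) auto
    ultimately have "|demands H| \<le>o |?Q|" by (rule card_subset_le)
    moreover have "\<forall>d\<in>demands H. |case d of (t, \<delta>, c) \<Rightarrow> range (wit t \<delta> c)| \<le>o |?Q|"
      by (auto split: prod.split intro: card_of_image_le ordLess_imp_ordLeq[OF less])
    ultimately have "|\<Union>d\<in>demands H. case d of (t, \<delta>, c) \<Rightarrow> range (wit t \<delta> c)| \<le>o |?Q|"
      by (rule card_of_UNION_ordLeq_infinite[OF infQ])
    then show ?thesis
      unfolding step_def by (rule card_of_Un_le[OF infQ card_of_image_le[OF H]])
  qed
  have step_in: "step H \<subseteq> univ S" if "H \<subseteq> univ S" for H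
  proof -
    have "range (wit t \<delta> c) \<subseteq> univ S" if "(t, \<delta>, c) \<in> demands H" for t \<delta> c
    proof -
      have "\<exists>u. ok t \<delta> c u" using that by (simp add: demands_def)
      then show ?thesis using wit[of t \<delta> c] by (simp add: ok_def)
    qed
    moreover have "fn S ` H \<subseteq> univ S" using image_mono[OF that, of "fn S"] S unfolding is_struc_def by (metis order_trans)
    ultimately show ?thesis unfolding step_def by blast
  qed
  obtain H where H: "X \<subseteq> H" "H \<subseteq> univ S" "|H| \<le>o |?Q|" and
    closed: "\<And>t :: 'l \<Rightarrow> 'm. range t \<subseteq> H \<Longrightarrow> \<exists>Z\<subseteq>H. range t \<subseteq> Z \<and> step Z \<subseteq> H"
    using closure_under_tuples[where s = step, OF infinite_index less X(2) step_small X(1) step_in] by metis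
  have fn: "fn S x \<in> H" if "x \<in> H" for x
  proof -
    obtain Z where "Z \<subseteq> H" "range (\<lambda>_ :: 'l. x) \<subseteq> Z" "step Z \<subseteq> H" using closed[of "\<lambda>_. x"] \<open>x \<in> H\<close> by auto
    then show ?thesis by (auto simp: step_def)
  qed
  have witness: "\<exists>u'. range u' \<subseteq> H \<and> tp \<delta> S (join t u') = tp \<delta> S (join t u)"
    if t: "range t \<subseteq> H" and "\<delta> < \<alpha>" and u: "range u \<subseteq> univ S" for t u \<delta>
  proof -
    let ?c = "tp \<delta> S (join t u)"
    obtain Z where Z: "Z \<subseteq> H" "range t \<subseteq> Z" "step Z \<subseteq> H" using closed[OF t] by metis
    have ex: "\<exists>u. ok t \<delta> ?c u" using u unfolding ok_def by metis
    have "(t, \<delta>, ?c) \<in> demands Z"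
      using Z(2) \<open>\<delta> < \<alpha>\<close> ex tp_subset A_down[OF \<alpha> less_imp_le[OF \<open>\<delta> < \<alpha>\<close>]] by (simp add: demands_def)
    then have "range (wit t \<delta> ?c) \<subseteq> step Z" by (auto simp: step_def)
    then have "range (wit t \<delta> ?c) \<subseteq> H" using Z(3) by (rule order_trans)
    moreover have "tp \<delta> S (join t (wit t \<delta> ?c)) = ?c" using wit[OF ex] by (simp add: ok_def)
    ultimately show ?thesis by metis
  qed
  let ?R = "restrict_struc S H"
  have R: "univ ?R = H" "fn ?R = fn S" by (simp_all add: restrict_struc_def)
  have struc: "is_struc ?R"
    using X(3) H(1) fn by (auto simp: is_struc_def restrict_struc_def)
  have "tp \<alpha> ?R t = tp \<alpha> S t" if t: "range t \<subseteq> H" for t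
  proof (rule tp_eqI[where R = "\<lambda>\<gamma> t t'. \<gamma> \<le> \<alpha> \<and> range t \<subseteq> H \<and> tp \<gamma> S t = tp \<gamma> S t'"], goal_cases)
    case 1
    show ?case using t by simp
  next
    case (2 \<gamma> t t')
    have "(fn S ^^ n) (t i) \<in> H" for n i using 2 fn by (induction n) auto
    then have "true_atoms ?R t = true_atoms S t" by (simp add: true_atoms_eq_iff restrict_struc_def)
    then show ?case using tp_atoms[OF A_down[OF \<alpha>]] 2 by metis
  next
    case (3 \<gamma> t t' \<delta> u)
    then have u: "range u \<subseteq> H" by (simp add: R)
    obtain u' where "range u' \<subseteq> univ S" "tp \<delta> S (join t u) = tp \<delta> S (join t' u')"
      using tp_forth[OF A_down[OF \<alpha>] _ 3(2) order_trans[OF u H(2)]] 3(1) by metis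
    moreover have "range (join t u) \<subseteq> H" using 3(1) u by (intro range_join) auto
    moreover have "\<delta> \<le> \<alpha>" using 3(1,2) by auto
    ultimately show ?case by (intro exI[of _ u']) simp
  next
    case (4 \<gamma> t t' \<delta> u')
    then have t: "range t \<subseteq> H" and less: "\<delta> < \<alpha>" by auto
    obtain u where u: "range u \<subseteq> univ S" "tp \<delta> S (join t u) = tp \<delta> S (join t' u')"
      using tp_forth[OF A_down[OF \<alpha>] _ 4(2,3)] 4(1) by metis
    then obtain u1 where "range u1 \<subseteq> H" "tp \<delta> S (join t u1) = tp \<delta> S (join t' u')"
      using witness[OF t less u(1)] by metis
    moreover from this have "range (join t u1) \<subseteq> H" using t by (intro range_join)
    ultimately show ?case using less by (intro exI[of _ u1]) (simp add: R)
  qed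
  with H struc show ?thesis by (intro exI[of _ H]) simp
qed

end

section \<open>Gluing copies of a piece\<close>

definition pointed :: "('l, 'm) struc \<Rightarrow> 'm \<Rightarrow> bool" where
  "pointed T a \<longleftrightarrow> is_struc T \<and> a \<in> univ T \<and> fn T a = a \<and> (\<forall>p. a \<notin> pr T p)"

text \<open>
  The wedge sum of \<open>N\<close> and of \<open>|Y|\<close> copies of \<open>T\<close> at the point \<open>a\<close>.
\<close>

definition glue :: "('l, 'm) struc \<Rightarrow> ('l, 'm) struc \<Rightarrow> 'm \<Rightarrow> 'y set \<Rightarrow> ('l, 'm + 'y \<times> 'm) struc" where
  "glue N T a Y = \<lparr>univ = Inl ` univ N \<union> Inr ` (Y \<times> (univ T - {a})),
     fn = case_sum (\<lambda>x. Inl (fn N x)) (\<lambda>(y, x). if fn T x = a then Inl a else Inr (y, fn T x)),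
     pr = (\<lambda>p. Inl ` pr N p \<union> Inr ` (Y \<times> pr T p))\<rparr>"

definition copies :: "('l, 'm) struc \<Rightarrow> 'm \<Rightarrow> 'y set \<Rightarrow> ('m + 'y \<times> 'm) set set" where
  "copies T a Y = (\<lambda>y. Inr ` ({y} \<times> (univ T - {a}))) ` Y"

lemma blocks_glue:
  assumes N: "blocks N a \<B>" and T: "pointed T a"
  shows "blocks (glue N T a Y) (Inl a) (image Inl ` \<B> \<union> copies T a Y)"
proof -
  have Nu: "\<Union>\<B> = univ N" "a \<in> univ N" "fn N ` univ N \<subseteq> univ N" "\<And>p. pr N p \<subseteq> univ N"
    using N by (auto simp: blocks_def is_struc_def)
  have Tu: "fn T x \<in> univ T" if "x \<in> univ T" for x
    using T that by (auto simp: pointed_def is_struc_def)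
  have Tp: "x \<in> univ T" "x \<noteq> a" if "x \<in> pr T p" for x p
    using T that by (auto simp: pointed_def is_struc_def)
  have "is_struc (glue N T a Y)"
    unfolding is_struc_def
  proof (intro conjI allI)
    show "univ (glue N T a Y) \<noteq> {}" using Nu(2) by (auto simp: glue_def)
    show "fn (glue N T a Y) ` univ (glue N T a Y) \<subseteq> univ (glue N T a Y)"
    proof
      fix z assume "z \<in> fn (glue N T a Y) ` univ (glue N T a Y)"
      then obtain w where w: "w \<in> univ (glue N T a Y)" "z = fn (glue N T a Y) w" by auto
      show "z \<in> univ (glue N T a Y)"
        using w Nu(2,3) Tu by (cases w) (auto simp: glue_def split: if_splits)
    qed
    show "pr (glue N T a Y) p \<subseteq> univ (glue N T a Y)" for p
      using Nu(4) Tp by (fastforce simp: glue_def)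
  qed
  moreover have "\<Union>(image Inl ` \<B> \<union> copies T a Y) = univ (glue N T a Y)"
    unfolding glue_def copies_def Nu(1)[symmetric] by auto
  moreover have "pairwise disjnt (image Inl ` \<B> \<union> copies T a Y)"
    using N unfolding blocks_def pairwise_def disjnt_iff copies_def by fast
  moreover have "fn (glue N T a Y) ` B \<subseteq> insert (Inl a) B" if B: "B \<in> image Inl ` \<B> \<union> copies T a Y" for B
  proof -
    consider B' where "B' \<in> \<B>" "B = Inl ` B'" | y where "y \<in> Y" "B = Inr ` ({y} \<times> (univ T - {a}))"
      using B unfolding copies_def by blast
    then show ?thesis
    proof cases
      case 1
      then have "fn N ` B' \<subseteq> insert a B'" using N unfolding blocks_def by metis
      then show ?thesis using 1 by (auto simp: glue_def)
    next
      case 2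
      then show ?thesis using Tu by (auto simp: glue_def split: if_splits)
    qed
  qed
  ultimately show ?thesis using Nu(2) unfolding blocks_def by (auto simp: glue_def)
qed

lemma is_struc_block:
  assumes "blocks S a \<B>" "B \<in> \<B>"
  shows "is_struc (block S a B)"
proof -
  have "fn S ` B \<subseteq> insert a B" using assms by (simp add: blocks_def)
  then have "fn S x \<in> insert a B" if "x \<in> B" for x using that by (metis imageI subsetD)
  then show ?thesis by (auto simp: is_struc_def block_def)
qed

lemma pointed_block:
  assumes "blocks S a \<B>" "B \<in> \<B>" "a \<notin> B"
  shows "pointed (block S a B) a"
  using is_struc_block[OF assms(1,2)] assms(3) by (simp add: pointed_def block_def)

context coded_types
begin

lemma tp_block_old:
  assumes N: "blocks N a \<B>" and B: "B \<in> \<B>"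
  shows "tp \<alpha> (block N a B) (\<lambda>_. a) = tp \<alpha> (block (glue N T a Y) (Inl a) (Inl ` B)) (\<lambda>_. Inl a)"
proof -
  have "tp \<alpha> (block N a B) (\<lambda>_. a) = tp \<alpha> (block (glue N T a Y) (Inl a) (Inl ` B)) (Inl \<circ> (\<lambda>_. a))"
    by (rule tp_iso[OF _ _ is_struc_block[OF N B]]) (auto simp: block_def glue_def)
  then show ?thesis by (simp add: comp_def)
qed

lemma tp_block_copy:
  assumes T: "pointed T a" and y: "y \<in> Y"
  shows "tp \<alpha> T (\<lambda>_. a) =
    tp \<alpha> (block (glue N T a Y) (Inl a) (Inr ` ({y} \<times> (univ T - {a})))) (\<lambda>_. Inl a)"
proof -
  let ?h = "\<lambda>x. if x = a then Inl a else Inr (y, x)"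
  have T': "is_struc T" "a \<in> univ T" "fn T a = a" "\<And>p. a \<notin> pr T p" "\<And>p. pr T p \<subseteq> univ T"
    using T by (auto simp: pointed_def is_struc_def)
  have "tp \<alpha> T (\<lambda>_. a) =
    tp \<alpha> (block (glue N T a Y) (Inl a) (Inr ` ({y} \<times> (univ T - {a})))) (?h \<circ> (\<lambda>_. a))"
  proof (rule tp_iso[OF _ _ T'(1)])
    show "inj_on ?h (univ T)" by (auto simp: inj_on_def)
    show "univ (block (glue N T a Y) (Inl a) (Inr ` ({y} \<times> (univ T - {a})))) = ?h ` univ T"
      using T'(2) by (auto simp: block_def image_iff)
  qed (use T' y in \<open>auto simp: block_def glue_def\<close>)
  then show ?thesis by (simp add: comp_def)
qed

text \<open>
  Copies of \<open>T\<close> may be added to a structure \<open>N\<close> whose own pieces look like \<open>T\<close>; \<open>N\<close> may also be the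
  core alone, provided that there are more than \<open>\<lambda>\<close> copies.
\<close>

theorem tp_glue:
  fixes S N T :: "('l, 'm) struc" and Y :: "'y set"
  assumes S: "blocks S a \<B>" and N: "blocks N a \<B>'" and T: "pointed T a" and \<alpha>: "\<alpha> \<in> A"
    and many: "|UNIV :: 'l set| <o |\<B>|" "|UNIV :: 'l set| <o |\<B>'| \<or> |UNIV :: 'l set| <o |Y| \<and> univ T \<noteq> {a}"
    and eq: "\<And>B B'. B \<in> \<B> \<Longrightarrow> B' \<in> \<B>' \<Longrightarrow> a \<in> B \<longleftrightarrow> a \<in> B' \<Longrightarrow>
      tp \<alpha> (block S a B) (\<lambda>_. a) = tp \<alpha> (block N a B') (\<lambda>_. a)"
    and eqT: "\<And>B. B \<in> \<B> \<Longrightarrow> a \<notin> B \<Longrightarrow> tp \<alpha> (block S a B) (\<lambda>_. a) = tp \<alpha> T (\<lambda>_. a)"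
  shows "tp \<alpha> S (\<lambda>_. a) = tp \<alpha> (glue N T a Y) (\<lambda>_. Inl a)"
proof (rule tp_eq_of_blocks[OF S blocks_glue[OF N T] many(1) _ \<alpha>])
  let ?G = "image Inl ` \<B>' \<union> copies T a Y"
  show "|UNIV :: 'l set| <o |?G|"
    using many(2)
  proof
    assume less: "|UNIV :: 'l set| <o |\<B>'|"
    have "inj_on (image (Inl :: 'm \<Rightarrow> 'm + 'y \<times> 'm)) \<B>'" by (rule inj_onI) (simp add: inj_image_eq_iff)
    then have "|\<B>'| \<le>o |image (Inl :: 'm \<Rightarrow> 'm + 'y \<times> 'm) ` \<B>'|" using card_of_ordLeq by blast
    also have "|image (Inl :: 'm \<Rightarrow> 'm + 'y \<times> 'm) ` \<B>'| \<le>o |?G|" by (rule card_of_mono1) simp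
    finally show ?thesis using less by (rule ordLess_ordLeq_trans[rotated])
  next
    assume less: "|UNIV :: 'l set| <o |Y| \<and> univ T \<noteq> {a}"
    then obtain x where x: "x \<in> univ T" "x \<noteq> a" using T by (auto simp: pointed_def)
    have "inj_on (\<lambda>y. (Inr ` ({y} \<times> (univ T - {a})) :: ('m + 'y \<times> 'm) set)) Y"
    proof (rule inj_onI)
      fix y z assume "(Inr ` ({y} \<times> (univ T - {a})) :: ('m + 'y \<times> 'm) set) = Inr ` ({z} \<times> (univ T - {a}))"
      moreover have "Inr (y, x) \<in> (Inr ` ({y} \<times> (univ T - {a})) :: ('m + 'y \<times> 'm) set)" using x by simp
      ultimately have "Inr (y, x) \<in> (Inr ` ({z} \<times> (univ T - {a})) :: ('m + 'y \<times> 'm) set)" by metis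
      then show "y = z" by auto
    qed
    then have "|Y| \<le>o |copies T a Y|" unfolding copies_def using card_of_ordLeq by blast
    also have "|copies T a Y| \<le>o |?G|" by (rule card_of_mono1) simp
    finally show ?thesis using less by (metis ordLess_ordLeq_trans)
  qed
next
  fix B G assume B: "B \<in> \<B>" and G: "G \<in> image Inl ` \<B>' \<union> copies T a Y" and iff: "a \<in> B \<longleftrightarrow> Inl a \<in> G"
  show "tp \<alpha> (block S a B) (\<lambda>_. a) = tp \<alpha> (block (glue N T a Y) (Inl a) G) (\<lambda>_. Inl a)"
    using G
  proof
    assume "G \<in> image Inl ` \<B>'"
    then obtain B' where B': "B' \<in> \<B>'" "G = Inl ` B'" by blast
    then have "a \<in> B \<longleftrightarrow> a \<in> B'" using iff by auto
    then show ?thesis using eq[OF B B'(1)] tp_block_old[OF N B'(1)] B'(2) by metis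
  next
    assume "G \<in> copies T a Y"
    then obtain y where y: "y \<in> Y" "G = Inr ` ({y} \<times> (univ T - {a}))" unfolding copies_def by blast
    then have "a \<notin> B" using iff by auto
    then show ?thesis using eqT[OF B] tp_block_copy[OF T y(1)] y(2) by metis
  qed
qed

text \<open>
  Types are preserved by isomorphisms, so a structure can be moved to any type with enough elements.
\<close>

lemma tp_transport:
  fixes S :: "('l, 'm) struc" and Z :: "'c set"
  assumes S: "is_struc S" "a \<in> univ S" and Z: "|univ S| \<le>o |Z|"
  shows "\<exists>(S' :: ('l, 'c) struc) a'. is_struc S' \<and> a' \<in> univ S' \<and> |univ S'| =o |univ S| \<and>
    (\<forall>\<alpha>. tp \<alpha> S (\<lambda>_. a) = tp \<alpha> S' (\<lambda>_. a'))"
proof -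
  obtain h where h: "inj_on h (univ S)" "h ` univ S \<subseteq> Z" using Z card_of_ordLeq by metis
  define S' where "S' = \<lparr>univ = h ` univ S, fn = h \<circ> fn S \<circ> inv_into (univ S) h, pr = (\<lambda>p. h ` pr S p)\<rparr>"
  have pr: "pr S p \<subseteq> univ S" for p using S by (simp add: is_struc_def)
  have fn: "fn S x \<in> univ S" if "x \<in> univ S" for x using S that by (auto simp: is_struc_def)
  have S': "is_struc S'"
    unfolding is_struc_def S'_def using S(2) fn pr h(1) by (auto simp: image_subset_iff)
  have "tp \<alpha> S (\<lambda>_. a) = tp \<alpha> S' (h \<circ> (\<lambda>_. a))" for \<alpha>
  proof (rule tp_iso[OF h(1) _ S(1)])
    show "univ S' = h ` univ S" by (simp add: S'_def)
    show "fn S' (h x) = h (fn S x)" if "x \<in> univ S" for x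
      using that h(1) by (simp add: S'_def)
    show "h x \<in> pr S' p \<longleftrightarrow> x \<in> pr S p" if "x \<in> univ S" for x p
      using that inj_on_image_mem_iff[OF h(1) that pr[of p]] by (simp add: S'_def)
  qed (use S in auto)
  then have "\<forall>\<alpha>. tp \<alpha> S (\<lambda>_. a) = tp \<alpha> S' (\<lambda>_. h a)" by (simp add: comp_def)
  moreover have "|univ S'| =o |univ S|"
    unfolding S'_def using h(1) by (auto intro!: card_of_ordIsoI[where f = "inv_into (univ S) h"] bij_betw_inv_into inj_on_imp_bij_betw)
  moreover have "h a \<in> univ S'" using S(2) by (simp add: S'_def)
  ultimately show ?thesis using S' by metis
qed

end

section \<open>Changing the cardinality of a model\<close>

text \<open>
  What remains of a structure after removing the pieces \<open>\<T>\<close> is closed under \<open>F\<close>, because the pieces contain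
  all preimages of their elements.
\<close>

lemma blocks_of_pieces:
  assumes S: "is_struc S" "a \<in> univ S" and disj: "pairwise disjnt \<T>"
    and \<T>: "\<And>T. T \<in> \<T> \<Longrightarrow> T \<subseteq> univ S - {a} \<and> fn S ` T \<subseteq> insert a T \<and> {x \<in> univ S. fn S x \<in> T} \<subseteq> T"
  shows "blocks S a (insert (univ S - \<Union>\<T>) \<T>)"
proof -
  have "fn S ` (univ S - \<Union>\<T>) \<subseteq> univ S - \<Union>\<T>"
  proof
    fix y assume "y \<in> fn S ` (univ S - \<Union>\<T>)"
    then obtain x where x: "x \<in> univ S" "x \<notin> \<Union>\<T>" "y = fn S x" by auto
    have "y \<in> univ S" using x S(1) by (auto simp: is_struc_def)
    moreover have "y \<notin> T" if "T \<in> \<T>" for T using x \<T>[OF that] that by auto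
    ultimately show "y \<in> univ S - \<Union>\<T>" by auto
  qed
  moreover have "\<Union>(insert (univ S - \<Union>\<T>) \<T>) = univ S" using \<T> by auto
  moreover have "pairwise disjnt (insert (univ S - \<Union>\<T>) \<T>)"
    using disj by (auto simp: pairwise_insert disjnt_iff)
  ultimately show ?thesis using S \<T> unfolding blocks_def by auto
qed

context coded_types
begin

text \<open>
  The piece \<open>T\<close> is chosen independently of \<open>\<alpha>\<close>, but the family \<open>\<J> \<alpha>\<close> of the pieces that resemble it, and
  hence the core, depends on \<open>\<alpha>\<close>.
\<close>

lemma similar_pieces:
  fixes K :: "'q set" and S :: "('l, 'm) struc"
  assumes S: "is_struc S" and \<A>: "\<A> \<subseteq> A" "|\<A>| \<le>o |K|" "\<A> \<noteq> {}"
    and K: "\<And>\<alpha>. \<alpha> \<in> \<A> \<Longrightarrow> |Pow (C \<alpha>)| \<le>o |K|" and big: "|K| <o |univ S|"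
  shows "\<exists>a T \<J>. a \<in> univ S \<and> T \<noteq> {} \<and> (\<forall>\<alpha>\<in>\<A>. a \<notin> \<Union>(\<J> \<alpha>) \<and> T \<in> \<J> \<alpha> \<and>
    blocks S a (insert (univ S - \<Union>(\<J> \<alpha>)) (\<J> \<alpha>)) \<and> |UNIV :: 'l set| <o |\<J> \<alpha>| \<and>
    (\<forall>T'\<in>\<J> \<alpha>. tp \<alpha> (block S a T') (\<lambda>_. a) = tp \<alpha> (block S a T) (\<lambda>_. a)))"
proof -
  obtain \<alpha> where \<alpha>: "\<alpha> \<in> \<A>" using \<A>(3) by blast
  have L: "|UNIV :: 'l set| \<le>o |K|"
    using index_le[of \<alpha>] \<alpha> \<A>(1) card_of_Pow[of "C \<alpha>"] K[OF \<alpha>]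
    by (meson card_le_trans ordLess_imp_ordLeq subsetD)
  have inf: "infinite K" using L infinite_index by (metis card_of_ordLeq_infinite)
  have f: "fn S ` univ S \<subseteq> univ S" using S by (simp add: is_struc_def)
  obtain a \<T> where a: "a \<in> univ S" and \<T>: "|K| <o |\<T>|" "pairwise disjnt \<T>" and
    pieces: "\<forall>T\<in>\<T>. T \<noteq> {} \<and> T \<subseteq> univ S - {a} \<and> fn S ` T \<subseteq> insert a T \<and> {x \<in> univ S. fn S x \<in> T} \<subseteq> T"
    using many_pieces[OF inf f big] by (elim bexE exE conjE) (rule that)
  define c where "c \<alpha> T = tp \<alpha> (block S a T) (\<lambda>_. a)" for \<alpha> T
  have few: "|c \<alpha> ` \<T>| \<le>o |K|" if "\<alpha> \<in> \<A>" for \<alpha>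
  proof (rule card_subset_le[OF _ K[OF that]])
    have "\<alpha> \<in> A" using that \<A>(1) by (rule subsetD[rotated])
    then show "c \<alpha> ` \<T> \<subseteq> Pow (C \<alpha>)" unfolding c_def by (intro image_subsetI PowI tp_subset)
  qed
  have "\<exists>T\<in>\<T>. \<forall>\<alpha>\<in>\<A>. |UNIV :: 'l set| <o |{T' \<in> \<T>. c \<alpha> T' = c \<alpha> T}|"
    by (rule common_large_class[OF inf \<T>(1) \<A>(2) L]) (rule few)
  then obtain T where T: "T \<in> \<T>" "\<forall>\<alpha>\<in>\<A>. |UNIV :: 'l set| <o |{T' \<in> \<T>. c \<alpha> T' = c \<alpha> T}|"
    by (elim bexE) (rule that)
  define \<J> where "\<J> \<alpha> = {T' \<in> \<T>. c \<alpha> T' = c \<alpha> T}" for \<alpha>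
  have blk: "blocks S a (insert (univ S - \<Union>(\<J> \<alpha>)) (\<J> \<alpha>))" for \<alpha>
  proof (rule blocks_of_pieces[OF S a])
    show "pairwise disjnt (\<J> \<alpha>)" using \<T>(2) by (rule pairwise_subset) (auto simp: \<J>_def)
    show "T' \<subseteq> univ S - {a} \<and> fn S ` T' \<subseteq> insert a T' \<and> {x \<in> univ S. fn S x \<in> T'} \<subseteq> T'"
      if "T' \<in> \<J> \<alpha>" for T' using that bspec[OF pieces, of T'] by (simp add: \<J>_def)
  qed
  have a_out: "a \<notin> \<Union>(\<J> \<alpha>)" for \<alpha>
  proof
    assume "a \<in> \<Union>(\<J> \<alpha>)"
    then obtain T' where "T' \<in> \<T>" "a \<in> T'" by (auto simp: \<J>_def)
    then show False using bspec[OF pieces, of T'] by blast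
  qed
  have T_in: "T \<in> \<J> \<alpha>" "T \<noteq> {}" for \<alpha> using T(1) bspec[OF pieces T(1)] by (simp_all add: \<J>_def)
  have same: "\<forall>T'\<in>\<J> \<alpha>. tp \<alpha> (block S a T') (\<lambda>_. a) = tp \<alpha> (block S a T) (\<lambda>_. a)" for \<alpha>
    by (simp add: \<J>_def c_def)
  have large: "|UNIV :: 'l set| <o |\<J> \<alpha>|" if "\<alpha> \<in> \<A>" for \<alpha> using bspec[OF T(2) that] by (simp add: \<J>_def)
  show ?thesis
    by (intro exI[of _ a] exI[of _ T] exI[of _ \<J>] conjI ballI a T_in a_out blk large bspec[OF same])
qed

text \<open>
  Copies of \<open>T\<close> are glued to the whole of \<open>S\<close> rather than to a core. This gives one structure
  for all \<open>\<alpha> \<in> \<A>\<close>, each \<open>\<alpha>\<close> decomposing it in its own way. Indexing the copies by the target type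
  makes the structure as large as this type permits.
\<close>

lemma upward:
  fixes K :: "'q set" and S :: "('l, 'm) struc"
  assumes S: "is_struc S" and \<A>: "\<A> \<subseteq> A" "|\<A>| \<le>o |K|" "\<A> \<noteq> {}"
    and K: "\<And>\<alpha>. \<alpha> \<in> \<A> \<Longrightarrow> |Pow (C \<alpha>)| \<le>o |K|" and big: "|K| <o |univ S|"
  shows "\<exists>(S' :: ('l, 'm + 'b) struc) a a'. a \<in> univ S \<and> is_struc S' \<and> a' \<in> univ S' \<and>
    |UNIV :: ('m + 'b) set| \<le>o |univ S'| \<and> (\<forall>\<alpha>\<in>\<A>. tp \<alpha> S (\<lambda>_. a) = tp \<alpha> S' (\<lambda>_. a'))"
proof -
  obtain a T \<J> where a: "a \<in> univ S" and "T \<noteq> {}" and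
    \<J>: "\<And>\<alpha>. \<alpha> \<in> \<A> \<Longrightarrow> a \<notin> \<Union>(\<J> \<alpha>)" "\<And>\<alpha>. \<alpha> \<in> \<A> \<Longrightarrow> T \<in> \<J> \<alpha>"
      "\<And>\<alpha>. \<alpha> \<in> \<A> \<Longrightarrow> blocks S a (insert (univ S - \<Union>(\<J> \<alpha>)) (\<J> \<alpha>))"
      "\<And>\<alpha>. \<alpha> \<in> \<A> \<Longrightarrow> |UNIV :: 'l set| <o |\<J> \<alpha>|"
    and eq: "\<And>\<alpha> T'. \<alpha> \<in> \<A> \<Longrightarrow> T' \<in> \<J> \<alpha> \<Longrightarrow> tp \<alpha> (block S a T') (\<lambda>_. a) = tp \<alpha> (block S a T) (\<lambda>_. a)"
    using similar_pieces[OF S \<A> K big] by metis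
  obtain x where x: "x \<in> T" using \<open>T \<noteq> {}\<close> by blast
  let ?V = "UNIV :: ('m + 'b) set"
  let ?G = "glue S (block S a T) a ?V"
  have tpG: "tp \<alpha> S (\<lambda>_. a) = tp \<alpha> ?G (\<lambda>_. Inl a)" if \<alpha>: "\<alpha> \<in> \<A>" for \<alpha>
  proof -
    let ?\<B> = "insert (univ S - \<Union>(\<J> \<alpha>)) (\<J> \<alpha>)"
    note B = \<J>(3)[OF \<alpha>]
    have core: "B = univ S - \<Union>(\<J> \<alpha>)" if "B \<in> ?\<B>" "a \<in> B" for B using that \<J>(1)[OF \<alpha>] by blast
    have piece: "B \<in> \<J> \<alpha>" if "B \<in> ?\<B>" "a \<notin> B" for B using that a \<J>(1)[OF \<alpha>] by blast
    have many: "|UNIV :: 'l set| <o |?\<B>|"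
      using \<J>(4)[OF \<alpha>] card_of_mono1[OF subset_insertI] by (rule ordLess_ordLeq_trans)
    have "a \<notin> T" using \<J>(1,2)[OF \<alpha>] by blast
    then have T: "pointed (block S a T) a" using \<J>(2)[OF \<alpha>] by (intro pointed_block[OF B]) simp_all
    have \<alpha>A: "\<alpha> \<in> A" using \<alpha> \<A>(1) by blast
    show ?thesis
    proof (rule tp_glue[OF B B T \<alpha>A many disjI1[OF many]])
      fix B B' assume BB: "B \<in> ?\<B>" "B' \<in> ?\<B>" and iff: "a \<in> B \<longleftrightarrow> a \<in> B'"
      show "tp \<alpha> (block S a B) (\<lambda>_. a) = tp \<alpha> (block S a B') (\<lambda>_. a)"
      proof (cases "a \<in> B")
        case True
        then show ?thesis using core[OF BB(1)] core[OF BB(2)] iff by metis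
      next
        case False
        then show ?thesis using eq[OF \<alpha> piece[OF BB(1)]] eq[OF \<alpha> piece[OF BB(2)]] iff by metis
      qed
    next
      fix B assume "B \<in> ?\<B>" "a \<notin> B"
      then show "tp \<alpha> (block S a B) (\<lambda>_. a) = tp \<alpha> (block S a T) (\<lambda>_. a)"
        by (intro eq[OF \<alpha>] piece)
    qed
  qed
  obtain \<alpha> where \<alpha>: "\<alpha> \<in> \<A>" using \<A>(3) by blast
  have "a \<notin> T" using \<J>(1,2)[OF \<alpha>] by blast
  then have G: "blocks ?G (Inl a) (image Inl ` insert (univ S - \<Union>(\<J> \<alpha>)) (\<J> \<alpha>) \<union> copies (block S a T) a ?V)"
    using \<J>(2)[OF \<alpha>] by (intro blocks_glue[OF \<J>(3)[OF \<alpha>]] pointed_block[OF \<J>(3)[OF \<alpha>]]) simp_all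
  have "infinite (\<J> \<alpha>)" using \<J>(4)[OF \<alpha>] infinite_index by (metis card_of_ordLeq_infinite ordLess_imp_ordLeq)
  moreover have "\<J> \<alpha> \<subseteq> Pow (univ S)" using \<J>(3)[OF \<alpha>] by (auto simp: blocks_def)
  ultimately have "infinite (univ S)" by (metis finite_Pow_iff finite_subset)
  then have infm: "infinite (UNIV :: 'm set)" by (metis finite_subset subset_UNIV)
  then have infV: "infinite ?V" by (simp add: UNIV_Plus_UNIV[symmetric] del: UNIV_Plus_UNIV)
  have mV: "|X| \<le>o |?V|" for X :: "'m set"
    using card_of_ordLeq[of X ?V] by (metis inj_Inl inj_on_subset subset_UNIV)
  have "|univ ?G| \<le>o |?V|"
  proof -
    have "|?V \<times> (univ (block S a T) - {a})| \<le>o |?V|"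
      by (intro card_of_Sigma_ordLeq_infinite[OF infV] ballI mV card_of_mono1 order_refl)
    then show ?thesis
      unfolding glue_def struc.simps by (intro card_of_Un_le[OF infV] card_of_image_le mV)
  qed
  then obtain S' :: "('l, 'm + 'b) struc" and a' where S': "is_struc S'" "a' \<in> univ S'" "|univ S'| =o |univ ?G|"
    "\<forall>\<alpha>. tp \<alpha> ?G (\<lambda>_. Inl a) = tp \<alpha> S' (\<lambda>_. a')"
    using tp_transport[of ?G "Inl a" ?V] G unfolding blocks_def by metis
  have "|?V| \<le>o |univ ?G|"
  proof -
    have "inj_on (\<lambda>v :: 'm + 'b. Inr (v, x) :: 'm + ('m + 'b) \<times> 'm) ?V" by (simp add: inj_on_def)
    moreover have "(\<lambda>v. Inr (v, x)) ` ?V \<subseteq> univ ?G"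
      using x \<open>a \<notin> T\<close> by (auto simp: glue_def block_def)
    ultimately show ?thesis using card_of_ordLeq by metis
  qed
  then have "|?V| \<le>o |univ S'|" using S'(3) by (metis ordIso_iff_ordLeq card_le_trans)
  then show ?thesis using a S' tpG by (intro exI[of _ S'] exI[of _ a] exI[of _ a']) simp
qed

lemma tp_block_whole:
  assumes "is_struc N" "a \<in> univ N"
  shows "tp \<alpha> (block N a (univ N)) (\<lambda>_. a) = tp \<alpha> N (\<lambda>_. a)"
proof -
  have "tp \<alpha> N (\<lambda>_. a) = tp \<alpha> (block N a (univ N)) (id \<circ> (\<lambda>_. a))"
    by (rule tp_iso) (use assms in \<open>auto simp: block_def\<close>)
  then show ?thesis by simp
qed

text \<open>
  Here the core and the piece are first made small, and then \<open>|X|\<close> copies of the small piece dominate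
  the cardinality of the result.
\<close>

lemma exact_cardinality:
  fixes S :: "('l, 'm) struc" and X :: "'b set"
  assumes S: "is_struc S" and \<alpha>: "\<alpha> \<in> A" and big: "|Pow (C \<alpha>)| <o |univ S|" and X: "|Pow (C \<alpha>)| <o |X|"
  shows "\<exists>(S' :: ('l, 'b) struc) a a'. a \<in> univ S \<and> is_struc S' \<and> a' \<in> univ S' \<and>
    |univ S'| =o |X| \<and> tp \<alpha> S (\<lambda>_. a) = tp \<alpha> S' (\<lambda>_. a')"
proof -
  let ?K = "Pow (C \<alpha>)"
  have LK: "|UNIV :: 'l set| <o |?K|"
    using index_le[OF \<alpha>] card_of_Pow by (rule ordLeq_ordLess_trans)
  have infK: "infinite ?K" using LK infinite_index by (metis card_of_ordLeq_infinite ordLess_imp_ordLeq)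
  have infX: "infinite X" using X infK by (metis card_of_ordLeq_infinite ordLess_imp_ordLeq)
  have small: "|Z| \<le>o |X|" if "|Z| \<le>o |?K|" for Z :: "'m set"
    using that ordLess_imp_ordLeq[OF X] by (rule card_le_trans)
  have single: "|Z| \<le>o |?K|" if "finite Z" for Z :: "'m set"
    using card_of_ordLeq_infinite card_le_total[of Z ?K] infK that by metis
  have one: "{\<alpha>} \<subseteq> A" "|{\<alpha>}| \<le>o |?K|" "{\<alpha>} \<noteq> {}"
    using \<alpha> infK by (simp, intro card_of_singl_ordLeq, auto)
  have Pow_le: "|Pow (C \<beta>)| \<le>o |?K|" if "\<beta> \<in> {\<alpha>}" for \<beta>
    using that card_of_mono1[OF order_refl, of ?K] by simp
  have "\<exists>a T \<J>'. a \<in> univ S \<and> T \<noteq> {} \<and> (\<forall>\<beta>\<in>{\<alpha>}. a \<notin> \<Union>(\<J>' \<beta>) \<and> T \<in> \<J>' \<beta> \<and>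
      blocks S a (insert (univ S - \<Union>(\<J>' \<beta>)) (\<J>' \<beta>)) \<and> |UNIV :: 'l set| <o |\<J>' \<beta>| \<and>
      (\<forall>T'\<in>\<J>' \<beta>. tp \<beta> (block S a T') (\<lambda>_. a) = tp \<beta> (block S a T) (\<lambda>_. a)))"
    by (rule similar_pieces[OF S one _ big]) (rule Pow_le)
  then obtain a T \<J>' where "a \<in> univ S" "T \<noteq> {}" and \<J>': "\<forall>\<beta>\<in>{\<alpha>}. a \<notin> \<Union>(\<J>' \<beta>) \<and> T \<in> \<J>' \<beta> \<and>
      blocks S a (insert (univ S - \<Union>(\<J>' \<beta>)) (\<J>' \<beta>)) \<and> |UNIV :: 'l set| <o |\<J>' \<beta>| \<and>
      (\<forall>T'\<in>\<J>' \<beta>. tp \<beta> (block S a T') (\<lambda>_. a) = tp \<beta> (block S a T) (\<lambda>_. a))"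
    by (elim exE conjE) (rule that)
  define \<J> where "\<J> = \<J>' \<alpha>"
  have a: "a \<in> univ S" by fact
  have \<J>: "a \<notin> \<Union>\<J>" "T \<in> \<J>" "blocks S a (insert (univ S - \<Union>\<J>) \<J>)" "|UNIV :: 'l set| <o |\<J>|"
    and eq: "\<And>T'. T' \<in> \<J> \<Longrightarrow> tp \<alpha> (block S a T') (\<lambda>_. a) = tp \<alpha> (block S a T) (\<lambda>_. a)"
    using bspec[OF \<J>' singletonI] unfolding \<J>_def by blast+
  obtain x where x: "x \<in> T" using \<open>T \<noteq> {}\<close> by blast
  have aT: "a \<notin> T" using \<J>(1,2) by blast
  let ?N = "univ S - \<Union>\<J>" and ?\<B> = "insert (univ S - \<Union>\<J>) \<J>"
  have aN: "a \<in> ?N" using a \<J>(1) by blast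
  let ?SN = "block S a ?N" and ?ST = "block S a T"
  have strucN: "is_struc ?SN" by (rule is_struc_block[OF \<J>(3)]) simp
  have ptT: "pointed ?ST a" using \<J>(2) aT by (intro pointed_block[OF \<J>(3)]) simp_all
  have "{a} \<subseteq> univ ?SN" by (simp add: block_def)
  then obtain HN where HN: "{a} \<subseteq> HN" "|HN| \<le>o |?K|" "is_struc (restrict_struc ?SN HN)"
    "\<And>t. range t \<subseteq> HN \<Longrightarrow> tp \<alpha> (restrict_struc ?SN HN) t = tp \<alpha> ?SN t"
    using small_elementary_substructure[OF \<alpha> strucN _ single] by (metis finite.emptyI finite_insert insert_not_empty)
  have "{a, x} \<subseteq> univ ?ST" using x by (simp add: block_def)
  moreover have "is_struc ?ST" using ptT by (simp add: pointed_def)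
  ultimately obtain HT where HT: "{a, x} \<subseteq> HT" "|HT| \<le>o |?K|" "is_struc (restrict_struc ?ST HT)"
    "\<And>t. range t \<subseteq> HT \<Longrightarrow> tp \<alpha> (restrict_struc ?ST HT) t = tp \<alpha> ?ST t"
    using small_elementary_substructure[OF \<alpha> _ _ single] by (metis finite.emptyI finite_insert insert_not_empty)
  let ?NH = "restrict_struc ?SN HN" and ?TH = "restrict_struc ?ST HT"
  have T0: "pointed ?TH a"
    using HT(1,3) ptT by (simp add: pointed_def restrict_struc_def)
  have univ0: "univ ?NH = HN" "univ ?TH = HT" by (simp_all add: restrict_struc_def)
  have N0: "blocks ?NH a {HN}"
    using HN(1,3) by (auto simp: blocks_def univ0 is_struc_def)
  let ?G = "glue ?NH ?TH a X"
  have "|\<J>| \<le>o |?\<B>|" by (rule card_of_mono1[OF subset_insertI])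
  with \<J>(4) have many: "|UNIV :: 'l set| <o |?\<B>|" by (rule ordLess_ordLeq_trans)
  have "x \<noteq> a" using x aT by blast
  then have "univ ?TH \<noteq> {a}" using HT(1) unfolding univ0 by blast
  moreover have "|UNIV :: 'l set| <o |X|" using LK X by (rule ordLess_transitive)
  ultimately have many': "|UNIV :: 'l set| <o |{HN}| \<or> |UNIV :: 'l set| <o |X| \<and> univ ?TH \<noteq> {a}" by simp
  have tpG: "tp \<alpha> S (\<lambda>_. a) = tp \<alpha> ?G (\<lambda>_. Inl a)"
  proof (rule tp_glue[OF \<J>(3) N0 T0 \<alpha> many many'])
    fix B B' assume B: "B \<in> ?\<B>" "B' \<in> {HN}" "a \<in> B \<longleftrightarrow> a \<in> B'"
    then have "a \<in> B" using HN(1) by auto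
    then have "B = ?N" using B(1) \<J>(1) by blast
    moreover have "tp \<alpha> (block ?NH a HN) (\<lambda>_. a) = tp \<alpha> ?SN (\<lambda>_. a)"
      using tp_block_whole[OF HN(3), of a \<alpha>] HN(1) HN(4)[of "\<lambda>_. a"] unfolding univ0 by simp
    ultimately show "tp \<alpha> (block S a B) (\<lambda>_. a) = tp \<alpha> (block ?NH a B') (\<lambda>_. a)" using B(2) by simp
  next
    fix B assume "B \<in> ?\<B>" "a \<notin> B"
    then have "B \<in> \<J>" using aN by blast
    then show "tp \<alpha> (block S a B) (\<lambda>_. a) = tp \<alpha> ?TH (\<lambda>_. a)"
      using eq[of B] HT(1) HT(4)[of "\<lambda>_. a"] by simp
  qed
  have le: "|univ ?G| \<le>o |X|"
  proof -
    have "|X \<times> (univ ?TH - {a})| \<le>o |X|"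
      by (intro card_of_Sigma_ordLeq_infinite[OF infX] ballI card_of_mono1 order_refl small)
        (rule card_subset_le[OF _ HT(2)], auto simp: univ0)
    moreover have "|univ ?NH| \<le>o |X|" using small HN(2) by (simp add: univ0)
    ultimately show ?thesis
      unfolding glue_def struc.simps by (intro card_of_Un_le[OF infX] card_of_image_le)
  qed
  have ge: "|X| \<le>o |univ ?G|"
  proof -
    have "inj_on (\<lambda>v :: 'b. Inr (v, x) :: 'm + 'b \<times> 'm) X" by (simp add: inj_on_def)
    moreover have "(\<lambda>v. Inr (v, x)) ` X \<subseteq> univ ?G"
      using HT(1) \<open>x \<noteq> a\<close> by (auto simp: glue_def univ0)
    ultimately show ?thesis using card_of_ordLeq by metis
  qed
  have "is_struc ?G" "Inl a \<in> univ ?G" using blocks_glue[OF N0 T0, of X] by (simp_all add: blocks_def)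
  then obtain S' :: "('l, 'b) struc" and a' where S': "is_struc S'" "a' \<in> univ S'" "|univ S'| =o |univ ?G|"
    "\<forall>\<alpha>. tp \<alpha> ?G (\<lambda>_. Inl a) = tp \<alpha> S' (\<lambda>_. a')"
    using tp_transport[OF _ _ le] by metis
  have "|univ ?G| =o |X|" using le ge by (simp add: ordIso_iff_ordLeq)
  then have "|univ S'| =o |X|" using S'(3) by (rule ordIso_transitive[rotated])
  then show ?thesis using a S' tpG by (intro exI[of _ S'] exI[of _ a] exI[of _ a']) simp
qed

end

section \<open>Towers of power sets\<close>

text \<open>
  The inequality \<open>\<le>\<close> of the beth recursion is all that the coding of types needs. It leaves the freedom to
  use sets larger than \<open>\<beth>\<^sub>\<gamma>(\<lambda>)\<close>, such as \<open>\<beth>\<^sub>\<beta>\<^sub>+\<^sub>\<gamma>(\<aleph>\<^sub>0)\<close> for large \<open>\<beta>\<close>.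
\<close>

definition tower :: "'l ord_below set \<Rightarrow> ('l ord_below \<Rightarrow> 'k set) \<Rightarrow> bool" where
  "tower A C \<longleftrightarrow> (\<forall>\<gamma>\<in>A. |(UNIV :: 'l set) <+> (SIGMA \<delta>:{..<\<gamma>}. Pow (C \<delta>))| \<le>o |C \<gamma>| )"

lemma card_atoms_le:
  assumes inf: "infinite (UNIV :: 'l set)"
  shows "|UNIV :: 'l atom set| \<le>o |UNIV :: 'l set|"
proof -
  define code :: "'l atom \<Rightarrow> (nat \<times> 'l \<times> nat \<times> 'l) + ('l \<times> nat \<times> 'l)" where
    "code = case_atom (\<lambda>n i m j. Inl (n, i, m, j)) (\<lambda>p n i. Inr (p, n, i))"
  have "inj code" by (rule injI) (auto simp: code_def split: atom.splits)
  then have "|UNIV :: 'l atom set| \<le>o |UNIV :: ((nat \<times> 'l \<times> nat \<times> 'l) + ('l \<times> nat \<times> 'l)) set|"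
    using card_of_ordLeq by blast
  also have "|UNIV :: ((nat \<times> 'l \<times> nat \<times> 'l) + ('l \<times> nat \<times> 'l)) set| \<le>o |UNIV :: 'l set|"
    unfolding UNIV_Plus_UNIV[symmetric] UNIV_Times_UNIV[symmetric]
    by (intro card_Plus_le[OF inf] card_Times_le[OF inf] card_nat_le[OF inf] card_of_mono1 order_refl)
  finally show ?thesis .
qed

lemma coded_types_exist:
  fixes C :: "'l ord_below \<Rightarrow> 'k set"
  assumes inf: "infinite (UNIV :: 'l set)" and C: "tower A C"
    and A: "\<And>\<gamma> \<delta>. \<gamma> \<in> A \<Longrightarrow> \<delta> \<le> \<gamma> \<Longrightarrow> \<delta> \<in> A"
  shows "\<exists>code. coded_types A C code"
proof -
  let ?D = "\<lambda>\<gamma>. (UNIV :: 'l atom set) <+> (SIGMA \<delta>:{..<\<gamma>}. Pow (C \<delta>))"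
  have "\<exists>h. inj_on h (?D \<gamma>) \<and> h ` ?D \<gamma> \<subseteq> C \<gamma>" if "\<gamma> \<in> A" for \<gamma>
  proof -
    have "|?D \<gamma>| \<le>o |(UNIV :: 'l set) <+> (SIGMA \<delta>:{..<\<gamma>}. Pow (C \<delta>))|"
      by (rule card_of_Plus_mono1[OF card_atoms_le[OF inf]])
    also have "|(UNIV :: 'l set) <+> (SIGMA \<delta>:{..<\<gamma>}. Pow (C \<delta>))| \<le>o |C \<gamma>|"
      using C that by (simp add: tower_def)
    finally show ?thesis using card_of_ordLeq by metis
  qed
  then have "\<forall>\<gamma>. \<exists>h. \<gamma> \<in> A \<longrightarrow> inj_on h (?D \<gamma>) \<and> h ` ?D \<gamma> \<subseteq> C \<gamma>" by blast
  then obtain code where code: "\<forall>\<gamma>. \<gamma> \<in> A \<longrightarrow> inj_on (code \<gamma>) (?D \<gamma>) \<and> code \<gamma> ` ?D \<gamma> \<subseteq> C \<gamma>"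
    by (rule choice[THEN exE])
  have "coded_types A C code"
    by (rule coded_types.intro) (use inf A code in auto)
  then show ?thesis by blast
qed

lemma tower_mono: "tower A C \<Longrightarrow> A' \<subseteq> A \<Longrightarrow> tower A' C"
  by (auto simp: tower_def)

lemma csum_sets: "|X| +c |Y| = |X <+> Y|"
  by (simp add: csum_def Field_card_of)

lemma lessThan_ord_suc:
  assumes "infinite (UNIV :: 'l set)"
  shows "{..<ord_suc \<gamma>} = {..(\<gamma> :: 'l ord_below)}"
proof -
  have "ord_suc \<gamma> \<le> \<delta>" if "\<gamma> < \<delta>" for \<delta> unfolding ord_suc_def using that by (rule Least_le)
  then have "\<delta> < ord_suc \<gamma> \<longleftrightarrow> \<delta> \<le> \<gamma>" for \<delta>
    using ord_suc_greater[OF assms, of \<gamma>] by (metis le_less_trans not_less)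
  then show ?thesis by auto
qed

lemma Plus_Sigma_mono:
  assumes "\<And>\<delta>. \<delta> < \<gamma> \<Longrightarrow> |B \<delta>| \<le>o |C \<delta>|"
  shows "|X <+> (SIGMA \<delta>:{..<(\<gamma> :: 'o :: wellorder)}. Pow (B \<delta>))| \<le>o |X <+> (SIGMA \<delta>:{..<\<gamma>}. Pow (C \<delta>))|"
  by (rule card_of_Plus_mono2, rule card_of_Sigma_mono1) (auto intro: card_Pow_mono assms)

text \<open>
  Besides being a tower, the beth sequence lies below any other tower, even if that one lives in
  another type; this compares the sizes of structures over different types.
\<close>

lemma tower_of_beth:
  fixes K :: "'k set" and \<alpha> :: "'l ord_below"
  assumes inf: "infinite (UNIV :: 'l set)"
    and K: "is_beth (UNIV :: 'l set) {..<ord_suc \<alpha>} K"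
  shows "\<exists>C :: 'l ord_below \<Rightarrow> 'k set. tower {..\<alpha>} C \<and> |Pow (C \<alpha>)| \<le>o |K| \<and>
    (\<forall>D :: 'l ord_below \<Rightarrow> 'q set. tower {..\<alpha>} D \<longrightarrow> |Pow (C \<alpha>)| \<le>o |Pow (D \<alpha>)| )"
proof -
  obtain B :: "'l ord_below \<Rightarrow> 'k set" where
    B: "\<forall>\<beta>\<in>{..\<alpha>}. |B \<beta>| =o |(UNIV :: 'l set) <+> (SIGMA \<gamma>:{..<\<beta>}. Pow (B \<gamma>))|" and
    KB: "|K| =o |(UNIV :: 'l set) <+> (SIGMA \<gamma>:{..\<alpha>}. Pow (B \<gamma>))|"
    using K unfolding is_beth_def csum_sets lessThan_ord_suc[OF inf] by (elim exE conjE) (rule that)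
  have "tower {..\<alpha>} B"
    unfolding tower_def using B ordIso_iff_ordLeq by blast
  moreover have "|Pow (B \<alpha>)| \<le>o |K|"
  proof -
    have "inj_on (\<lambda>c. Inr (\<alpha>, c) :: 'l + 'l ord_below \<times> 'k set) (Pow (B \<alpha>))" by (simp add: inj_on_def)
    moreover have "(\<lambda>c. Inr (\<alpha>, c)) ` Pow (B \<alpha>) \<subseteq> (UNIV :: 'l set) <+> (SIGMA \<gamma>:{..\<alpha>}. Pow (B \<gamma>))" by auto
    ultimately have "|Pow (B \<alpha>)| \<le>o |(UNIV :: 'l set) <+> (SIGMA \<gamma>:{..\<alpha>}. Pow (B \<gamma>))|"
      using card_of_ordLeq by metis
    then show ?thesis using KB by (metis ordIso_iff_ordLeq ordLeq_transitive)
  qed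
  moreover have "|Pow (B \<alpha>)| \<le>o |Pow (D \<alpha>)|" if D: "tower {..\<alpha>} D" for D :: "'l ord_below \<Rightarrow> 'q set"
  proof -
    have "\<gamma> \<le> \<alpha> \<Longrightarrow> |B \<gamma>| \<le>o |D \<gamma>|" for \<gamma>
    proof (induction \<gamma> rule: less_induct)
      case (less \<gamma>)
      have "|B \<gamma>| \<le>o |(UNIV :: 'l set) <+> (SIGMA \<delta>:{..<\<gamma>}. Pow (B \<delta>))|"
        using B less.prems by (simp add: ordIso_iff_ordLeq)
      also have "|(UNIV :: 'l set) <+> (SIGMA \<delta>:{..<\<gamma>}. Pow (B \<delta>))| \<le>o |(UNIV :: 'l set) <+> (SIGMA \<delta>:{..<\<gamma>}. Pow (D \<delta>))|"
        by (rule Plus_Sigma_mono, rule less.IH) (use less.prems in auto)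
      also have "|(UNIV :: 'l set) <+> (SIGMA \<delta>:{..<\<gamma>}. Pow (D \<delta>))| \<le>o |D \<gamma>|"
        using D less.prems by (simp add: tower_def)
      finally show ?case .
    qed
    then show ?thesis by (intro card_Pow_mono) simp
  qed
  ultimately show ?thesis by (intro exI[of _ B]) simp
qed

lemma card_segment_le: "|{..<\<gamma> :: 'l ord_below}| \<le>o |UNIV :: 'l set|"
proof -
  let ?r = "cardSuc |UNIV :: 'l set|"
  let ?u = "underS ?r (Rep_ord_below \<gamma>)"
  have "inj_on Rep_ord_below {..<\<gamma>}" by (simp add: inj_on_def Rep_ord_below_inject)
  moreover have "Rep_ord_below ` {..<\<gamma>} \<subseteq> ?u"
    by (auto simp: underS_def less_ord_below_def less_eq_ord_below_def Rep_ord_below_inject)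
  ultimately have "|{..<\<gamma>}| \<le>o |?u|" using card_of_ordLeq by metis
  moreover have "|?u| <o ?r"
    by (rule card_of_underS[OF Card_order_lambda_plus Rep_ord_below])
  ultimately have "|{..<\<gamma>}| <o ?r" by (rule ordLeq_ordLess_trans)
  then show ?thesis
    using cardSuc_ordLeq_ordLess[OF card_of_Card_order card_of_Card_order] by metis
qed

text \<open>
  The ordinal \<open>\<beta>\<close> that corresponds to \<open>\<lambda>\<close> itself is below \<open>\<lambda>\<^sup>+\<close>.
\<close>

lemma long_segment: "\<exists>\<beta> :: 'l ord_below. |UNIV :: 'l set| \<le>o |{..<\<beta>}|"
proof -
  let ?r = "cardSuc |UNIV :: 'l set|" and ?s = "|UNIV :: 'l set|"
  have wo: "Well_order ?r" "Well_order ?s"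
    using Card_order_lambda_plus card_order_on_def card_of_Well_order by blast+
  have "?s <o ?r" by (simp add: cardSuc_greater card_of_Card_order)
  then obtain a where a: "a \<in> Field ?r" "?s =o Restr ?r (underS ?r a)"
    using ordLess_iff_ordIso_Restr[OF wo] by blast
  have "|Field ?s| =o |Field (Restr ?r (underS ?r a))|" using a(2) by (rule card_of_cong)
  moreover have "Field (Restr ?r (underS ?r a)) \<subseteq> underS ?r a" by (auto simp: Field_def)
  ultimately have 1: "?s \<le>o |underS ?r a|"
    by (metis Field_card_of card_of_mono1 ordIso_ordLeq_trans)
  have sub: "underS ?r a \<subseteq> Field ?r" by (auto simp: underS_def Field_def)
  have "inj_on Abs_ord_below (underS ?r a)"
    using sub by (auto simp: inj_on_def Abs_ord_below_inject subset_iff)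
  moreover have "Abs_ord_below ` underS ?r a \<subseteq> {..<Abs_ord_below a}"
  proof
    fix y assume "y \<in> Abs_ord_below ` underS ?r a"
    then obtain x where x: "x \<in> underS ?r a" "y = Abs_ord_below x" by blast
    then have "x \<in> Field ?r" "x \<noteq> a" "(x, a) \<in> ?r" using sub by (auto simp: underS_def)
    then show "y \<in> {..<Abs_ord_below a}"
      using a(1) by (simp add: x(2) less_ord_below_def less_eq_ord_below_def
        Abs_ord_below_inverse Abs_ord_below_inject)
  qed
  ultimately have "|underS ?r a| \<le>o |{..<Abs_ord_below a}|" using card_of_ordLeq by metis
  with 1 show ?thesis by (metis ordLeq_transitive)
qed

text \<open>
  The value is the ordinal sum \<open>\<beta> + \<gamma>\<close>, described as a strictly increasing function that starts at \<open>\<beta>\<close>.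
\<close>

function shift :: "'o :: wellorder \<Rightarrow> 'o \<Rightarrow> 'o" where
  "shift \<beta> \<gamma> = (LEAST y. \<beta> \<le> y \<and> (\<forall>\<delta>\<in>{..<\<gamma>}. shift \<beta> \<delta> < y))"
  by pat_completeness auto
termination
  by (relation "inv_image {(x, y). x < y} snd") (auto simp: wf)

declare shift.simps [simp del]

lemma shift_greater:
  fixes \<beta> \<gamma> :: "'l ord_below"
  assumes inf: "infinite (UNIV :: 'l set)"
  shows "\<beta> \<le> shift \<beta> \<gamma> \<and> (\<forall>\<delta>\<in>{..<\<gamma>}. shift \<beta> \<delta> < shift \<beta> \<gamma>)"
proof -
  obtain e where e: "inj_on e {..<\<gamma>}" "e ` {..<\<gamma>} \<subseteq> (UNIV :: 'l set)"
    using card_segment_le[of \<gamma>] card_of_ordLeq by metis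
  let ?g = "\<lambda>i. shift \<beta> (inv_into {..<\<gamma>} e i)"
  obtain y where y: "\<forall>i. ?g i < y" using ord_below_bounded[OF inf, of ?g] by metis
  have "\<forall>\<delta>\<in>{..<\<gamma>}. shift \<beta> \<delta> < max \<beta> y"
  proof
    fix \<delta> assume "\<delta> \<in> {..<\<gamma>}"
    then have "inv_into {..<\<gamma>} e (e \<delta>) = \<delta>" using e(1) by simp
    then have "shift \<beta> \<delta> < y" using y by metis
    then show "shift \<beta> \<delta> < max \<beta> y" by (rule less_le_trans) simp
  qed
  then have "\<beta> \<le> max \<beta> y \<and> (\<forall>\<delta>\<in>{..<\<gamma>}. shift \<beta> \<delta> < max \<beta> y)" by simp
  then show ?thesis unfolding shift.simps[of \<beta> \<gamma>] by (rule LeastI)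
qed

text \<open>
  The point is that \<open>\<beth>\<^sub>\<gamma>(\<lambda>) \<le> \<beth>\<^sub>\<beta>\<^sub>+\<^sub>\<gamma>(\<aleph>\<^sub>0)\<close> if \<open>\<lambda> \<le> |\<beta>|\<close>, since \<open>|\<beta>| \<le> \<beth>\<^sub>\<beta>(\<aleph>\<^sub>0)\<close>. As \<open>\<beta> + \<gamma>\<close>
  stays below \<open>\<lambda>\<^sup>+\<close>, starting the beth sequence at \<open>\<aleph>\<^sub>0\<close> instead of \<open>\<lambda>\<close> makes no difference at \<open>\<lambda>\<^sup>+\<close>.
  The sets \<open>X\<close> are strictly between the number of \<open>\<gamma>\<close>-types and \<open>\<beth>\<close> at \<open>\<lambda>\<^sup>+\<close>; models in
  arbitrarily large cardinalities below the latter include one beyond \<open>X\<close>.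
\<close>

lemma tower_below_beth:
  fixes K :: "'k set"
  assumes inf: "infinite (UNIV :: 'l set)"
    and K: "is_beth (UNIV :: nat set) (UNIV :: 'l ord_below set) K"
  shows "\<exists>C :: 'l ord_below \<Rightarrow> 'k set. tower UNIV C \<and> (\<forall>\<gamma>. |Pow (C \<gamma>)| \<le>o |K| ) \<and>
    |UNIV :: 'l ord_below set| \<le>o |K| \<and>
    (\<forall>\<gamma>. \<exists>X :: 'k set. |Pow (C \<gamma>)| <o |X| \<and> |X| <o |K| )"
proof -
  obtain B :: "'l ord_below \<Rightarrow> 'k set" where
    B': "\<forall>\<beta>\<in>UNIV. |B \<beta>| =o |(UNIV :: nat set) <+> (SIGMA \<gamma>:{..<\<beta>}. Pow (B \<gamma>))|" and
    KB: "|K| =o |(UNIV :: nat set) <+> (SIGMA \<gamma>:UNIV. Pow (B \<gamma>))|"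
    using K unfolding is_beth_def csum_sets by (elim exE conjE) (rule that)
  have B: "|(UNIV :: nat set) <+> (SIGMA \<gamma>:{..<\<beta>}. Pow (B \<gamma>))| \<le>o |B \<beta>|" for \<beta>
    using B' by (simp add: ordIso_iff_ordLeq)
  have Bsum: "|SIGMA \<gamma>:{..<\<beta>}. Pow (B \<gamma>)| \<le>o |B \<beta>|" and Bnat: "|UNIV :: nat set| \<le>o |B \<beta>|" for \<beta>
    using B card_of_Plus1 card_of_Plus2 by (metis card_le_trans)+
  have Binf: "infinite (B \<beta>)" for \<beta> using Bnat infinite_iff_card_of_nat by metis
  have Bpow: "|Pow (B \<delta>)| \<le>o |B \<beta>|" if "\<delta> < \<beta>" for \<delta> \<beta>
  proof -
    have "inj_on (\<lambda>c. (\<delta>, c)) (Pow (B \<delta>))" by (simp add: inj_on_def)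
    moreover have "(\<lambda>c. (\<delta>, c)) ` Pow (B \<delta>) \<subseteq> (SIGMA \<gamma>:{..<\<beta>}. Pow (B \<gamma>))" using that by auto
    ultimately have "|Pow (B \<delta>)| \<le>o |SIGMA \<gamma>:{..<\<beta>}. Pow (B \<gamma>)|" using card_of_ordLeq by metis
    then show ?thesis using Bsum by (rule card_le_trans)
  qed
  have Bseg: "|{..<\<beta>}| \<le>o |B \<beta>|" for \<beta>
  proof -
    have "inj_on (\<lambda>\<gamma>. (\<gamma>, {})) {..<\<beta>}" by (simp add: inj_on_def)
    moreover have "(\<lambda>\<gamma>. (\<gamma>, {})) ` {..<\<beta>} \<subseteq> (SIGMA \<gamma>:{..<\<beta>}. Pow (B \<gamma>))" by auto
    ultimately have "|{..<\<beta>}| \<le>o |SIGMA \<gamma>:{..<\<beta>}. Pow (B \<gamma>)|" using card_of_ordLeq by metis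
    then show ?thesis using Bsum by (rule card_le_trans)
  qed
  have KB': "|SIGMA \<gamma>:UNIV. Pow (B \<gamma>)| \<le>o |K|"
    using KB card_of_Plus2 by (metis card_le_trans ordIso_iff_ordLeq)
  have BK: "|Pow (B \<delta>)| \<le>o |K|" for \<delta>
  proof -
    have "inj_on (\<lambda>c. (\<delta>, c)) (Pow (B \<delta>))" by (simp add: inj_on_def)
    moreover have "(\<lambda>c. (\<delta>, c)) ` Pow (B \<delta>) \<subseteq> (SIGMA \<gamma>:UNIV. Pow (B \<gamma>))" by auto
    ultimately have "|Pow (B \<delta>)| \<le>o |SIGMA \<gamma>:UNIV. Pow (B \<gamma>)|" using card_of_ordLeq by metis
    then show ?thesis using KB' by (rule card_le_trans)
  qed
  obtain \<beta> :: "'l ord_below" where \<beta>: "|UNIV :: 'l set| \<le>o |{..<\<beta>}|" using long_segment by metis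
  let ?f = "shift \<beta>"
  have f: "\<beta> \<le> ?f \<gamma>" "\<delta> < \<gamma> \<Longrightarrow> ?f \<delta> < ?f \<gamma>" for \<gamma> \<delta> using shift_greater[OF inf, of \<beta> \<gamma>] by auto
  have "inj ?f"
    by (rule injI) (metis f(2) less_irrefl linorder_neqE)
  have "tower UNIV (\<lambda>\<gamma>. B (?f \<gamma>))"
    unfolding tower_def
  proof
    fix \<gamma> :: "'l ord_below"
    have "{..<\<beta>} \<subseteq> {..<?f \<gamma>}" using f(1) by (auto intro: less_le_trans)
    then have "|{..<\<beta>}| \<le>o |{..<?f \<gamma>}|" by (rule card_of_mono1)
    then have 1: "|UNIV :: 'l set| \<le>o |B (?f \<gamma>)|" using \<beta> Bseg card_le_trans by metis
    have "inj_on (\<lambda>(\<delta>, c). (?f \<delta>, c)) (SIGMA \<delta>:{..<\<gamma>}. Pow (B (?f \<delta>)))"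
      using \<open>inj ?f\<close> by (auto simp: inj_on_def)
    moreover have "(\<lambda>(\<delta>, c). (?f \<delta>, c)) ` (SIGMA \<delta>:{..<\<gamma>}. Pow (B (?f \<delta>))) \<subseteq> (SIGMA \<delta>:{..<?f \<gamma>}. Pow (B \<delta>))"
      using f(2) by auto
    ultimately have "|SIGMA \<delta>:{..<\<gamma>}. Pow (B (?f \<delta>))| \<le>o |SIGMA \<delta>:{..<?f \<gamma>}. Pow (B \<delta>)|"
      using card_of_ordLeq by metis
    then have "|SIGMA \<delta>:{..<\<gamma>}. Pow (B (?f \<delta>))| \<le>o |B (?f \<gamma>)|" using Bsum by (rule card_le_trans)
    with 1 show "|(UNIV :: 'l set) <+> (SIGMA \<delta>:{..<\<gamma>}. Pow (B (?f \<delta>)))| \<le>o |B (?f \<gamma>)|"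
      by (rule card_Plus_le[OF Binf])
  qed
  moreover have "|UNIV :: 'l ord_below set| \<le>o |K|"
  proof -
    have "inj_on (\<lambda>\<gamma> :: 'l ord_below. (\<gamma>, {} :: 'k set)) UNIV" by (simp add: inj_on_def)
    moreover have "range (\<lambda>\<gamma> :: 'l ord_below. (\<gamma>, {})) \<subseteq> (SIGMA \<gamma>:UNIV. Pow (B \<gamma>))" by auto
    ultimately have "|UNIV :: 'l ord_below set| \<le>o |SIGMA \<gamma>:UNIV. Pow (B \<gamma>)|" using card_of_ordLeq by metis
    then show ?thesis using KB' by (rule card_le_trans)
  qed
  moreover have "\<exists>X :: 'k set. |Pow (B (?f \<gamma>))| <o |X| \<and> |X| <o |K|" for \<gamma>
  proof (intro exI conjI)
    \<comment> \<open>Two more steps of the sequence: the first covers the power set, the second makes the inequality strict.\<close>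
    let ?y = "ord_suc (?f \<gamma>)" and ?z = "ord_suc (ord_suc (?f \<gamma>))"
    have "|Pow (B (?f \<gamma>))| \<le>o |B ?y|" by (rule Bpow[OF ord_suc_greater[OF inf]])
    also have "|B ?y| <o |Pow (B ?y)|" by (rule card_of_Pow)
    also have "|Pow (B ?y)| \<le>o |B ?z|" by (rule Bpow[OF ord_suc_greater[OF inf]])
    finally show "|Pow (B (?f \<gamma>))| <o |B ?z|" .
    show "|B ?z| <o |K|" using card_of_Pow BK by (rule ordLess_ordLeq_trans)
  qed
  ultimately show ?thesis using BK by (intro exI[of _ "\<lambda>\<gamma>. B (?f \<gamma>)"]) simp
qed

section \<open>Spectra of sentences and theories\<close>

lemma sentence_spectrum_unbounded:
  fixes \<psi> :: "('l, 'v) fm" and S :: "('l, 'm) struc" and C :: "'l ord_below \<Rightarrow> 'k set"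
  assumes inf: "infinite (UNIV :: 'l set)" and \<psi>: "sentence \<psi>"
    and S: "models S {\<psi>}" and C: "tower {..qd \<psi>} C" and big: "|Pow (C (qd \<psi>))| <o |univ S|"
  shows "\<exists>S' :: ('l, 'm + 'b) struc. models S' {\<psi>} \<and> |UNIV :: ('m + 'b) set| \<le>o |univ S'|"
proof -
  obtain code where "coded_types {..qd \<psi>} C code"
    using coded_types_exist[OF inf C] by (meson atMost_iff order_trans)
  then interpret coded_types "{..qd \<psi>}" C code .
  let ?K = "Pow (C (qd \<psi>))"
  have S_struc: "is_struc S" using S by (simp add: models_def)
  have "|{qd \<psi>}| \<le>o |?K|" by (rule card_of_singl_ordLeq) auto
  moreover have "|Pow (C \<alpha>)| \<le>o |?K|" if "\<alpha> \<in> {qd \<psi>}" for \<alpha>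
    using that card_of_mono1[OF order_refl, of ?K] by simp
  ultimately have "\<exists>(S' :: ('l, 'm + 'b) struc) a a'. a \<in> univ S \<and> is_struc S' \<and> a' \<in> univ S' \<and>
    |UNIV :: ('m + 'b) set| \<le>o |univ S'| \<and> (\<forall>\<alpha>\<in>{qd \<psi>}. tp \<alpha> S (\<lambda>_. a) = tp \<alpha> S' (\<lambda>_. a'))"
    by (intro upward[OF S_struc _ _ _ _ big]) simp_all
  then obtain S' :: "('l, 'm + 'b) struc" and a a' where S': "a \<in> univ S" "is_struc S'" "a' \<in> univ S'"
    "|UNIV :: ('m + 'b) set| \<le>o |univ S'|" "tp (qd \<psi>) S (\<lambda>_. a) = tp (qd \<psi>) S' (\<lambda>_. a')"
    by auto
  then have "models S' {\<psi>}"
    using models_transfer[OF \<psi> order_refl _ S S'(1,2,3,5)] by simp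
  then show ?thesis using S'(4) by metis
qed

text \<open>
  The types are coded in the tower of the target type, whose sets have exactly the cardinalities
  \<open>\<beth>\<^sub>\<gamma>(\<lambda>)\<close>. The tower \<open>C\<close> may be larger, in which case its number of types could exceed \<open>|X|\<close>.
\<close>

lemma sentence_exact:
  fixes \<psi> :: "('l, 'v) fm" and S :: "('l, 'm) struc" and C :: "'l ord_below \<Rightarrow> 'k set" and X :: "'b set"
  assumes inf: "infinite (UNIV :: 'l set)" and \<psi>: "sentence \<psi>"
    and S: "models S {\<psi>}" and C: "tower {..qd \<psi>} C" and big: "|Pow (C (qd \<psi>))| <o |univ S|"
    and X: "above_beth (UNIV :: 'l set) {..<ord_suc (qd \<psi>)} X"
  shows "\<exists>S' :: ('l, 'b) struc. models S' {\<psi>} \<and> |univ S'| =o |X|"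
proof -
  obtain K :: "'b set" where K: "is_beth (UNIV :: 'l set) {..<ord_suc (qd \<psi>)} K" "|K| <o |X|"
    using X unfolding above_beth_def by metis
  obtain D :: "'l ord_below \<Rightarrow> 'b set" where D: "tower {..qd \<psi>} D" "|Pow (D (qd \<psi>))| \<le>o |K|"
    "|Pow (D (qd \<psi>))| \<le>o |Pow (C (qd \<psi>))|"
    using tower_of_beth[OF inf K(1)] C by metis
  obtain code where "coded_types {..qd \<psi>} D code"
    using coded_types_exist[OF inf D(1)] by (meson atMost_iff order_trans)
  then interpret coded_types "{..qd \<psi>}" D code .
  have S_struc: "is_struc S" using S by (simp add: models_def)
  have "|Pow (D (qd \<psi>))| <o |univ S|" using D(3) big by (rule ordLeq_ordLess_trans)
  moreover have "|Pow (D (qd \<psi>))| <o |X|" using D(2) K(2) by (rule ordLeq_ordLess_trans)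
  moreover have A: "qd \<psi> \<in> {..qd \<psi>}" by simp
  ultimately obtain S' :: "('l, 'b) struc" and a a' where S': "a \<in> univ S" "is_struc S'" "a' \<in> univ S'"
    "|univ S'| =o |X|" "tp (qd \<psi>) S (\<lambda>_. a) = tp (qd \<psi>) S' (\<lambda>_. a')"
    using exact_cardinality[OF S_struc A] by metis
  then have "models S' {\<psi>}"
    using models_transfer[OF \<psi> order_refl A S S'(1,2,3,5)] by simp
  then show ?thesis using S'(4) by metis
qed

lemma theory_spectrum_unbounded:
  fixes T :: "('l, 'v) fm set" and S :: "('l, 'm) struc"
  assumes inf: "infinite (UNIV :: 'l set)" and T: "\<forall>\<phi>\<in>T. sentence \<phi>" and S: "models S T"
    and big: "above_beth (UNIV :: nat set) (UNIV :: 'l ord_below set) (univ S)"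
  shows "\<exists>S' :: ('l, 'm + 'b) struc. models S' T \<and> |UNIV :: ('m + 'b) set| \<le>o |univ S'|"
proof -
  obtain K :: "'m set" where K: "is_beth (UNIV :: nat set) (UNIV :: 'l ord_below set) K" "|K| <o |univ S|"
    using big unfolding above_beth_def by metis
  obtain C :: "'l ord_below \<Rightarrow> 'm set" where C: "tower UNIV C" "\<And>\<gamma>. |Pow (C \<gamma>)| \<le>o |K|"
    "|UNIV :: 'l ord_below set| \<le>o |K|"
    using tower_below_beth[OF inf K(1)] by metis
  obtain code where "coded_types UNIV C code"
    using coded_types_exist[OF inf C(1)] by (meson UNIV_I)
  then interpret coded_types UNIV C code .
  have S_struc: "is_struc S" using S by (simp add: models_def)
  have "\<exists>(S' :: ('l, 'm + 'b) struc) a a'. a \<in> univ S \<and> is_struc S' \<and> a' \<in> univ S' \<and>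
    |UNIV :: ('m + 'b) set| \<le>o |univ S'| \<and> (\<forall>\<alpha>\<in>UNIV. tp \<alpha> S (\<lambda>_. a) = tp \<alpha> S' (\<lambda>_. a'))"
    by (rule upward[OF S_struc subset_UNIV C(3) UNIV_not_empty C(2) K(2)])
  then obtain S' :: "('l, 'm + 'b) struc" and a a' where S': "a \<in> univ S" "is_struc S'" "a' \<in> univ S'"
    "|UNIV :: ('m + 'b) set| \<le>o |univ S'|" and eq: "\<And>\<alpha>. tp \<alpha> S (\<lambda>_. a) = tp \<alpha> S' (\<lambda>_. a')"
    by auto
  have "models S' {\<phi>}" if "\<phi> \<in> T" for \<phi>
  proof (rule models_transfer[OF _ order_refl UNIV_I _ S'(1,2,3) eq])
    show "sentence \<phi>" using T that by blast
    show "models S {\<phi>}" using S that by (simp add: models_def)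
  qed
  then have "models S' T" using S'(2) by (auto simp: models_def)
  then show ?thesis using S'(4) by metis
qed

theorem theorem2p3:
  fixes \<psi> :: "('l, 'v) fm" and T :: "('l, 'v) fm set"
  assumes "infinite (UNIV :: 'l set)"
  shows
    "(sentence \<psi> \<and>
        ((\<exists>K :: 'm set. is_beth (UNIV :: nat set) (UNIV :: 'l ord_below set) K \<and>
            (\<forall>X :: 'm set. |X| <o |K| \<longrightarrow>
              (\<exists>S :: ('l, 'm) struc. models S {\<psi>} \<and> |X| \<le>o |univ S| \<and> |univ S| <o |K| )))
         \<or> (\<exists>S :: ('l, 'm) struc. models S {\<psi>} \<and>
              above_beth (UNIV :: 'l set) {..<ord_suc (qd \<psi>)} (univ S)))
      \<longrightarrow>
        (\<forall>X :: 'b set. \<exists>S :: ('l, 'm + 'b) struc. models S {\<psi>} \<and> |X| \<le>o |univ S| ) \<and>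
        (\<forall>X :: 'b set. above_beth (UNIV :: 'l set) {..<ord_suc (qd \<psi>)} X \<longrightarrow>
              (\<exists>S :: ('l, 'b) struc. models S {\<psi>} \<and> |univ S| =o |X| )))
     \<and>
     ((\<forall>\<phi>\<in>T. sentence \<phi>) \<and>
        (\<exists>S :: ('l, 'm) struc. models S T \<and>
              above_beth (UNIV :: nat set) (UNIV :: 'l ord_below set) (univ S))
      \<longrightarrow>
        (\<forall>X :: 'b set. \<exists>S :: ('l, 'm + 'b) struc. models S T \<and> |X| \<le>o |univ S| ))"
proof (intro conjI impI; elim conjE)
  have b_le: "|X| \<le>o |UNIV :: ('m + 'b) set|" for X :: "'b set"
    using card_of_ordLeq[of X "UNIV :: ('m + 'b) set"] by (metis inj_Inr inj_on_subset subset_UNIV)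
  assume \<psi>: "sentence \<psi>" and
    models: "(\<exists>K :: 'm set. is_beth (UNIV :: nat set) (UNIV :: 'l ord_below set) K \<and>
            (\<forall>X :: 'm set. |X| <o |K| \<longrightarrow>
              (\<exists>S :: ('l, 'm) struc. models S {\<psi>} \<and> |X| \<le>o |univ S| \<and> |univ S| <o |K| )))
         \<or> (\<exists>S :: ('l, 'm) struc. models S {\<psi>} \<and>
              above_beth (UNIV :: 'l set) {..<ord_suc (qd \<psi>)} (univ S))"
  obtain S :: "('l, 'm) struc" and C :: "'l ord_below \<Rightarrow> 'm set"
    where S: "models S {\<psi>}" "tower {..qd \<psi>} C" "|Pow (C (qd \<psi>))| <o |univ S|"
    using models
  proof (elim disjE exE conjE)
    fix K :: "'m set"
    assume K: "is_beth (UNIV :: nat set) (UNIV :: 'l ord_below set) K"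
      and all: "\<forall>X :: 'm set. |X| <o |K| \<longrightarrow>
              (\<exists>S :: ('l, 'm) struc. models S {\<psi>} \<and> |X| \<le>o |univ S| \<and> |univ S| <o |K| )"
    obtain C :: "'l ord_below \<Rightarrow> 'm set" where C: "tower UNIV C"
      "\<forall>\<gamma>. \<exists>X :: 'm set. |Pow (C \<gamma>)| <o |X| \<and> |X| <o |K|"
      using tower_below_beth[OF assms K] by metis
    obtain X :: "'m set" where X: "|Pow (C (qd \<psi>))| <o |X|" "|X| <o |K|" using C(2) by metis
    obtain S :: "('l, 'm) struc" where "models S {\<psi>}" "|X| \<le>o |univ S|" using all X(2) by metis
    moreover from X(1) this(2) have "|Pow (C (qd \<psi>))| <o |univ S|" by (rule ordLess_ordLeq_trans)
    ultimately show thesis using tower_mono[OF C(1) subset_UNIV] that by metis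
  next
    fix S :: "('l, 'm) struc"
    assume S: "models S {\<psi>}" and big: "above_beth (UNIV :: 'l set) {..<ord_suc (qd \<psi>)} (univ S)"
    obtain K :: "'m set" where K: "is_beth (UNIV :: 'l set) {..<ord_suc (qd \<psi>)} K" "|K| <o |univ S|"
      using big unfolding above_beth_def by metis
    obtain C :: "'l ord_below \<Rightarrow> 'm set" where C: "tower {..qd \<psi>} C" "|Pow (C (qd \<psi>))| \<le>o |K|"
      using tower_of_beth[OF assms K(1)] by metis
    from C(2) K(2) have "|Pow (C (qd \<psi>))| <o |univ S|" by (rule ordLeq_ordLess_trans)
    then show thesis using S C(1) that by metis
  qed
  show "\<forall>X :: 'b set. \<exists>S :: ('l, 'm + 'b) struc. models S {\<psi>} \<and> |X| \<le>o |univ S|"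
    using sentence_spectrum_unbounded[OF assms \<psi> S, where 'b = 'b] b_le card_le_trans by metis
  show "\<forall>X :: 'b set. above_beth (UNIV :: 'l set) {..<ord_suc (qd \<psi>)} X \<longrightarrow>
              (\<exists>S :: ('l, 'b) struc. models S {\<psi>} \<and> |univ S| =o |X| )"
    using sentence_exact[OF assms \<psi> S] by metis
next
  have b_le: "|X| \<le>o |UNIV :: ('m + 'b) set|" for X :: "'b set"
    using card_of_ordLeq[of X "UNIV :: ('m + 'b) set"] by (metis inj_Inr inj_on_subset subset_UNIV)
  assume T: "\<forall>\<phi>\<in>T. sentence \<phi>" and "\<exists>S :: ('l, 'm) struc. models S T \<and>
              above_beth (UNIV :: nat set) (UNIV :: 'l ord_below set) (univ S)"
  then obtain S :: "('l, 'm) struc" where S: "models S T"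
    "above_beth (UNIV :: nat set) (UNIV :: 'l ord_below set) (univ S)" by metis
  show "\<forall>X :: 'b set. \<exists>S :: ('l, 'm + 'b) struc. models S T \<and> |X| \<le>o |univ S|"
    using theory_spectrum_unbounded[OF assms T S, where 'b = 'b] b_le card_le_trans by metis
qed

end
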